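(* Let $k$ be an algebraically closed field and $f\in k[X_1,\ldots,X_n]$. Then there exists $q\in\mathbb{N}$ with $q\le 2^{\overline{L}(f)^2}$ such that $\overline{L}_q(f)\le 2\,\overline{L}(f)$.
   Context: Approximative complexity: with $K=k(\epsilon)$ and $R\subseteq K$ the rational functions defined at $\epsilon=0$, $\overline{L}(f)$ is the least $r$ such that some $F\in R[X]$ whose image under $\epsilon\mapsto0$ is $f$ can be computed by a division-free straight-line program ($+,-,\times$ operations) of length $\le r$ from the variables with free constants from $K$. For $q\in\mathbb{N}$, $\overline{L}_q(f)$ is the least $r$ such that there is $f'\in k[[\epsilon]][X]$ with $\epsilon^qf+\epsilon^{q+1}f'$ computable by a division-free straight-line program of length $\le r$ in $k[[\epsilon]][X]$ from the variables with free constants from $k[[\epsilon]]$. *)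

theory Defs
  imports
    "HOL-Library.Poly_Mapping"
    "HOL-Computational_Algebra.Computational_Algebra"
begin

section \<open>Polynomials in finitely many variables\<close>

text \<open>
  A monomial is an exponent vector of finite support, and the convolution product of
  \<^theory>\<open>HOL-Library.Poly_Mapping\<close> is the multiplication of polynomials. The variables
  \<open>X_1, \<dots>, X_n\<close> are numbered \<open>0, \<dots>, n - 1\<close>, and \<open>mpolys n\<close> is the polynomial ring in them.
\<close>

type_synonym 'a mpoly = "(nat \<Rightarrow>\<^sub>0 nat) \<Rightarrow>\<^sub>0 'a"

definition mpolys :: "nat \<Rightarrow> 'a::zero mpoly set" where
  "mpolys n = {p. \<forall>m \<in> Poly_Mapping.keys p. Poly_Mapping.keys m \<subseteq> {..<n}}"

definition mconst :: "'a::zero \<Rightarrow> 'a mpoly" where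
  "mconst c = Poly_Mapping.single 0 c"

definition mvar :: "nat \<Rightarrow> 'a::zero_neq_one mpoly" where
  "mvar i = Poly_Mapping.single (Poly_Mapping.single i 1) 1"


section \<open>Division-free straight-line programs\<close>

text \<open>
  Only the arithmetic instructions count towards the length: constants and variables may be used
  as operands at no cost. \<open>Res j\<close> refers to the result of instruction \<open>j\<close> (counted from \<open>0\<close>),
  which must precede the instruction that uses it.
\<close>

datatype 'a operand = Const 'a | Var nat | Res nat

datatype 'a instr =
  Add "'a operand" "'a operand"
| Sub "'a operand" "'a operand"
| Mul "'a operand" "'a operand"

type_synonym 'a slp = "'a instr list"

fun wf_operand :: "nat \<Rightarrow> nat \<Rightarrow> 'a operand \<Rightarrow> bool" where
  "wf_operand n k (Const c) = True"
| "wf_operand n k (Var i) = (i < n)"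
| "wf_operand n k (Res j) = (j < k)"

fun wf_instr :: "nat \<Rightarrow> nat \<Rightarrow> 'a instr \<Rightarrow> bool" where
  "wf_instr n k (Add a b) = (wf_operand n k a \<and> wf_operand n k b)"
| "wf_instr n k (Sub a b) = (wf_operand n k a \<and> wf_operand n k b)"
| "wf_instr n k (Mul a b) = (wf_operand n k a \<and> wf_operand n k b)"

definition wf_slp :: "nat \<Rightarrow> 'a slp \<Rightarrow> bool" where
  "wf_slp n P \<longleftrightarrow> (\<forall>k < length P. wf_instr n k (P ! k))"

fun operand_val :: "'a::comm_ring_1 mpoly list \<Rightarrow> 'a operand \<Rightarrow> 'a mpoly" where
  "operand_val vs (Const c) = mconst c"
| "operand_val vs (Var i) = mvar i"
| "operand_val vs (Res j) = vs ! j"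

fun instr_val :: "'a::comm_ring_1 mpoly list \<Rightarrow> 'a instr \<Rightarrow> 'a mpoly" where
  "instr_val vs (Add a b) = operand_val vs a + operand_val vs b"
| "instr_val vs (Sub a b) = operand_val vs a - operand_val vs b"
| "instr_val vs (Mul a b) = operand_val vs a * operand_val vs b"

definition slp_results :: "'a::comm_ring_1 slp \<Rightarrow> 'a mpoly list" where
  "slp_results P = foldl (\<lambda>vs I. vs @ [instr_val vs I]) [] P"

text \<open>
  The output is designated by an operand, so that constants and variables are computed by the
  empty program.
\<close>

definition slp_computes :: "nat \<Rightarrow> 'a::comm_ring_1 slp \<Rightarrow> 'a mpoly \<Rightarrow> bool" where
  "slp_computes n P F \<longleftrightarrow>
     wf_slp n P \<and> (\<exists>out. wf_operand n (length P) out \<and> operand_val (slp_results P) out = F)"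

definition computable_within :: "nat \<Rightarrow> nat \<Rightarrow> 'a::comm_ring_1 mpoly \<Rightarrow> bool" where
  "computable_within n r F \<longleftrightarrow> (\<exists>P. length P \<le> r \<and> slp_computes n P F)"

text \<open>
  Every polynomial is computable, so the minima defining the complexities below exist.
\<close>

fun shift_operand :: "nat \<Rightarrow> 'a operand \<Rightarrow> 'a operand" where
  "shift_operand l (Res j) = Res (l + j)"
| "shift_operand l a = a"

fun shift_instr :: "nat \<Rightarrow> 'a instr \<Rightarrow> 'a instr" where
  "shift_instr l (Add a b) = Add (shift_operand l a) (shift_operand l b)"
| "shift_instr l (Sub a b) = Sub (shift_operand l a) (shift_operand l b)"
| "shift_instr l (Mul a b) = Mul (shift_operand l a) (shift_operand l b)"

lemma slp_results_Nil [simp]: "slp_results [] = []"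
  by (simp add: slp_results_def)

lemma slp_results_snoc [simp]:
  "slp_results (P @ [I]) = slp_results P @ [instr_val (slp_results P) I]"
  by (simp add: slp_results_def)

lemma length_slp_results [simp]: "length (slp_results P) = length P"
  by (induction P rule: rev_induct) simp_all

lemma wf_slp_snoc: "wf_slp n (P @ [I]) \<longleftrightarrow> wf_slp n P \<and> wf_instr n (length P) I"
  by (auto simp: wf_slp_def nth_append less_Suc_eq)

lemma wf_operand_shift: "wf_operand n k a \<Longrightarrow> wf_operand n (l + k) (shift_operand l a)"
  by (cases a) auto

lemma wf_instr_shift: "wf_instr n k I \<Longrightarrow> wf_instr n (l + k) (shift_instr l I)"
  by (cases I) (auto simp: wf_operand_shift)

lemma operand_val_append:
  "wf_operand n (length vs) a \<Longrightarrow> operand_val (vs @ ws) a = operand_val vs a"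
  by (cases a) (auto simp: nth_append)

lemma operand_val_shift:
  "wf_operand n k a \<Longrightarrow> operand_val (vs @ ws) (shift_operand (length vs) a) = operand_val ws a"
  by (cases a) (auto simp: nth_append)

lemma instr_val_shift:
  "wf_instr n k I \<Longrightarrow> instr_val (vs @ ws) (shift_instr (length vs) I) = instr_val ws I"
  by (cases I) (auto simp: operand_val_shift)

lemma slp_results_shift:
  "wf_slp n Q \<Longrightarrow>
     slp_results (P @ map (shift_instr (length P)) Q) = slp_results P @ slp_results Q"
proof (induction Q rule: rev_induct)
  case (snoc I Q)
  then have IH: "slp_results (P @ map (shift_instr (length P)) Q) = slp_results P @ slp_results Q"
    and I: "wf_instr n (length Q) I"
    by (auto simp: wf_slp_snoc)
  have "slp_results (P @ map (shift_instr (length P)) (Q @ [I])) =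
      slp_results ((P @ map (shift_instr (length P)) Q) @ [shift_instr (length P) I])"
    by simp
  also have "\<dots> = slp_results P @ slp_results Q @
      [instr_val (slp_results P @ slp_results Q) (shift_instr (length (slp_results P)) I)]"
    unfolding slp_results_snoc IH by simp
  also have "\<dots> = slp_results P @ slp_results (Q @ [I])"
    using instr_val_shift[OF I, of "slp_results P" "slp_results Q"] by simp
  finally show ?case .
qed simp

lemma wf_slp_shift:
  "wf_slp n P \<Longrightarrow> wf_slp n Q \<Longrightarrow> wf_slp n (P @ map (shift_instr (length P)) Q)"
proof (induction Q rule: rev_induct)
  case (snoc I Q)
  then show ?case
    using wf_slp_snoc[of n "P @ map (shift_instr (length P)) Q" "shift_instr (length P) I"]
    by (auto simp: wf_slp_snoc wf_instr_shift)
qed simp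

lemma computable_binop:
  fixes op :: "'a::comm_ring_1 operand \<Rightarrow> 'a operand \<Rightarrow> 'a instr"
    and F G H :: "'a mpoly"
  assumes "computable_within n r F" "computable_within n s G"
    and op: "op = Add \<and> H = F + G \<or> op = Sub \<and> H = F - G \<or> op = Mul \<and> H = F * G"
  shows "computable_within n (Suc (r + s)) H"
proof -
  obtain P a where P: "length P \<le> r" "wf_slp n P" "wf_operand n (length P) a"
    "operand_val (slp_results P) a = F"
    using assms(1) by (auto simp: computable_within_def slp_computes_def)
  obtain Q b where Q: "length Q \<le> s" "wf_slp n Q" "wf_operand n (length Q) b"
    "operand_val (slp_results Q) b = G"
    using assms(2) by (auto simp: computable_within_def slp_computes_def)
  define b' where "b' = shift_operand (length P) b"
  define PQ where "PQ = P @ map (shift_instr (length P)) Q"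
  have len: "length PQ = length P + length Q" by (simp add: PQ_def)
  have res: "slp_results PQ = slp_results P @ slp_results Q"
    unfolding PQ_def by (rule slp_results_shift[OF Q(2)])
  have wfa: "wf_operand n (length PQ) a"
    using P(3) len by (cases a) auto
  have wfb: "wf_operand n (length PQ) b'"
    unfolding b'_def len by (rule wf_operand_shift[OF Q(3)])
  have va: "operand_val (slp_results PQ) a = F"
    unfolding res using operand_val_append[of n "slp_results P" a] P by simp
  have vb: "operand_val (slp_results PQ) b' = G"
    unfolding res b'_def using operand_val_shift[OF Q(3), of "slp_results P"] Q by simp
  have "wf_slp n (PQ @ [op a b'])"
    using wf_slp_shift[OF P(2) Q(2)] wfa wfb op by (auto simp: wf_slp_snoc PQ_def[symmetric])
  moreover have "operand_val (slp_results (PQ @ [op a b'])) (Res (length PQ)) = H"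
    using op va vb by (auto simp: nth_append)
  moreover have "wf_operand n (length (PQ @ [op a b'])) (Res (length PQ))"
    by simp
  ultimately have "slp_computes n (PQ @ [op a b']) H"
    unfolding slp_computes_def by blast
  moreover have "length (PQ @ [op a b']) \<le> Suc (r + s)"
    using P(1) Q(1) len by simp
  ultimately show ?thesis
    unfolding computable_within_def by blast
qed

lemma computable_mconst: "computable_within n 0 (mconst c)"
  unfolding computable_within_def slp_computes_def
  by (intro exI[of _ "[]"] conjI exI[of _ "Const c"]) (simp_all add: wf_slp_def)

lemma computable_mvar: "i < n \<Longrightarrow> computable_within n 0 (mvar i)"
  unfolding computable_within_def slp_computes_def
  by (intro exI[of _ "[]"] conjI exI[of _ "Var i"]) (simp_all add: wf_slp_def)

lemma computable_var_power:
  assumes "i < n"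
  shows "\<exists>r. computable_within n r
           (Poly_Mapping.single (Poly_Mapping.single i k) (1 :: 'a::comm_ring_1))"
proof (induction k)
  case 0
  then show ?case
    using computable_mconst[of n 1] by (auto simp: mconst_def)
next
  case (Suc k)
  have "Poly_Mapping.single (Poly_Mapping.single i (Suc k)) (1 :: 'a) =
      mvar i * Poly_Mapping.single (Poly_Mapping.single i k) 1"
    by (simp add: mvar_def mult_single single_add[symmetric])
  then show ?case
    using Suc computable_binop computable_mvar[OF assms] by metis
qed

lemma computable_monomial:
  "Poly_Mapping.keys m \<subseteq> {..<n} \<Longrightarrow>
     \<exists>r. computable_within n r (Poly_Mapping.single m (c :: 'a::comm_ring_1))"
proof (induction m rule: update_induct)
  case const
  then show ?case
    using computable_mconst[of n c] by (auto simp: mconst_def)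
next
  case (update m i k)
  have "m + Poly_Mapping.single i k = Poly_Mapping.update i k m"
    using update.hyps by (intro poly_mapping_eqI)
      (auto simp: lookup_add lookup_update lookup_single in_keys_iff)
  then have "Poly_Mapping.single (Poly_Mapping.update i k m) c =
      Poly_Mapping.single m c * Poly_Mapping.single (Poly_Mapping.single i k) 1"
    by (simp add: mult_single)
  moreover have "i < n" "Poly_Mapping.keys m \<subseteq> {..<n}"
    using update.prems update.hyps by (auto simp: keys_update split: if_splits)
  ultimately show ?case
    using update.IH computable_var_power[of i n k] computable_binop by metis
qed

lemma computable_mpolys:
  "F \<in> mpolys n \<Longrightarrow> \<exists>r. computable_within n r (F :: 'a::comm_ring_1 mpoly)"
proof (induction F rule: update_induct)
  case const
  then show ?case
    using computable_mconst[of n 0] by (auto simp: mconst_def)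
next
  case (update F m c)
  have "F + Poly_Mapping.single m c = Poly_Mapping.update m c F"
    using update.hyps by (intro poly_mapping_eqI)
      (auto simp: lookup_add lookup_update lookup_single in_keys_iff)
  moreover have "F \<in> mpolys n" "Poly_Mapping.keys m \<subseteq> {..<n}"
    using update.prems update.hyps by (auto simp: mpolys_def keys_update split: if_splits)
  ultimately show ?case
    using update.IH computable_monomial[of m n c] computable_binop by metis
qed



section \<open>Approximative complexity\<close>

text \<open>
  \<open>K = k(\<epsilon>)\<close> is the field of fractions of the polynomial ring \<open>k[\<epsilon>]\<close>, \<open>regular_at_0\<close> is its
  subring \<open>R\<close>, and \<open>at_eps_0\<close>, which is only meaningful on \<open>R\<close>, is the substitution of \<open>0\<close>
  for \<open>\<epsilon>\<close>.
\<close>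

definition regular_at_0 :: "'k::field poly fract set" where
  "regular_at_0 = {Fract a b | a b. poly b 0 \<noteq> 0}"

definition at_eps_0 :: "'k::field poly fract \<Rightarrow> 'k" where
  "at_eps_0 x = (THE c. \<exists>a b. x = Fract a b \<and> poly b 0 \<noteq> 0 \<and> c = poly a 0 / poly b 0)"

lemma at_eps_0_Fract:
  fixes a b :: "'k::field poly"
  assumes "poly b 0 \<noteq> 0"
  shows "at_eps_0 (Fract a b) = poly a 0 / poly b 0"
  unfolding at_eps_0_def
proof (rule the_equality)
  show "\<exists>a' b'. Fract a b = Fract a' b' \<and> poly b' 0 \<noteq> 0 \<and> poly a 0 / poly b 0 = poly a' 0 / poly b' 0"
    using assms by blast
next
  fix c
  assume "\<exists>a' b'. Fract a b = Fract a' b' \<and> poly b' 0 \<noteq> 0 \<and> c = poly a' 0 / poly b' 0"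
  then obtain a' b' where *: "Fract a b = Fract a' b'" "poly b' 0 \<noteq> 0" "c = poly a' 0 / poly b' 0"
    by blast
  have "b \<noteq> 0" "b' \<noteq> 0"
    using assms *(2) by auto
  with *(1) have "a * b' = a' * b"
    by (simp add: eq_fract)
  then have "poly a 0 * poly b' 0 = poly a' 0 * poly b 0"
    by (metis poly_mult)
  then show "c = poly a 0 / poly b 0"
    using assms *(2,3) by (simp add: frac_eq_eq)
qed

lemma at_eps_0_zero [simp]: "at_eps_0 0 = 0"
  using at_eps_0_Fract[of 1 0] by (simp add: Zero_fract_def)

definition approx_complexity :: "nat \<Rightarrow> 'k::field mpoly \<Rightarrow> nat" where
  "approx_complexity n f = (LEAST r. \<exists>F \<in> mpolys n.
     (\<forall>m. Poly_Mapping.lookup F m \<in> regular_at_0) \<and>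
     Poly_Mapping.map at_eps_0 F = f \<and>
     computable_within n r F)"

text \<open>
  \<open>approx_complexity_order q n f\<close> is the variant with order of approximation \<open>q\<close>, over the power
  series ring \<open>k[[\<epsilon>]]\<close>, where \<^const>\<open>fps_X\<close> plays the role of \<open>\<epsilon>\<close>.
\<close>

definition approx_complexity_order :: "nat \<Rightarrow> nat \<Rightarrow> 'k::field mpoly \<Rightarrow> nat" where
  "approx_complexity_order q n f = (LEAST r. \<exists>f' \<in> mpolys n.
     computable_within n r
       (mconst (fps_X ^ q) * Poly_Mapping.map fps_const f + mconst (fps_X ^ (q + 1)) * f'))"

end

(* A program of length r over k(\<epsilon>) has at most one parameter per instruction; let m of the instructions
   have one. The coefficients of its result are polynomials in the parameters y, of degree at most
   2^(r - m) in each of them. If the parameters are replaced by Laurent series with poles of order at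
   most e such that the result still specializes to f, then multiplying every intermediate result by a
   suitable power of \<epsilon> gives a program over k[[\<epsilon>]]: a product needs no extra instruction, a sum one,
   and q is at most m 2^(r - m) e.

   To bound e, let \<sigma> consist of the coefficients of the result minus those of f, together with local
   coordinates \<chi> of the y (y - a, or 1/y at a pole). All of them vanish along the given arc. Counting
   standard monomials of the associated graded ring, there are m of the \<sigma> whose initial forms are
   algebraically independent. Hence there is a place of k(y) that kills all \<sigma> and is trivial on the ratios
   of those m, that is, a point of a curve over a field of transcendence degree m - 1 over k. Comparing
   dimensions of spaces of polynomials bounds the ramification of the \<chi>, and thereby e, by
   m^m (2^(r - m) + 1)^(m - 1). Only finitely many coefficients of the expansions at this point matter, and
   the Nullstellensatz moves them to k. *)

theory Submission
  imports "HOL-Algebra.Algebraic_Closure_Type" Defs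
begin

text \<open>Nothing in r restricts the poles of the parameters of a shortest program. The given arc
  therefore only witnesses that all \<sigma> can be small together; another arc has to be found. A
  valuation ring with all \<sigma> in its maximal ideal is easy to get, but its value group may be
  large, and then nothing can play the part of \<epsilon>. Turning the ratios of the m initial forms
  into constants leaves a field of transcendence degree one, where a bound on ramification yields a
  uniformizer. The place lives on an algebraic closure because there the residue field lifts to a
  subfield without completion. Origin of the constant: with D = 2^(r - m) + 1 the \<sigma> are
  quotients of polynomials of degree at most D in each of m coordinates; the + 1 comes from writing
  \<chi> as \<chi> Q / Q. If some \<chi> is divisible by the p-th power of a local element w, then
  about p D N products of powers of w and \<chi> are independent over the coefficient field.
  Multiplied by N^(m - 1) forms and cleared of denominators, they are counted against polynomials of
  degree about D m N in each coordinate. As N grows, this gives p D \<le> (D m)^m.\<close>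

abbreviation "lookup \<equiv> Poly_Mapping.lookup"
abbreviation "keys \<equiv> Poly_Mapping.keys"
abbreviation "single \<equiv> Poly_Mapping.single"


section \<open>Subrings, homogeneous systems, and relations compatible with the ring operations\<close>

definition subring_set :: "'a::comm_ring_1 set \<Rightarrow> bool" where
  "subring_set A \<longleftrightarrow> 1 \<in> A \<and> (\<forall>x\<in>A. \<forall>y\<in>A. x - y \<in> A \<and> x * y \<in> A)"

lemma subring_setD:
  assumes "subring_set A"
  shows subring_1: "1 \<in> A" and subring_0: "0 \<in> A"
    and subring_diff: "x \<in> A \<Longrightarrow> y \<in> A \<Longrightarrow> x - y \<in> A"
    and subring_mult: "x \<in> A \<Longrightarrow> y \<in> A \<Longrightarrow> x * y \<in> A"
    and subring_minus: "x \<in> A \<Longrightarrow> - x \<in> A"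
    and subring_add: "x \<in> A \<Longrightarrow> y \<in> A \<Longrightarrow> x + y \<in> A"
proof -
  have 1: "1 \<in> A" and d: "\<And>x y. x \<in> A \<Longrightarrow> y \<in> A \<Longrightarrow> x - y \<in> A"
    and m: "\<And>x y. x \<in> A \<Longrightarrow> y \<in> A \<Longrightarrow> x * y \<in> A"
    using assms by (auto simp: subring_set_def)
  have z: "0 \<in> A" using d[OF 1 1] by simp
  have n: "- x \<in> A" if "x \<in> A" for x using d[OF z that] by simp
  show "1 \<in> A" "0 \<in> A" by (fact 1 z)+
  show "x - y \<in> A" "x * y \<in> A" "x + y \<in> A" if "x \<in> A" "y \<in> A"
    using d[of x y] m[of x y] d[of x "- y"] n[of y] that by auto
  show "- x \<in> A" if "x \<in> A" using n that .
qed

lemma subring_power: "subring_set A \<Longrightarrow> x \<in> A \<Longrightarrow> x ^ n \<in> A"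
  by (induction n) (auto intro: subring_1 subring_mult)

lemma subring_sum: "subring_set A \<Longrightarrow> (\<And>i. i \<in> I \<Longrightarrow> f i \<in> A) \<Longrightarrow> sum f I \<in> A"
  by (induction I rule: infinite_finite_induct) (auto intro: subring_0 subring_add)

lemma subring_prod: "subring_set A \<Longrightarrow> (\<And>i. i \<in> I \<Longrightarrow> f i \<in> A) \<Longrightarrow> prod f I \<in> A"
  by (induction I rule: infinite_finite_induct) (auto intro: subring_1 subring_mult)

lemma subring_set_UNIV: "subring_set UNIV"
  by (simp add: subring_set_def)

text \<open>Gaussian elimination without fractions: rows are multiplied by the pivot instead of
  divided by it, so the solution stays in the subring. It is used over subrings of a field, over the
  coefficient field of a place and over the base field.\<close>

lemma homogeneous_system:
  fixes C :: "'i \<Rightarrow> 'b \<Rightarrow> 'a::idom"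
  assumes "finite B" "finite I" "card B < card I" and A: "subring_set A"
    and "\<And>i b. i \<in> I \<Longrightarrow> b \<in> B \<Longrightarrow> C i b \<in> A"
  shows "\<exists>h. (\<forall>i\<in>I. h i \<in> A) \<and> (\<exists>i\<in>I. h i \<noteq> 0) \<and> (\<forall>b\<in>B. (\<Sum>i\<in>I. h i * C i b) = 0)"
  using assms(1-3,5)
proof (induction B arbitrary: I C rule: finite_induct)
  case empty
  then obtain i where "i \<in> I" by fastforce
  then show ?case using subring_1[OF A] by (intro exI[of _ "\<lambda>_. 1"]) auto
next
  case (insert b B)
  show ?case
  proof (cases "\<forall>i\<in>I. C i b = 0")
    case True
    have "\<exists>h. (\<forall>i\<in>I. h i \<in> A) \<and> (\<exists>i\<in>I. h i \<noteq> 0) \<and> (\<forall>b\<in>B. (\<Sum>i\<in>I. h i * C i b) = 0)"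
      using insert.prems insert.hyps by (intro insert.IH) auto
    then show ?thesis using True by auto
  next
    case False
    then obtain i0 where i0: "i0 \<in> I" "C i0 b \<noteq> 0" by blast
    define c where "c = C i0 b"
    define I' where "I' = I - {i0}"
    have fin: "finite I'" "finite I" and I: "I = insert i0 I'" "i0 \<notin> I'"
      using insert.prems i0 by (auto simp: I'_def)
    define C' where "C' i b' = c * C i b' - C i b * C i0 b'" for i b'
    have c: "c \<in> A" "c \<noteq> 0" using i0 insert.prems by (auto simp: c_def)
    have "\<exists>h. (\<forall>i\<in>I'. h i \<in> A) \<and> (\<exists>i\<in>I'. h i \<noteq> 0) \<and> (\<forall>b\<in>B. (\<Sum>i\<in>I'. h i * C' i b) = 0)"
    proof (rule insert.IH)
      show "card B < card I'" using insert.prems insert.hyps I fin by simp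
      show "C' i b' \<in> A" if "i \<in> I'" "b' \<in> B" for i b'
        unfolding C'_def using that insert.prems(3) c I i0
        by (intro subring_diff[OF A] subring_mult[OF A]) auto
    qed (use fin in auto)
    then obtain h' where h': "\<forall>i\<in>I'. h' i \<in> A" "\<exists>i\<in>I'. h' i \<noteq> 0"
      "\<forall>b\<in>B. (\<Sum>i\<in>I'. h' i * C' i b) = 0" by blast
    define h where "h i = (if i = i0 then - (\<Sum>i\<in>I'. h' i * C i b) else c * h' i)" for i
    have hI': "(\<Sum>i\<in>I. h i * g i) = (\<Sum>i\<in>I'. c * h' i * g i) - (\<Sum>i\<in>I'. h' i * C i b) * g i0" for g
    proof -
      have "(\<Sum>i\<in>I'. h i * g i) = (\<Sum>i\<in>I'. c * h' i * g i)"
        using I by (intro sum.cong) (auto simp: h_def)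
      then show ?thesis using I fin by (simp add: h_def)
    qed
    show ?thesis
    proof (intro exI[of _ h] conjI ballI)
      fix i assume "i \<in> I"
      then show "h i \<in> A" unfolding h_def using h'(1) I c insert.prems(3)
        by (auto intro!: subring_minus[OF A] subring_sum[OF A] subring_mult[OF A])
    next
      show "\<exists>i\<in>I. h i \<noteq> 0" using h'(2) I c by (auto simp: h_def)
    next
      fix b' assume b': "b' \<in> insert b B"
      show "(\<Sum>i\<in>I. h i * C i b') = 0"
      proof (cases "b' = b")
        case True
        show ?thesis unfolding hI' True
          by (simp add: sum_distrib_left sum_distrib_right c_def[symmetric] mult_ac)
      next
        case False
        then have "(\<Sum>i\<in>I'. h' i * C' i b') = 0" using h'(3) b' by auto
        then show ?thesis unfolding hI'
          by (simp add: C'_def algebra_simps sum_subtractf sum_distrib_left sum_distrib_right)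
      qed
    qed
  qed
qed

text \<open>A relation rather than a map, because one transfer argument for programs has to cover
  homomorphisms, homomorphisms on a subring only, and congruences such as "equal up to order q"
  between rings that no map connects.\<close>

definition ring_rel :: "('a::comm_ring_1 \<Rightarrow> 'b::comm_ring_1 \<Rightarrow> bool) \<Rightarrow> bool" where
  "ring_rel R \<longleftrightarrow> R 1 1 \<and>
     (\<forall>a a' b b'. R a a' \<longrightarrow> R b b' \<longrightarrow> R (a - b) (a' - b') \<and> R (a * b) (a' * b'))"

lemma ring_relD:
  assumes "ring_rel R"
  shows ring_rel_1: "R 1 1" and ring_rel_0: "R 0 0"
    and ring_rel_diff: "R a a' \<Longrightarrow> R b b' \<Longrightarrow> R (a - b) (a' - b')"
    and ring_rel_mult: "R a a' \<Longrightarrow> R b b' \<Longrightarrow> R (a * b) (a' * b')"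
    and ring_rel_add: "R a a' \<Longrightarrow> R b b' \<Longrightarrow> R (a + b) (a' + b')"
proof -
  have 1: "R 1 1" and d: "\<And>a a' b b'. R a a' \<Longrightarrow> R b b' \<Longrightarrow> R (a - b) (a' - b')"
    and m: "\<And>a a' b b'. R a a' \<Longrightarrow> R b b' \<Longrightarrow> R (a * b) (a' * b')"
    using assms by (auto simp: ring_rel_def)
  have z: "R 0 0" using d[OF 1 1] by simp
  show "R 1 1" "R 0 0" by (fact 1 z)+
  show "R (a - b) (a' - b')" "R (a * b) (a' * b')" "R (a + b) (a' + b')" if "R a a'" "R b b'"
    using d[OF that] m[OF that] d[OF that(1) d[OF z that(2)]] by auto
qed

lemma ring_rel_power: "ring_rel R \<Longrightarrow> R x y \<Longrightarrow> R (x ^ n) (y ^ n)"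
  by (induction n) (auto intro: ring_rel_1 ring_rel_mult)

lemma ring_rel_sum: "ring_rel R \<Longrightarrow> (\<And>i. i \<in> I \<Longrightarrow> R (f i) (g i)) \<Longrightarrow> R (sum f I) (sum g I)"
  by (induction I rule: infinite_finite_induct) (auto intro: ring_rel_0 ring_rel_add)

lemma ring_rel_prod: "ring_rel R \<Longrightarrow> (\<And>i. i \<in> I \<Longrightarrow> R (f i) (g i)) \<Longrightarrow> R (prod f I) (prod g I)"
  by (induction I rule: infinite_finite_induct) (auto intro: ring_rel_1 ring_rel_mult)

definition ring_map :: "('a::comm_ring_1 \<Rightarrow> 'b::comm_ring_1) \<Rightarrow> bool" where
  "ring_map h \<longleftrightarrow> ring_rel (\<lambda>a b. b = h a)"

lemma ring_mapI:
  "h 1 = 1 \<Longrightarrow> (\<And>a b. h (a - b) = h a - h b) \<Longrightarrow> (\<And>a b. h (a * b) = h a * h b) \<Longrightarrow> ring_map h"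
  by (simp add: ring_map_def ring_rel_def)

lemma ring_mapD:
  assumes "ring_map h"
  shows ring_map_1: "h 1 = 1" and ring_map_0: "h 0 = 0"
    and ring_map_diff: "h (a - b) = h a - h b"
    and ring_map_mult: "h (a * b) = h a * h b"
    and ring_map_add: "h (a + b) = h a + h b"
    and ring_map_power: "h (a ^ n) = h a ^ n"
    and ring_map_sum: "h (sum f I) = (\<Sum>i\<in>I. h (f i))"
    and ring_map_prod: "h (prod f I) = (\<Prod>i\<in>I. h (f i))"
  using assms ring_rel_1[of "\<lambda>a b. b = h a"] ring_rel_0[of "\<lambda>a b. b = h a"]
    ring_rel_diff[of "\<lambda>a b. b = h a" a "h a" b "h b"] ring_rel_mult[of "\<lambda>a b. b = h a" a "h a" b "h b"]
    ring_rel_add[of "\<lambda>a b. b = h a" a "h a" b "h b"] ring_rel_power[of "\<lambda>a b. b = h a" a "h a"]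
    ring_rel_sum[of "\<lambda>a b. b = h a" I f "\<lambda>i. h (f i)"] ring_rel_prod[of "\<lambda>a b. b = h a" I f "\<lambda>i. h (f i)"]
  by (simp_all add: ring_map_def)

lemma ring_map_comp: "ring_map g \<Longrightarrow> ring_map h \<Longrightarrow> ring_map (\<lambda>x. g (h x))"
  by (rule ring_mapI) (simp_all add: ring_mapD)

lemma ring_map_ident: "ring_map (\<lambda>x. x)"
  by (rule ring_mapI) simp_all

lemma ring_map_inj_iff:
  fixes h :: "'a::field \<Rightarrow> 'b::field"
  assumes "ring_map h"
  shows "h a = 0 \<longleftrightarrow> a = 0"
proof
  assume "h a = 0"
  show "a = 0"
  proof (rule ccontr)
    assume "a \<noteq> 0"
    then have "h a * h (1 / a) = 1"
      using ring_map_mult[OF assms, of a "1/a"] ring_map_1[OF assms] by simp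
    then show False using \<open>h a = 0\<close> by simp
  qed
qed (simp add: ring_map_0[OF assms])


section \<open>Coefficients, evaluation and degrees of multivariate polynomials\<close>

lemma mpoly_sum_monomials:
  assumes "finite A" "keys p \<subseteq> A"
  shows "p = (\<Sum>a\<in>A. single a (lookup p a))"
proof (rule poly_mapping_eqI)
  fix k
  have "lookup (\<Sum>a\<in>A. single a (lookup p a)) k =
      (\<Sum>a\<in>A. if a = k then lookup p k else 0)"
    by (auto simp: lookup_sum lookup_single when_def intro!: sum.cong)
  also have "\<dots> = lookup p k"
    using assms by (auto simp: in_keys_iff)
  finally show "lookup p k =
      lookup (\<Sum>a\<in>A. single a (lookup p a)) k" ..
qed

lemma mpoly_times_monomials:
  fixes p q :: "'a::comm_ring_1 mpoly"
  assumes "finite A" "keys p \<subseteq> A" "finite B" "keys q \<subseteq> B"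
  shows "p * q = (\<Sum>a\<in>A. \<Sum>b\<in>B.
    single (a + b) (lookup p a * lookup q b))"
proof -
  have "p * q = (\<Sum>a\<in>A. single a (lookup p a)) *
      (\<Sum>b\<in>B. single b (lookup q b))"
    using mpoly_sum_monomials[of A p] mpoly_sum_monomials[of B q] assms by simp
  then show ?thesis by (simp add: sum_product mult_single)
qed

definition mpoly_rel :: "('a::zero \<Rightarrow> 'b::zero \<Rightarrow> bool) \<Rightarrow> 'a mpoly \<Rightarrow> 'b mpoly \<Rightarrow> bool" where
  "mpoly_rel R p q \<longleftrightarrow> (\<forall>m. R (lookup p m) (lookup q m))"

lemma mpoly_rel_single: "R 0 0 \<Longrightarrow> R a b \<Longrightarrow> mpoly_rel R (single m a) (single m b)"
  by (simp add: mpoly_rel_def lookup_single when_def)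

text \<open>A coefficient of a product is a finite sum of products of coefficients. Expanding both
  products over the same index sets makes the sums match term by term even if the supports
  differ.\<close>

lemma ring_rel_mpoly:
  assumes R: "ring_rel R"
  shows "ring_rel (mpoly_rel R)"
  unfolding ring_rel_def
proof (intro conjI allI impI)
  show "mpoly_rel R 1 1"
    using mpoly_rel_single[of R 1 1 0] ring_rel_0[OF R] ring_rel_1[OF R] by simp
next
  fix p p' q q' assume *: "mpoly_rel R p p'" "mpoly_rel R q q'"
  show "mpoly_rel R (p - q) (p' - q')"
    using * ring_rel_diff[OF R] by (auto simp: mpoly_rel_def lookup_minus)
  define A where "A = keys p \<union> keys p'"
  define B where "B = keys q \<union> keys q'"
  have AB: "finite A" "finite B" "keys p \<subseteq> A" "keys p' \<subseteq> A"
    "keys q \<subseteq> B" "keys q' \<subseteq> B"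
    by (auto simp: A_def B_def)
  show "mpoly_rel R (p * q) (p' * q')"
    unfolding mpoly_times_monomials[OF AB(1,3) AB(2,5)] mpoly_times_monomials[OF AB(1,4) AB(2,6)]
    unfolding mpoly_rel_def lookup_sum
    using * ring_rel_mult[OF R] ring_rel_0[OF R]
    by (auto simp: mpoly_rel_def lookup_single when_def intro!: ring_rel_sum[OF R])
qed

lemma mvar_power: "mvar i ^ k = single (single i k) (1 :: 'a::comm_ring_1)"
proof (induction k)
  case (Suc k)
  have "single i (Suc k) = single i 1 + single i k"
    by (simp flip: single_add)
  then show ?case by (simp only: power_Suc Suc.IH) (simp add: mvar_def mult_single)
qed simp

definition monval :: "(nat \<Rightarrow> 'a::comm_ring_1) \<Rightarrow> (nat \<Rightarrow>\<^sub>0 nat) \<Rightarrow> 'a" where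
  "monval x m = (\<Prod>i\<in>keys m. x i ^ lookup m i)"

lemma monval_superset:
  "finite A \<Longrightarrow> keys m \<subseteq> A \<Longrightarrow> monval x m = (\<Prod>i\<in>A. x i ^ lookup m i)"
  unfolding monval_def by (rule prod.mono_neutral_left) (auto simp: in_keys_iff)

lemma monval_0 [simp]: "monval x 0 = 1"
  by (simp add: monval_def)

lemma monval_single [simp]: "monval x (single i k) = x i ^ k"
  by (simp add: monval_def)

lemma monval_add: "monval x (a + b) = monval x a * monval x b"
proof -
  let ?A = "keys a \<union> keys b"
  have "keys (a + b) \<subseteq> ?A" by (rule keys_add)
  then show ?thesis
    using monval_superset[of ?A "a + b" x] monval_superset[of ?A a x] monval_superset[of ?A b x]
    by (simp add: lookup_add power_add prod.distrib)
qed

text \<open>Coefficients pass through \<open>h\<close>, so the same notion serves evaluation in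
  extension fields, power series, Laurent series and polynomial rings.\<close>

definition peval :: "('k::comm_ring_1 \<Rightarrow> 'a::comm_ring_1) \<Rightarrow> (nat \<Rightarrow> 'a) \<Rightarrow> 'k mpoly \<Rightarrow> 'a" where
  "peval h x p = (\<Sum>m\<in>keys p. h (lookup p m) * monval x m)"

context
  fixes h :: "'k::comm_ring_1 \<Rightarrow> 'a::comm_ring_1" and x :: "nat \<Rightarrow> 'a"
  assumes h: "ring_map h"
begin

lemma peval_superset:
  "finite A \<Longrightarrow> keys p \<subseteq> A \<Longrightarrow>
     peval h x p = (\<Sum>m\<in>A. h (lookup p m) * monval x m)"
  unfolding peval_def by (rule sum.mono_neutral_left) (auto simp: in_keys_iff ring_map_0[OF h])

lemma peval_single [simp]: "peval h x (single m c) = h c * monval x m"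
  by (subst peval_superset[of "{m}"]) auto

lemma peval_mconst [simp]: "peval h x (mconst c) = h c"
  by (simp add: mconst_def)

lemma peval_mvar [simp]: "peval h x (mvar i) = x i"
  by (simp add: mvar_def ring_map_1[OF h])

lemma peval_diff: "peval h x (p - q) = peval h x p - peval h x q"
proof -
  let ?A = "keys p \<union> keys q"
  have "keys (p - q) \<subseteq> ?A" by (auto simp: in_keys_iff lookup_minus)
  then show ?thesis
    using peval_superset[of ?A "p - q"] peval_superset[of ?A p] peval_superset[of ?A q]
    by (simp add: lookup_minus ring_map_diff[OF h] sum_subtractf left_diff_distrib)
qed

lemma peval_0 [simp]: "peval h x 0 = 0"
  by (simp add: peval_def)

lemma peval_add: "peval h x (p + q) = peval h x p + peval h x q"
proof -
  have "p + q = p - (0 - q)" by simp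
  then show ?thesis by (simp only: peval_diff peval_0) simp
qed

lemma peval_sum: "peval h x (sum f I) = (\<Sum>i\<in>I. peval h x (f i))"
  by (induction I rule: infinite_finite_induct) (simp_all add: peval_add)

lemma ring_map_peval: "ring_map (peval h x)"
proof (rule ring_mapI)
  show "peval h x 1 = 1"
    using peval_single[of 0 1] ring_map_1[OF h] by simp
  fix p q
  show "peval h x (p - q) = peval h x p - peval h x q" by (rule peval_diff)
  show "peval h x (p * q) = peval h x p * peval h x q"
  proof -
    have "peval h x (p * q) = (\<Sum>a\<in>keys p. \<Sum>b\<in>keys q.
        (h (lookup p a) * monval x a) * (h (lookup q b) * monval x b))"
      by (subst mpoly_times_monomials[OF finite_keys subset_refl finite_keys subset_refl])
        (simp add: peval_sum monval_add ring_map_mult[OF h] mult_ac)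
    then show ?thesis by (simp add: peval_def sum_product)
  qed
qed

lemmas peval_1 [simp] = ring_map_1[OF ring_map_peval]
  and peval_mult = ring_map_mult[OF ring_map_peval]
  and peval_power = ring_map_power[OF ring_map_peval]
  and peval_prod = ring_map_prod[OF ring_map_peval]

text \<open>This is the universal property of the polynomial ring; monomials are built up one
  variable at a time.\<close>

lemma ring_map_eq_peval:
  assumes g: "ring_map g" and "\<And>c. g (mconst c) = h c" "\<And>i. g (mvar i) = x i"
  shows "g p = peval h x p"
proof -
  have "g (single m c) = h c * monval x m" for m c
  proof (induction m rule: update_induct)
    case const
    then show ?case using assms(2)[of c] by (simp add: mconst_def)
  next
    case (update m i k)
    have "m + single i k = Poly_Mapping.update i k m"
      using update.hyps by (intro poly_mapping_eqI)
        (auto simp: lookup_add lookup_update lookup_single in_keys_iff)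
    then have "single (Poly_Mapping.update i k m) c =
        single m c * mvar i ^ k" "monval x (Poly_Mapping.update i k m) = monval x m * x i ^ k"
      using monval_add[of x m "single i k"] by (simp_all add: mult_single mvar_power)
    then show ?case using update.IH
      by (simp add: ring_map_mult[OF g] ring_map_power[OF g] assms(3))
  qed
  moreover have "g p = (\<Sum>a\<in>keys p. g (single a (lookup p a)))"
    using mpoly_sum_monomials[of "keys p" p] by (simp flip: ring_map_sum[OF g])
  ultimately show ?thesis by (simp add: peval_def)
qed

end

lemma peval_rel:
  assumes R: "ring_rel R" and h: "ring_map h" "ring_map h'"
    and "\<And>m. R (h (lookup p m)) (h' (lookup p m))"
    and x: "\<And>m i. m \<in> keys p \<Longrightarrow> i \<in> keys m \<Longrightarrow> R (x i) (x' i)"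
  shows "R (peval h x p) (peval h' x' p)"
  unfolding peval_def monval_def using assms
  by (auto intro!: ring_rel_sum[OF R] ring_rel_mult[OF R] ring_rel_prod[OF R] ring_rel_power[OF R])

lemma peval_hom:
  assumes "ring_map h" "ring_map g"
  shows "g (peval h x p) = peval (\<lambda>c. g (h c)) (\<lambda>i. g (x i)) p"
  using peval_rel[of "\<lambda>a b. b = g a" h "\<lambda>c. g (h c)" p x "\<lambda>i. g (x i)"] assms
    ring_map_comp[of g h] by (simp add: ring_map_def)

lemma ring_map_mconst: "ring_map (mconst :: 'a::comm_ring_1 \<Rightarrow> _)"
  by (rule ring_mapI) (simp_all add: mconst_def single_diff mult_single)

lemma peval_mvar_id: "peval mconst mvar p = p"
  using ring_map_eq_peval[OF ring_map_mconst ring_map_ident, of mvar p] by simp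

definition deg_le :: "'a::zero mpoly \<Rightarrow> (nat \<Rightarrow> nat) \<Rightarrow> bool" where
  "deg_le p \<nu> \<longleftrightarrow> (\<forall>m\<in>keys p. \<forall>i. lookup m i \<le> \<nu> i)"

lemma deg_le_mono: "deg_le p \<nu> \<Longrightarrow> (\<And>i. \<nu> i \<le> \<mu> i) \<Longrightarrow> deg_le p \<mu>"
  by (meson deg_le_def le_trans)

lemma deg_le_0 [simp]: "deg_le 0 \<nu>"
  by (simp add: deg_le_def)

lemma deg_le_single: "(\<And>i. lookup m i \<le> \<nu> i) \<Longrightarrow> deg_le (single m c) \<nu>"
  by (simp add: deg_le_def)

lemma deg_le_mconst [simp]: "deg_le (mconst c) \<nu>"
  by (simp add: mconst_def deg_le_single)

lemma deg_le_1 [simp]: "deg_le (1 :: 'a::comm_ring_1 mpoly) \<nu>"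
  using deg_le_mconst[of "1 :: 'a"] by (simp add: mconst_def)

lemma deg_le_mvar: "1 \<le> \<nu> i \<Longrightarrow> deg_le (mvar i) \<nu>"
  unfolding mvar_def by (rule deg_le_single) (auto simp: lookup_single when_def)

lemma deg_le_add: "deg_le p \<nu> \<Longrightarrow> deg_le q \<nu> \<Longrightarrow> deg_le (p + q) \<nu>"
  using keys_add[of p q] by (auto simp: deg_le_def)

lemma deg_le_diff: "deg_le p \<nu> \<Longrightarrow> deg_le q \<nu> \<Longrightarrow> deg_le (p - q :: 'a::comm_ring_1 mpoly) \<nu>"
  by (auto simp: deg_le_def in_keys_iff lookup_minus)

lemma deg_le_sum: "(\<And>i. i \<in> I \<Longrightarrow> deg_le (f i) \<nu>) \<Longrightarrow> deg_le (sum f I) \<nu>"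
  by (induction I rule: infinite_finite_induct) (auto intro: deg_le_add)

lemma deg_le_mult:
  assumes "deg_le p \<nu>" "deg_le q \<mu>"
  shows "deg_le (p * q :: 'a::comm_ring_1 mpoly) (\<lambda>i. \<nu> i + \<mu> i)"
  unfolding deg_le_def
proof (intro ballI allI)
  fix m i assume "m \<in> keys (p * q)"
  then obtain a b where "m = a + b" "a \<in> keys p" "b \<in> keys q"
    using keys_mult[of p q] by auto
  then show "lookup m i \<le> \<nu> i + \<mu> i"
    using assms by (auto simp: deg_le_def lookup_add intro: add_mono)
qed

lemma deg_le_power:
  "deg_le p \<nu> \<Longrightarrow> deg_le (p ^ n :: 'a::comm_ring_1 mpoly) (\<lambda>i. n * \<nu> i)"
proof (induction n)
  case (Suc n)
  then have "deg_le (p * p ^ n) (\<lambda>i. \<nu> i + n * \<nu> i)" by (intro deg_le_mult)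
  then show ?case by simp
qed simp

lemma deg_le_prod:
  "(\<And>j. j \<in> I \<Longrightarrow> deg_le (f j :: 'a::comm_ring_1 mpoly) (\<nu> j)) \<Longrightarrow> deg_le (prod f I) (\<lambda>i. \<Sum>j\<in>I. \<nu> j i)"
  by (induction I rule: infinite_finite_induct) (auto intro!: deg_le_mult)

definition box :: "nat set \<Rightarrow> (nat \<Rightarrow> nat) \<Rightarrow> (nat \<Rightarrow>\<^sub>0 nat) set" where
  "box I b = {\<beta>. keys \<beta> \<subseteq> I \<and> (\<forall>i\<in>I. lookup \<beta> i < b i)}"

lemma box_finite_card:
  assumes "finite I"
  shows finite_box: "finite (box I b)" and card_box: "card (box I b) = (\<Prod>i\<in>I. b i)"
proof -
  define F where "F \<beta> = (\<lambda>i\<in>I. lookup \<beta> i)" for \<beta> :: "nat \<Rightarrow>\<^sub>0 nat"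
  have "bij_betw F (box I b) (\<Pi>\<^sub>E i\<in>I. {..<b i})"
  proof (rule bij_betw_imageI)
    show "inj_on F (box I b)"
    proof (rule inj_onI)
      fix \<beta> \<gamma> assume *: "\<beta> \<in> box I b" "\<gamma> \<in> box I b" "F \<beta> = F \<gamma>"
      show "\<beta> = \<gamma>"
      proof (rule poly_mapping_eqI)
        fix i
        show "lookup \<beta> i = lookup \<gamma> i"
        proof (cases "i \<in> I")
          case True
          then show ?thesis using fun_cong[OF *(3), of i] by (simp add: F_def)
        next
          case False
          then have "i \<notin> keys \<beta>" "i \<notin> keys \<gamma>" using * by (auto simp: box_def)
          then show ?thesis by (simp add: in_keys_iff)
        qed
      qed
    qed
    show "F ` box I b = (\<Pi>\<^sub>E i\<in>I. {..<b i})"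
    proof (intro equalityI subsetI)
      fix g assume g: "g \<in> (\<Pi>\<^sub>E i\<in>I. {..<b i})"
      define \<beta> where "\<beta> = Abs_poly_mapping (\<lambda>i. if i \<in> I then g i else 0)"
      have l: "lookup \<beta> = (\<lambda>i. if i \<in> I then g i else 0)"
        unfolding \<beta>_def using assms by (intro Abs_poly_mapping_inverse) auto
      have "F \<beta> = g" using g by (auto simp: F_def l PiE_def extensional_def)
      moreover have "\<beta> \<in> box I b" using g by (auto simp: box_def l in_keys_iff PiE_def split: if_splits)
      ultimately show "g \<in> F ` box I b" by blast
    qed (auto simp: F_def box_def)
  qed
  moreover have "finite (\<Pi>\<^sub>E i\<in>I. {..<b i})" using assms by (intro finite_PiE) auto
  moreover have "card (\<Pi>\<^sub>E i\<in>I. {..<b i}) = (\<Prod>i\<in>I. b i)" using assms by (simp add: card_PiE)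
  ultimately show "finite (box I b)" "card (box I b) = (\<Prod>i\<in>I. b i)"
    by (auto simp: bij_betw_finite bij_betw_same_card)
qed

lemma deg_le_keys_box:
  assumes "deg_le p (\<lambda>i. if i \<in> I then n else 0)"
  shows "keys p \<subseteq> box I (\<lambda>_. Suc n)"
proof
  fix m assume m: "m \<in> keys p"
  have "lookup m i \<le> (if i \<in> I then n else 0)" for i
    using m assms by (auto simp: deg_le_def)
  then show "m \<in> box I (\<lambda>_. Suc n)"
    by (force simp: box_def in_keys_iff less_Suc_eq_le split: if_splits)
qed

section \<open>Univariate polynomials over a subring\<close>

text \<open>Polynomials over a subring stay elements of the polynomial ring over the ambient type,
  so subrings need no types of their own. Accordingly \<open>adjoin\<close> below is A[x].\<close>

definition polyset :: "'a::comm_ring_1 set \<Rightarrow> 'a poly set" where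
  "polyset A = {p. \<forall>i. coeff p i \<in> A}"

definition adjoin :: "'a::comm_ring_1 set \<Rightarrow> 'a \<Rightarrow> 'a set" where
  "adjoin A x = {poly p x | p. p \<in> polyset A}"

lemma subring_polyset:
  assumes A: "subring_set A"
  shows "subring_set (polyset A)"
  unfolding subring_set_def polyset_def
  by (auto simp: coeff_mult coeff_1 intro!: subring_sum[OF A] subring_diff[OF A] subring_mult[OF A]
      subring_0[OF A] subring_1[OF A])

lemma polyset_monom: "subring_set A \<Longrightarrow> c \<in> A \<Longrightarrow> monom c n \<in> polyset A"
  by (auto simp: polyset_def subring_0)

lemma polyset_smult: "subring_set A \<Longrightarrow> c \<in> A \<Longrightarrow> p \<in> polyset A \<Longrightarrow> smult c p \<in> polyset A"
  by (auto simp: polyset_def subring_mult)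

lemma polyset_pCons: "subring_set A \<Longrightarrow> pCons c p \<in> polyset A \<longleftrightarrow> c \<in> A \<and> p \<in> polyset A"
  unfolding polyset_def by (auto simp: coeff_pCons split: nat.splits)

lemma adjoinI: "p \<in> polyset A \<Longrightarrow> poly p x \<in> adjoin A x"
  by (auto simp: adjoin_def)

lemma subring_adjoin:
  assumes A: "subring_set A"
  shows "subring_set (adjoin A x)"
  unfolding subring_set_def
proof (intro conjI ballI)
  note P = subring_polyset[OF A]
  show "1 \<in> adjoin A x" using adjoinI[OF subring_1[OF P], of x] by simp
  fix y z assume "y \<in> adjoin A x" "z \<in> adjoin A x"
  then obtain p q where "y = poly p x" "z = poly q x" "p \<in> polyset A" "q \<in> polyset A"
    by (auto simp: adjoin_def)
  then show "y - z \<in> adjoin A x" "y * z \<in> adjoin A x"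
    using adjoinI[OF subring_diff[OF P], of p q x] adjoinI[OF subring_mult[OF P], of p q x] by simp_all
qed

lemma adjoin_base: "subring_set A \<Longrightarrow> A \<subseteq> adjoin A x"
proof
  fix c assume "subring_set A" "c \<in> A"
  then show "c \<in> adjoin A x"
    using adjoinI[of "[:c:]" A x] by (simp add: polyset_pCons) (simp add: polyset_def subring_0)
qed

lemma adjoin_self: "subring_set A \<Longrightarrow> x \<in> adjoin A x"
  using adjoinI[of "monom 1 1" A x] by (simp add: polyset_monom subring_1 poly_monom)

lemma poly_in_subring: "subring_set A \<Longrightarrow> p \<in> polyset A \<Longrightarrow> x \<in> A \<Longrightarrow> poly p x \<in> A"
  by (auto simp: poly_altdef polyset_def intro!: subring_sum subring_mult subring_power)

section \<open>Subfields and fields of fractions inside an ambient field\<close>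

definition subfield_set :: "'a::field set \<Rightarrow> bool" where
  "subfield_set E \<longleftrightarrow> subring_set E \<and> (\<forall>x\<in>E. inverse x \<in> E)"

lemma subfield_subring: "subfield_set E \<Longrightarrow> subring_set E"
  by (simp add: subfield_set_def)

lemma subfield_inverse: "subfield_set E \<Longrightarrow> x \<in> E \<Longrightarrow> inverse x \<in> E"
  by (simp add: subfield_set_def)

lemma subfield_divide: "subfield_set E \<Longrightarrow> x \<in> E \<Longrightarrow> y \<in> E \<Longrightarrow> x / y \<in> E"
  by (simp add: subfield_inverse subfield_subring subring_mult field_class.field_divide_inverse)

definition fracs :: "'a::field set \<Rightarrow> 'a set" where
  "fracs A = {a / b | a b. a \<in> A \<and> b \<in> A \<and> b \<noteq> 0}"

lemma fracs_base: "subring_set A \<Longrightarrow> A \<subseteq> fracs A"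
  unfolding fracs_def using subring_1[of A] by force

lemma subfield_fracs:
  assumes A: "subring_set A"
  shows "subfield_set (fracs A)"
  unfolding subfield_set_def subring_set_def
proof (intro conjI ballI)
  show "1 \<in> fracs A" using fracs_base[OF A] subring_1[OF A] by blast
next
  fix x y assume "x \<in> fracs A" "y \<in> fracs A"
  then obtain a b c d where *: "x = a / b" "y = c / d" "a \<in> A" "b \<in> A" "c \<in> A" "d \<in> A" "b \<noteq> 0" "d \<noteq> 0"
    by (auto simp: fracs_def)
  then have "x - y = (a * d - c * b) / (b * d)" "x * y = (a * c) / (b * d)" "b * d \<noteq> 0"
    by (simp_all add: diff_frac_eq)
  moreover have "a * d - c * b \<in> A" "b * d \<in> A" "a * c \<in> A"
    using * by (auto intro!: subring_diff[OF A] subring_mult[OF A])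
  ultimately show "x - y \<in> fracs A" "x * y \<in> fracs A"
    unfolding fracs_def by blast+
next
  fix x assume "x \<in> fracs A"
  then obtain a b where *: "x = a / b" "a \<in> A" "b \<in> A" "b \<noteq> 0" by (auto simp: fracs_def)
  show "inverse x \<in> fracs A"
  proof (cases "a = 0")
    case True
    then have "inverse x = 0 / 1" using * by simp
    then show ?thesis unfolding fracs_def using subring_0[OF A] subring_1[OF A] by force
  next
    case False
    then have "inverse x = b / a" using * by simp
    then show ?thesis unfolding fracs_def using * False by blast
  qed
qed


lemma power_mult_poly_inverse:
  fixes x :: "'a::field"
  assumes "x \<noteq> 0" "degree p \<le> n"
  shows "x ^ n * poly p (inverse x) = (\<Sum>i\<le>degree p. coeff p i * x ^ (n - i))"
  unfolding poly_altdef sum_distrib_left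
proof (rule sum.cong)
  fix i assume "i \<in> {..degree p}"
  then have "x ^ n = x ^ (n - i) * x ^ i" using assms(2) by (simp flip: power_add)
  moreover have "x ^ i * inverse x ^ i = 1" using assms(1) by (simp flip: power_mult_distrib)
  ultimately show "x ^ n * (coeff p i * inverse x ^ i) = coeff p i * x ^ (n - i)"
    by (simp add: mult.assoc)
qed simp


section \<open>Valuation rings\<close>

text \<open>The ideal I R. The inductive form makes visible that each membership involves finitely
  many elements of R, which is why it passes to unions of chains.\<close>

inductive_set ideal_gen :: "'a::comm_ring_1 set \<Rightarrow> 'a set \<Rightarrow> 'a set" for I R where
  zero: "0 \<in> ideal_gen I R"
| step: "a \<in> I \<Longrightarrow> r \<in> R \<Longrightarrow> x \<in> ideal_gen I R \<Longrightarrow> a * r + x \<in> ideal_gen I R"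

lemma ideal_gen_mono: "R \<subseteq> R' \<Longrightarrow> ideal_gen I R \<subseteq> ideal_gen I R'"
proof
  fix x assume R: "R \<subseteq> R'" and x: "x \<in> ideal_gen I R"
  show "x \<in> ideal_gen I R'"
    using x by induction (use R in \<open>auto intro: ideal_gen.intros\<close>)
qed

lemma ideal_gen_add: "x \<in> ideal_gen I R \<Longrightarrow> y \<in> ideal_gen I R \<Longrightarrow> x + y \<in> ideal_gen I R"
  by (induction rule: ideal_gen.induct) (auto simp: add.assoc intro: ideal_gen.intros)

lemma ideal_gen_mult:
  assumes R: "subring_set R" and "r \<in> R"
  shows "x \<in> ideal_gen I R \<Longrightarrow> x * r \<in> ideal_gen I R"
proof (induction rule: ideal_gen.induct)
  case (step a s x)
  have "a * (s * r) + x * r \<in> ideal_gen I R"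
    using step assms by (intro ideal_gen.step) (auto intro: subring_mult)
  then show ?case by (simp add: algebra_simps)
qed (simp add: ideal_gen.zero)

lemma ideal_gen_sum:
  "(\<And>i. i \<in> S \<Longrightarrow> f i \<in> ideal_gen I R) \<Longrightarrow> sum f S \<in> ideal_gen I R"
  by (induction S rule: infinite_finite_induct) (auto intro: ideal_gen.zero ideal_gen_add)

lemma ideal_gen_base: "subring_set R \<Longrightarrow> a \<in> I \<Longrightarrow> a \<in> ideal_gen I R"
  using ideal_gen.step[of a I 1 R 0] by (simp add: subring_1 ideal_gen.zero)

lemma ideal_gen_subset: "subring_set R \<Longrightarrow> I \<subseteq> R \<Longrightarrow> ideal_gen I R \<subseteq> R"
proof
  fix x assume *: "subring_set R" "I \<subseteq> R" and "x \<in> ideal_gen I R"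
  from this(3) show "x \<in> R" by induction (use * in \<open>auto intro: subring_0 subring_add subring_mult\<close>)
qed

lemma ideal_gen_chain:
  assumes C: "C \<noteq> {}" "\<And>R R'. R \<in> C \<Longrightarrow> R' \<in> C \<Longrightarrow> R \<subseteq> R' \<or> R' \<subseteq> R"
  shows "x \<in> ideal_gen I (\<Union>C) \<Longrightarrow> \<exists>R\<in>C. x \<in> ideal_gen I R"
proof (induction rule: ideal_gen.induct)
  case zero
  then show ?case using C by (auto intro: ideal_gen.zero)
next
  case (step a r x)
  then obtain R R' where R: "R \<in> C" "x \<in> ideal_gen I R" "R' \<in> C" "r \<in> R'" by blast
  then obtain R'' where "R'' \<in> C" "R \<subseteq> R''" "R' \<subseteq> R''" using C(2)[of R R'] by blast
  then have "R'' \<in> C" "x \<in> ideal_gen I R''" "r \<in> R''" using R ideal_gen_mono by blast+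
  then show ?case using step(1) by (auto intro: ideal_gen.step)
qed

lemma ideal_gen_adjoin:
  assumes R: "subring_set R"
  shows "y \<in> ideal_gen I (adjoin R x) \<Longrightarrow> \<exists>p. p \<in> polyset (ideal_gen I R) \<and> y = poly p x"
proof (induction rule: ideal_gen.induct)
  case zero
  then show ?case by (intro exI[of _ 0]) (auto simp: polyset_def ideal_gen.zero)
next
  case (step a r y)
  then obtain p q where "r = poly q x" "q \<in> polyset R" "p \<in> polyset (ideal_gen I R)" "y = poly p x"
    by (auto simp: adjoin_def)
  then show ?case using step(1)
    by (intro exI[of _ "smult a q + p"]) (auto simp: polyset_def intro: ideal_gen.step)
qed

lemma chain_Union_subring:
  assumes "C \<noteq> {}" "\<And>R R'. R \<in> C \<Longrightarrow> R' \<in> C \<Longrightarrow> R \<subseteq> R' \<or> R' \<subseteq> R" "\<And>R. R \<in> C \<Longrightarrow> subring_set R"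
  shows "subring_set (\<Union>C)"
  unfolding subring_set_def
proof (intro conjI ballI)
  show "1 \<in> \<Union>C" using assms(1,3) subring_1 by fast
  fix x y assume "x \<in> \<Union>C" "y \<in> \<Union>C"
  then obtain R where "R \<in> C" "x \<in> R" "y \<in> R" using assms(2) by blast
  then show "x - y \<in> \<Union>C" "x * y \<in> \<Union>C" using assms(3) subring_diff subring_mult by blast+
qed

locale valuation_ring =
  fixes V :: "'w::field set"
  assumes subring: "subring_set V" and total: "x \<notin> V \<Longrightarrow> inverse x \<in> V"
begin

text \<open>The non-units. Zero is listed separately because \<open>inverse 0 = 0\<close> lies in
  V.\<close>

definition max_ideal :: "'w set" where
  "max_ideal = {x \<in> V. x = 0 \<or> inverse x \<notin> V}"

lemma max_ideal_subset: "x \<in> max_ideal \<Longrightarrow> x \<in> V"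
  by (simp add: max_ideal_def)

lemma unit_inverse: "x \<in> V \<Longrightarrow> x \<notin> max_ideal \<Longrightarrow> inverse x \<in> V"
  by (simp add: max_ideal_def)

lemma max_ideal_mult:
  assumes "x \<in> max_ideal" "y \<in> V"
  shows "x * y \<in> max_ideal"
proof (rule ccontr)
  assume *: "x * y \<notin> max_ideal"
  then have "inverse (x * y) \<in> V" "x * y \<noteq> 0"
    using assms subring_mult[OF subring] by (auto simp: max_ideal_def)
  then have "inverse (x * y) * y \<in> V" using assms subring_mult[OF subring] by blast
  then have "inverse x \<in> V" using \<open>x * y \<noteq> 0\<close> by (simp add: field_simps)
  then show False using assms \<open>x * y \<noteq> 0\<close> by (simp add: max_ideal_def)
qed

lemma inverse_in_max_ideal:
  assumes "x \<notin> V"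
  shows "inverse x \<in> max_ideal"
proof -
  have "x \<noteq> 0" using assms subring_0[OF subring] by auto
  then show ?thesis using assms total[OF assms] by (simp add: max_ideal_def)
qed

text \<open>One of y / x and x / y lies in V, so the sum is a multiple in V of one of the
  summands.\<close>

lemma max_ideal_add:
  assumes "x \<in> max_ideal" "y \<in> max_ideal"
  shows "x + y \<in> max_ideal"
proof -
  have *: "x + y \<in> max_ideal" if "x \<in> max_ideal" "x \<noteq> 0" "y / x \<in> V" for x y
  proof -
    have "x * (1 + y / x) \<in> max_ideal"
      using that by (intro max_ideal_mult subring_add[OF subring] subring_1[OF subring])
    moreover have "x * (1 + y / x) = x + y" using that by (simp add: distrib_left)
    ultimately show ?thesis by simp
  qed
  show ?thesis
  proof (cases "x = 0 \<or> y = 0")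
    case False
    then show ?thesis
      using *[of x y] *[of y x] total[of "y / x"] assms by (cases "y / x \<in> V") (auto simp: add.commute)
  qed (use assms in auto)
qed

lemma max_ideal_minus: "x \<in> max_ideal \<Longrightarrow> - x \<in> max_ideal"
  using max_ideal_mult[of x "-1"] subring_minus[OF subring subring_1[OF subring]] by simp

lemma max_ideal_0: "0 \<in> max_ideal"
  using subring_0[OF subring] by (simp add: max_ideal_def)

lemma max_ideal_sum: "(\<And>i. i \<in> S \<Longrightarrow> f i \<in> max_ideal) \<Longrightarrow> sum f S \<in> max_ideal"
  by (induction S rule: infinite_finite_induct) (auto intro: max_ideal_0 max_ideal_add)

lemma max_ideal_power: "x \<in> max_ideal \<Longrightarrow> n > 0 \<Longrightarrow> x ^ n \<in> max_ideal"
  by (cases n) (auto intro!: max_ideal_mult subring_power[OF subring] dest: max_ideal_subset)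

lemma unit_notin_max_ideal: "x \<noteq> 0 \<Longrightarrow> inverse x \<in> V \<Longrightarrow> x \<notin> max_ideal"
  by (simp add: max_ideal_def)

lemma subfield_notin_max_ideal:
  "subfield_set E \<Longrightarrow> E \<subseteq> V \<Longrightarrow> c \<in> E \<Longrightarrow> c \<noteq> 0 \<Longrightarrow> c \<notin> max_ideal"
  by (intro unit_notin_max_ideal) (auto dest: subfield_inverse)

lemma max_ideal_prime:
  assumes "x \<in> V" "y \<in> V" "x * y \<in> max_ideal"
  shows "x \<in> max_ideal \<or> y \<in> max_ideal"
proof (rule ccontr)
  assume "\<not> ?thesis"
  then have "y \<notin> max_ideal" "inverse x \<in> V" "x \<noteq> 0" using assms(1) by (simp_all add: max_ideal_def)
  then have "x * y * inverse x \<in> max_ideal" using max_ideal_mult[OF assms(3)] by blast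
  moreover have "x * y * inverse x = y" using \<open>x \<noteq> 0\<close> by simp
  ultimately show False using \<open>y \<notin> max_ideal\<close> by simp
qed

text \<open>Valuation rings are integrally closed. For x outside V the inverse is in the maximal
  ideal, and dividing the equation by x^n would put the leading coefficient there, although it is a
  unit.\<close>

lemma algebraic_in_V:
  assumes E: "subfield_set E" "E \<subseteq> V" and p: "p \<in> polyset E" "p \<noteq> 0" "poly p x = 0"
  shows "x \<in> V"
proof (rule ccontr)
  assume x: "x \<notin> V"
  then have x0: "x \<noteq> 0" using subring_0[OF subring] by auto
  define n where "n = degree p"
  define y where "y = inverse x"
  have y: "y \<in> max_ideal" using x by (simp add: y_def inverse_in_max_ideal)
  have "0 = y ^ n * poly p (inverse y)" using p by (simp add: y_def)
  also have "\<dots> = (\<Sum>i\<le>n. coeff p i * y ^ (n - i))"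
    unfolding n_def using x0 by (intro power_mult_poly_inverse) (auto simp: y_def)
  also have "\<dots> = (\<Sum>i<n. coeff p i * y ^ (n - i)) + coeff p n"
    by (simp add: lessThan_Suc_atMost[symmetric])
  finally have "coeff p n = - (\<Sum>i<n. coeff p i * y ^ (n - i))"
    by (simp add: eq_neg_iff_add_eq_0 add.commute)
  moreover have "(\<Sum>i<n. coeff p i * y ^ (n - i)) \<in> max_ideal"
  proof (rule max_ideal_sum)
    fix i assume "i \<in> {..<n}"
    then have "y ^ (n - i) * coeff p i \<in> max_ideal"
      using y p E by (intro max_ideal_mult max_ideal_power) (auto simp: polyset_def)
    then show "coeff p i * y ^ (n - i) \<in> max_ideal" by (simp add: mult.commute)
  qed
  ultimately have "coeff p n \<in> max_ideal" by (simp add: max_ideal_minus)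
  moreover have "coeff p n \<notin> max_ideal"
    using p by (intro subfield_notin_max_ideal[OF E]) (auto simp: polyset_def n_def)
  ultimately show False by simp
qed

end

lemma minimal_degree_relation:
  assumes "p \<in> P" "Q p"
  obtains p where "p \<in> P" "Q p" "\<And>q. q \<in> P \<Longrightarrow> Q q \<Longrightarrow> degree p \<le> degree q"
proof -
  have "\<exists>p. (p \<in> P \<and> Q p) \<and> (\<forall>q. q \<in> P \<and> Q q \<longrightarrow> degree p \<le> degree q)"
    using assms by (intro ex_has_least_nat[of "\<lambda>p. p \<in> P \<and> Q p"]) auto
  then show ?thesis using that by blast
qed

text \<open>Chevalley's existence theorem: a subring that is maximal among those in which I does not
  generate the unit ideal is a valuation ring.\<close>

theorem valuation_ring_exists:
  fixes A I :: "'w::field set"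
  assumes A: "subring_set A" and IA: "I \<subseteq> A" and proper: "1 \<notin> ideal_gen I A"
  obtains V where "valuation_ring V" "A \<subseteq> V" "I \<subseteq> valuation_ring.max_ideal V"
proof -
  define FF where "FF = {R. subring_set R \<and> A \<subseteq> R \<and> 1 \<notin> ideal_gen I R}"
  have "\<exists>V\<in>FF. \<forall>Z\<in>FF. V \<subseteq> Z \<longrightarrow> Z = V"
  proof (rule subset_Zorn_nonempty)
    show "FF \<noteq> {}" using assms by (auto simp: FF_def)
    fix C assume C: "C \<noteq> {}" "subset.chain FF C"
    then have ch: "R \<subseteq> R' \<or> R' \<subseteq> R" if "R \<in> C" "R' \<in> C" for R R'
      using that by (auto simp: subset_chain_def)
    have CA: "R \<in> FF" if "R \<in> C" for R using C that by (auto simp: subset_chain_def)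
    have "subring_set (\<Union>C)" using CA by (intro chain_Union_subring C ch) (auto simp: FF_def)
    moreover have "A \<subseteq> \<Union>C" using C(1) CA by (auto simp: FF_def)
    moreover have "1 \<notin> ideal_gen I (\<Union>C)"
      using ideal_gen_chain[OF C(1) ch, of 1 I] CA by (auto simp: FF_def)
    ultimately show "\<Union>C \<in> FF" by (simp add: FF_def)
  qed
  then obtain V where V: "V \<in> FF" and max: "\<And>Z. Z \<in> FF \<Longrightarrow> V \<subseteq> Z \<Longrightarrow> Z = V" by blast
  have sV: "subring_set V" and AV: "A \<subseteq> V" and pV: "1 \<notin> ideal_gen I V" using V by (auto simp: FF_def)
  let ?M = "ideal_gen I V"
  have MV: "?M \<subseteq> V" using sV AV IA by (intro ideal_gen_subset) auto
  \<comment> \<open>By maximality, adjoining any new x makes I generate 1; collecting powers of x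
    gives a polynomial over I V with value 1 at x.\<close>
  have adj: "\<exists>p\<in>polyset ?M. poly p x = 1" if "x \<notin> V" for x
  proof -
    have "adjoin V x \<noteq> V" using adjoin_self[OF sV, of x] that by auto
    then have "adjoin V x \<notin> FF" using max adjoin_base[OF sV] by blast
    then have "1 \<in> ideal_gen I (adjoin V x)"
      using subring_adjoin[OF sV, of x] adjoin_base[OF sV, of x] AV by (auto simp: FF_def)
    then show ?thesis using ideal_gen_adjoin[OF sV] by metis
  qed
  \<comment> \<open>A substitute for knowing already that V is local. If 1/u were missing from V,
    multiplying its relation by a power of u would put some u^n into I V next to 1 - u^n.\<close>
  have unit: "inverse u \<in> V" "u \<noteq> 0" if u: "u \<in> V" "1 - u \<in> ?M" for u
  proof -
    have pow: "1 - u ^ n \<in> ?M" for n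
    proof (induction n)
      case (Suc n)
      have "(1 - u ^ n) * u + (1 - u) \<in> ?M"
        using Suc u by (intro ideal_gen_add ideal_gen_mult sV)
      then show ?case by (simp add: algebra_simps)
    qed (simp add: ideal_gen.zero)
    show u0: "u \<noteq> 0" using u pV by auto
    show "inverse u \<in> V"
    proof (rule ccontr)
      assume "inverse u \<notin> V"
      then obtain p where p: "p \<in> polyset ?M" "poly p (inverse u) = 1" using adj by blast
      let ?n = "degree p"
      have "u ^ ?n = u ^ ?n * poly p (inverse u)" using p by simp
      also have "\<dots> = (\<Sum>i\<le>?n. coeff p i * u ^ (?n - i))"
        by (rule power_mult_poly_inverse[OF u0 order_refl])
      also have "\<dots> \<in> ?M"
        using p u by (intro ideal_gen_sum ideal_gen_mult sV subring_power[OF sV]) (auto simp: polyset_def)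
      finally have "u ^ ?n + (1 - u ^ ?n) \<in> ?M" using pow by (intro ideal_gen_add)
      then show False using pV by simp
    qed
  qed
  \<comment> \<open>Of two relations of least degree, in x and in 1/x, the one of smaller degree
    expresses x^n by lower powers and thereby shortens the other one.\<close>
  have key: False
    if x: "x \<noteq> 0" and p: "p \<in> polyset ?M" "poly p x = 1"
      "\<And>p'. p' \<in> polyset ?M \<Longrightarrow> poly p' x = 1 \<Longrightarrow> degree p \<le> degree p'"
      and q: "q \<in> polyset ?M" "poly q (inverse x) = 1" and le: "degree q \<le> degree p" for x p q
  proof -
    define n where "n = degree p"
    define m where "m = degree q"
    \<comment> \<open>After multiplication of the relation in 1/x by x^n, this is the total
      coefficient of x^n. It is 1 modulo I V, hence a unit.\<close>
    define u where "u = 1 - coeff q 0"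
    have uV: "u \<in> V" using q MV sV by (auto simp: u_def polyset_def intro!: subring_diff subring_1)
    have u: "inverse u \<in> V" "u \<noteq> 0" using unit[OF uV] q by (auto simp: u_def polyset_def)
    have n0: "n > 0"
    proof (rule ccontr)
      assume "\<not> n > 0"
      then obtain c where "p = [:c:]" using degree_eq_zeroE n_def by auto
      then have "c = 1" "c \<in> ?M" using p(1,2) by (auto simp: polyset_def coeff_pCons split: nat.splits)
      then show False using pV by simp
    qed
    have "x ^ n = x ^ n * poly q (inverse x)" using q by simp
    also have "\<dots> = (\<Sum>j\<le>m. coeff q j * x ^ (n - j))"
      unfolding m_def n_def by (rule power_mult_poly_inverse[OF x le])
    also have "\<dots> = coeff q 0 * x ^ n + (\<Sum>j\<in>{1..m}. coeff q j * x ^ (n - j))"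
      by (simp add: atMost_atLeast0 sum.atLeast_Suc_atMost)
    finally have "u * x ^ n = (\<Sum>j\<in>{1..m}. coeff q j * x ^ (n - j))"
      by (simp add: u_def algebra_simps)
    then have "inverse u * (u * x ^ n) = (\<Sum>j\<in>{1..m}. inverse u * coeff q j * x ^ (n - j))"
      by (simp add: sum_distrib_left mult.assoc)
    then have xn: "x ^ n = (\<Sum>j\<in>{1..m}. inverse u * coeff q j * x ^ (n - j))"
      using u(2) by (simp add: field_simps)
    define p' where "p' = p - monom (coeff p n) n
      + (\<Sum>j\<in>{1..m}. monom (coeff p n * (inverse u * coeff q j)) (n - j))"
    have "poly p' x = poly p x - coeff p n * x ^ n
        + coeff p n * (\<Sum>j\<in>{1..m}. inverse u * coeff q j * x ^ (n - j))"
      by (simp add: p'_def poly_monom poly_sum sum_distrib_left mult.assoc)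
    then have "poly p' x = 1" unfolding xn[symmetric] using p(2) by simp
    moreover have "p' \<in> polyset ?M"
      unfolding polyset_def
    proof (intro CollectI allI)
      fix i
      have "coeff p i - coeff (monom (coeff p n) n) i = (if i = n then 0 else coeff p i)" by simp
      then have "coeff p i - coeff (monom (coeff p n) n) i \<in> ?M"
        using p(1) by (auto simp: polyset_def ideal_gen.zero)
      moreover have "coeff (monom (coeff p n * (inverse u * coeff q j)) (n - j)) i \<in> ?M" for j
      proof -
        have "coeff p n \<in> ?M" "inverse u * coeff q j \<in> V"
          using p(1) q(1) u MV by (auto simp: polyset_def intro!: subring_mult[OF sV])
        then show ?thesis by (auto simp: ideal_gen.zero intro!: ideal_gen_mult[OF sV])
      qed
      ultimately show "coeff p' i \<in> ?M"
        unfolding p'_def coeff_add coeff_diff coeff_sum by (intro ideal_gen_add ideal_gen_sum)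
    qed
    ultimately have "n \<le> degree p'" using p(3) n_def by blast
    moreover have "degree p' < n"
    proof -
      have "coeff p' i = 0" if "i \<ge> n" for i
        using that n0 le by (auto simp: p'_def coeff_sum n_def m_def coeff_eq_0 intro!: sum.neutral)
      then have "degree p' \<le> n - 1" using n0 by (intro degree_le) auto
      then show ?thesis using n0 by simp
    qed
    ultimately show False by simp
  qed
  interpret valuation_ring V
  proof
    show "subring_set V" by fact
    fix x assume x: "x \<notin> V"
    have x0: "x \<noteq> 0" using x subring_0[OF sV] by auto
    show "inverse x \<in> V"
    proof (rule ccontr)
      assume nx: "inverse x \<notin> V"
      obtain p where p: "p \<in> polyset ?M" "poly p x = 1"
        "\<And>p'. p' \<in> polyset ?M \<Longrightarrow> poly p' x = 1 \<Longrightarrow> degree p \<le> degree p'"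
        using adj[OF x] minimal_degree_relation[of _ "polyset ?M" "\<lambda>p. poly p x = 1"] by metis
      obtain q where q: "q \<in> polyset ?M" "poly q (inverse x) = 1"
        "\<And>p'. p' \<in> polyset ?M \<Longrightarrow> poly p' (inverse x) = 1 \<Longrightarrow> degree q \<le> degree p'"
        using adj[OF nx] minimal_degree_relation[of _ "polyset ?M" "\<lambda>p. poly p (inverse x) = 1"] by metis
      show False
        using key[of x p q] key[of "inverse x" q p] p q x0 by (cases "degree q \<le> degree p") auto
    qed
  qed
  show ?thesis
  proof (rule that)
    show "valuation_ring V" by unfold_locales
    show "I \<subseteq> max_ideal"
    proof
      fix a assume a: "a \<in> I"
      then have aV: "a \<in> V" using IA AV by auto
      show "a \<in> max_ideal"
      proof (rule ccontr)
        assume "a \<notin> max_ideal"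
        then have "inverse a \<in> V" "a \<noteq> 0" using aV by (auto simp: max_ideal_def)
        then have "a * inverse a \<in> ?M"
          using a by (intro ideal_gen_mult sV ideal_gen_base)
        then show False using pV \<open>a \<noteq> 0\<close> by simp
      qed
    qed
  qed fact
qed

lemma polyset_division:
  fixes g :: "'a::idom poly"
  assumes A: "subring_set A" and g: "g \<in> polyset A" "g \<noteq> 0"
  shows "p \<in> polyset A \<Longrightarrow> \<exists>N q r. q \<in> polyset A \<and> r \<in> polyset A \<and>
    smult (lead_coeff g ^ N) p = g * q + r \<and> (r = 0 \<or> degree r < degree g)"
proof (induction "degree p" arbitrary: p rule: less_induct)
  case less
  note P = subring_polyset[OF A]
  show ?case
  proof (cases "p = 0 \<or> degree p < degree g")
    case True
    then show ?thesis using less.prems subring_0[OF P]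
      by (intro exI[of _ 0] exI[of _ p]) (auto simp: )
  next
    case False
    define k where "k = degree p - degree g"
    define t where "t = monom (lead_coeff p) k"
    define p' where "p' = smult (lead_coeff g) p - t * g"
    have lg: "lead_coeff g \<in> A" "lead_coeff p \<in> A" using g less.prems by (auto simp: polyset_def)
    have tA: "t \<in> polyset A" using A lg by (auto simp: t_def intro: polyset_monom)
    have p'A: "p' \<in> polyset A"
      unfolding p'_def using g tA lg less.prems
      by (intro subring_diff[OF P] subring_mult[OF P] polyset_smult A)
    have t: "degree (t * g) = degree p" "coeff (t * g) (degree p) = lead_coeff g * lead_coeff p"
    proof -
      have "t \<noteq> 0" using False by (simp add: t_def)
      then show "degree (t * g) = degree p" using g False
        by (subst degree_mult_eq) (auto simp: t_def degree_monom_eq k_def)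
      then show "coeff (t * g) (degree p) = lead_coeff g * lead_coeff p"
        using lead_coeff_mult[of t g] \<open>t \<noteq> 0\<close> False by (simp add: t_def degree_monom_eq)
    qed
    show ?thesis
    proof (cases "degree p = 0")
      case True
      then have dg: "degree g = 0" using False by simp
      then obtain c where c: "g = [:c:]" using degree_eq_zeroE by blast
      show ?thesis
        using less.prems g subring_0[OF P]
        by (intro exI[of _ 1] exI[of _ p] exI[of _ 0]) (auto simp: c)
    next
      case dp: False
      have "degree p' < degree p"
      proof -
        have "degree p' \<le> degree p"
          unfolding p'_def using t(1) by (intro degree_diff_le degree_smult_le) auto
        moreover have "coeff p' (degree p) = 0" by (simp add: p'_def t(2))
        ultimately show ?thesis using dp
          by (metis degree_0 eq_zero_or_degree_less neq0_conv)
      qed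
      then obtain N q r where IH: "q \<in> polyset A" "r \<in> polyset A"
        "smult (lead_coeff g ^ N) p' = g * q + r" "r = 0 \<or> degree r < degree g"
        using less.hyps p'A by blast
      have "smult (lead_coeff g ^ Suc N) p = smult (lead_coeff g ^ N) (p' + t * g)"
        by (simp add: p'_def mult.commute)
      also have "\<dots> = g * (q + smult (lead_coeff g ^ N) t) + r"
        by (simp add: smult_add_right IH(3) algebra_simps)
      finally show ?thesis using IH tA lg
        by (intro exI[of _ "Suc N"] exI[of _ "q + smult (lead_coeff g ^ N) t"] exI[of _ r])
          (auto intro!: subring_add[OF P] polyset_smult A subring_power[OF A])
    qed
  qed
qed

text \<open>Modulo g the n + 1 powers of b up to b^n become remainders of degree below n, which must
  be linearly dependent. The powers of the leading coefficient from the pseudo-division reappear as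
  nonzero factors in the relation for b.\<close>

lemma algebraic_adjoin:
  fixes x :: "'a::idom"
  assumes A: "subring_set A" and g: "g \<in> polyset A" "g \<noteq> 0" "poly g x = 0"
    and b: "b \<in> adjoin A x"
  shows "\<exists>t\<in>polyset A. t \<noteq> 0 \<and> poly t b = 0"
proof -
  note P = subring_polyset[OF A]
  obtain pb where pb: "pb \<in> polyset A" "b = poly pb x" using b by (auto simp: adjoin_def)
  define n where "n = degree g"
  define d where "d = lead_coeff g"
  have d: "d \<in> A" "d \<noteq> 0" using g by (auto simp: d_def polyset_def)
  have "\<forall>i. \<exists>N q r. q \<in> polyset A \<and> r \<in> polyset A \<and>
    smult (d ^ N) (pb ^ i) = g * q + r \<and> (r = 0 \<or> degree r < n)"
    unfolding d_def n_def using polyset_division[OF A g(1,2)] subring_power[OF P pb(1)] by blast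
  then obtain N q r where *: "\<And>i. r i \<in> polyset A"
    "\<And>i. smult (d ^ N i) (pb ^ i) = g * q i + r i" "\<And>i. r i = 0 \<or> degree (r i) < n" by metis
  have ri: "poly (r i) x = d ^ N i * b ^ i" for i
    using arg_cong[OF *(2)[of i], of "\<lambda>p. poly p x"] g pb by simp
  obtain h where h: "\<forall>i\<in>{..n}. h i \<in> A" "\<exists>i\<in>{..n}. h i \<noteq> 0"
    "\<forall>j\<in>{..<n}. (\<Sum>i\<in>{..n}. h i * coeff (r i) j) = 0"
    using homogeneous_system[of "{..<n}" "{..n}" A "\<lambda>i j. coeff (r i) j"] A * by (auto simp: polyset_def)
  define t where "t = (\<Sum>i\<le>n. monom (h i * d ^ N i) i)"
  have ct: "coeff t i = h i * d ^ N i" if "i \<le> n" for i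
    using that by (simp add: t_def coeff_sum)
  have zero: "(\<Sum>i\<le>n. smult (h i) (r i)) = 0"
  proof (rule poly_eqI)
    fix j
    show "coeff (\<Sum>i\<le>n. smult (h i) (r i)) j = coeff 0 j"
    proof (cases "j < n")
      case True
      then show ?thesis using h(3) by (simp add: coeff_sum)
    next
      case False
      then have "coeff (r i) j = 0" for i using *(3)[of i] by (auto simp: coeff_eq_0)
      then show ?thesis by (simp add: coeff_sum)
    qed
  qed
  have "poly t b = (\<Sum>i\<le>n. h i * poly (r i) x)"
    by (simp add: t_def poly_sum poly_monom ri mult.assoc)
  also have "\<dots> = poly (\<Sum>i\<le>n. smult (h i) (r i)) x" by (simp add: poly_sum)
  finally have "poly t b = 0" unfolding zero by simp
  moreover have "t \<noteq> 0" using h(2) ct d by (metis atMost_iff coeff_0 mult_eq_0_iff power_not_zero)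
  moreover have "t \<in> polyset A" unfolding t_def
    using h(1) d by (intro subring_sum[OF P] polyset_monom A subring_mult[OF A] subring_power[OF A]) auto
  ultimately show ?thesis by blast
qed

context valuation_ring
begin

text \<open>Numerators and denominators are algebraic over E; the inverse of a denominator is a root
  of the reversed polynomial.\<close>

lemma fracs_adjoin_algebraic:
  assumes E: "subfield_set E" "E \<subseteq> V" and p: "p \<in> polyset E" "p \<noteq> 0" "poly p x = 0"
  shows "fracs (adjoin E x) \<subseteq> V"
proof
  note sE = subfield_subring[OF E(1)]
  fix y assume "y \<in> fracs (adjoin E x)"
  then obtain a b where ab: "y = a / b" "a \<in> adjoin E x" "b \<in> adjoin E x" "b \<noteq> 0" by (auto simp: fracs_def)
  have "a \<in> V" using algebraic_adjoin[OF sE p ab(2)] algebraic_in_V[OF E] by blast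
  moreover have "inverse b \<in> V"
  proof -
    obtain t where t: "t \<in> polyset E" "t \<noteq> 0" "poly t b = 0" using algebraic_adjoin[OF sE p ab(3)] by blast
    have "poly (reflect_poly t) (inverse b) = 0"
      using t ab(4) poly_reflect_poly_nz[of "inverse b" t] by simp
    moreover have "reflect_poly t \<in> polyset E"
      using t(1) subring_0[OF sE] by (auto simp: polyset_def coeff_reflect_poly)
    ultimately show ?thesis using t(2) by (intro algebraic_in_V[OF E, of "reflect_poly t"]) auto
  qed
  ultimately show "y \<in> V" unfolding ab(1) field_class.field_divide_inverse by (rule subring_mult[OF subring])
qed

end

text \<open>Over an algebraically closed field a maximal subfield of a valuation ring is a set of
  representatives for the residue field; no completeness is needed.\<close>

theorem coefficient_field_exists:
  fixes V :: "'w::alg_closed_field set"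
  assumes "valuation_ring V" and E: "subfield_set E" "E \<subseteq> V"
  obtains k where "subfield_set k" "E \<subseteq> k" "k \<subseteq> V"
    "\<And>x. x \<in> V \<Longrightarrow> \<exists>c\<in>k. x - c \<in> valuation_ring.max_ideal V"
proof -
  interpret valuation_ring V by fact
  define FF where "FF = {k. subfield_set k \<and> E \<subseteq> k \<and> k \<subseteq> V}"
  have "\<exists>k\<in>FF. \<forall>Z\<in>FF. k \<subseteq> Z \<longrightarrow> Z = k"
  proof (rule subset_Zorn_nonempty)
    show "FF \<noteq> {}" using assms by (auto simp: FF_def)
    fix C assume C: "C \<noteq> {}" "subset.chain FF C"
    then have ch: "R \<subseteq> R' \<or> R' \<subseteq> R" if "R \<in> C" "R' \<in> C" for R R'
      using that by (auto simp: subset_chain_def)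
    have CA: "R \<in> FF" if "R \<in> C" for R using C that by (auto simp: subset_chain_def)
    have "subring_set (\<Union>C)" using CA by (intro chain_Union_subring C ch) (auto simp: FF_def subfield_set_def)
    moreover have "inverse x \<in> \<Union>C" if "x \<in> \<Union>C" for x
      using that CA subfield_inverse unfolding FF_def by blast
    ultimately have "subfield_set (\<Union>C)" by (simp add: subfield_set_def)
    then show "\<Union>C \<in> FF" using C(1) CA by (fastforce simp: FF_def)
  qed
  then obtain k where k: "k \<in> FF" and max: "\<And>Z. Z \<in> FF \<Longrightarrow> k \<subseteq> Z \<Longrightarrow> Z = k" by blast
  have kf: "subfield_set k" and Ek: "E \<subseteq> k" and kV: "k \<subseteq> V" using k by (auto simp: FF_def)
  note sk = subfield_subring[OF kf]
  have ext: "x \<in> k" if "fracs (adjoin k x) \<subseteq> V" for x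
  proof -
    have sub: "k \<subseteq> fracs (adjoin k x)"
      using adjoin_base[OF sk, of x] fracs_base[OF subring_adjoin[OF sk, of x]] by blast
    then have "fracs (adjoin k x) = k"
      using Ek that subfield_fracs[OF subring_adjoin[OF sk, of x]] by (intro max) (auto simp: FF_def)
    then show ?thesis using adjoin_self[OF sk, of x] fracs_base[OF subring_adjoin[OF sk, of x]] by blast
  qed
  \<comment> \<open>So k is algebraically closed in the ambient field, and every polynomial over k
    splits over k itself.\<close>
  have alg: "x \<in> k" if "p \<in> polyset k" "p \<noteq> 0" "poly p x = 0" for p x
    using ext fracs_adjoin_algebraic[OF kf kV that] by blast
  \<comment> \<open>If x is algebraic modulo the maximal ideal, that ideal is prime and contains
    some linear factor x - c of the relation. Otherwise all nonzero p(x) are units, k(x) lies in V,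
    and x is in k by maximality.\<close>
  have "\<exists>c\<in>k. x - c \<in> max_ideal" if x: "x \<in> V" for x
  proof (cases "\<exists>p\<in>polyset k. p \<noteq> 0 \<and> poly p x \<in> max_ideal")
    case True
    then obtain p where p: "p \<in> polyset k" "p \<noteq> 0" "poly p x \<in> max_ideal" by blast
    obtain A where A: "size A = degree p" "p = smult (lead_coeff p) (\<Prod>c\<in>#A. [:-c, 1:])"
      using alg_closed_imp_factorization[OF p(2)] by blast
    have Ak: "c \<in> k" if "c \<in># A" for c
    proof (rule alg[OF p(1,2)])
      have "poly (\<Prod>c\<in>#A. [:-c, 1:]) c = 0"
        using that by (auto simp: poly_prod_mset prod_mset_zero_iff)
      then show "poly p c = 0" by (subst A(2)) simp
    qed
    have lc: "lead_coeff p \<in> k" "lead_coeff p \<noteq> 0" using p by (auto simp: polyset_def)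
    have "poly p x = lead_coeff p * (\<Prod>c\<in>#A. x - c)"
      by (subst A(2)) (simp add: poly_prod_mset)
    moreover have "\<exists>c\<in>#B. x - c \<in> max_ideal"
      if "set_mset B \<subseteq> set_mset A" "a * (\<Prod>c\<in>#B. x - c) \<in> max_ideal" "a \<in> k" "a \<noteq> 0" for B a
      using that(1,2)
    proof (induction B)
      case empty
      then show ?case using subfield_notin_max_ideal[OF kf kV that(3,4)] by simp
    next
      case (add c B)
      have cV: "x - c \<in> V" using x Ak[of c] kV add.prems by (auto intro: subring_diff[OF subring])
      have BV: "a * (\<Prod>c\<in>#B. x - c) \<in> V"
      proof -
        have "set_mset B \<subseteq> set_mset A" using add.prems by auto
        then have "(\<Prod>c\<in>#B. x - c) \<in> V"
          by (induction B) (use x Ak kV in \<open>auto intro!: subring_mult[OF subring] subring_1[OF subring] subring_diff[OF subring]\<close>)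
        then show ?thesis using that(3) kV by (auto intro: subring_mult[OF subring])
      qed
      have "(x - c) * (a * (\<Prod>c\<in>#B. x - c)) \<in> max_ideal" using add.prems(2) by (simp add: mult_ac)
      then consider "x - c \<in> max_ideal" | "a * (\<Prod>c\<in>#B. x - c) \<in> max_ideal"
        using max_ideal_prime[OF cV BV] by blast
      then show ?case using add.IH add.prems by cases auto
    qed
    ultimately have "\<exists>c\<in>#A. x - c \<in> max_ideal" using p(3) lc by auto
    then show ?thesis using Ak by blast
  next
    case False
    have "fracs (adjoin k x) \<subseteq> V"
    proof
      fix y assume "y \<in> fracs (adjoin k x)"
      then obtain p q where pq: "y = poly p x / poly q x" "p \<in> polyset k" "q \<in> polyset k" "poly q x \<noteq> 0"
        by (auto simp: fracs_def adjoin_def)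
      have in_V: "poly r x \<in> V" if "r \<in> polyset k" for r
        using that kV x by (intro poly_in_subring[OF subring]) (auto simp: polyset_def)
      have "q \<noteq> 0" using pq(4) by auto
      then have "inverse (poly q x) \<in> V" using False pq(3) in_V unit_inverse by blast
      then show "y \<in> V" unfolding pq(1) field_class.field_divide_inverse
        using in_V pq(2) by (intro subring_mult[OF subring]) auto
    qed
    then have "x \<in> k" by (rule ext)
    then show ?thesis using max_ideal_0 by (intro bexI[of _ x]) auto
  qed
  then show ?thesis using that kf Ek kV by blast
qed

section \<open>Specialization to an algebraically closed field\<close>

definition hom_on :: "'a::comm_ring_1 set \<Rightarrow> ('a \<Rightarrow> 'b::comm_ring_1) \<Rightarrow> bool" where
  "hom_on A h \<longleftrightarrow> h 1 = 1 \<and> (\<forall>x\<in>A. \<forall>y\<in>A. h (x - y) = h x - h y \<and> h (x * y) = h x * h y)"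

lemma hom_on_rel:
  assumes "subring_set A" "hom_on A h"
  shows "ring_rel (\<lambda>a b. a \<in> A \<and> b = h a)"
  using assms by (auto simp: ring_rel_def hom_on_def subring_set_def)

lemma hom_onD:
  assumes A: "subring_set A" and h: "hom_on A h"
  shows hom_on_0: "h 0 = 0" and hom_on_1: "h 1 = 1"
    and hom_on_diff: "x \<in> A \<Longrightarrow> y \<in> A \<Longrightarrow> h (x - y) = h x - h y"
    and hom_on_mult: "x \<in> A \<Longrightarrow> y \<in> A \<Longrightarrow> h (x * y) = h x * h y"
    and hom_on_power: "x \<in> A \<Longrightarrow> h (x ^ n) = h x ^ n"
    and hom_on_sum: "(\<And>i. i \<in> I \<Longrightarrow> f i \<in> A) \<Longrightarrow> h (sum f I) = (\<Sum>i\<in>I. h (f i))"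
  using h ring_rel_0[OF hom_on_rel[OF A h]] ring_rel_power[OF hom_on_rel[OF A h], of x "h x" n]
    ring_rel_sum[OF hom_on_rel[OF A h], of I f "\<lambda>i. h (f i)"]
  by (auto simp: hom_on_def)

lemma coeff_map_poly_hom:
  "subring_set A \<Longrightarrow> hom_on A h \<Longrightarrow> coeff (map_poly h p) i = h (coeff p i)"
  by (simp add: coeff_map_poly hom_on_0)

lemma hom_on_map_poly:
  assumes A: "subring_set A" and h: "hom_on A h"
  shows "hom_on (polyset A) (map_poly h)"
  unfolding hom_on_def
proof (intro conjI ballI)
  note c = coeff_map_poly_hom[OF A h]
  show "map_poly h 1 = 1" using h by (simp add: hom_on_def)
  fix p q assume "p \<in> polyset A" "q \<in> polyset A"
  then have *: "coeff p i \<in> A" "coeff q i \<in> A" for i by (auto simp: polyset_def)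
  show "map_poly h (p - q) = map_poly h p - map_poly h q"
    by (rule poly_eqI) (use * in \<open>simp add: c hom_on_diff[OF A h]\<close>)
  show "map_poly h (p * q) = map_poly h p * map_poly h q"
    by (rule poly_eqI)
      (use * in \<open>simp add: c coeff_mult hom_on_sum[OF A h] hom_on_mult[OF A h] subring_mult[OF A]\<close>)
qed

lemma hom_on_poly:
  assumes A: "subring_set A" and h: "hom_on A h" and "p \<in> polyset A" "x \<in> A"
  shows "h (poly p x) = poly (map_poly h p) (h x)"
proof -
  have deg: "degree (map_poly h p) \<le> degree p" 
    by (rule degree_le) (simp add: coeff_map_poly_hom[OF A h] coeff_eq_0 hom_on_0[OF A h])
  have "poly (map_poly h p) (h x) = (\<Sum>i\<le>degree p. h (coeff p i) * h x ^ i)"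
    using deg coeff_map_poly_hom[OF A h]
    by (subst poly_altdef, intro sum.mono_neutral_cong_left) (auto simp: coeff_eq_0 not_le intro!: le_degree)
  also have "\<dots> = h (poly p x)"
    unfolding poly_altdef using assms
    by (subst hom_on_sum[OF A h])
      (auto simp: polyset_def hom_on_mult[OF A h] hom_on_power[OF A h] subring_power[OF A] intro!: subring_mult[OF A])
  finally show ?thesis ..
qed

text \<open>If the intended image z satisfies the image of every relation of x, the value does not
  depend on the polynomial chosen to represent an element of A[x].\<close>

lemma hom_on_adjoin_extend:
  assumes A: "subring_set A" and h: "hom_on A h"
    and z: "\<And>p. p \<in> polyset A \<Longrightarrow> poly p x = 0 \<Longrightarrow> poly (map_poly h p) z = 0"
  obtains h' where "hom_on (adjoin A x) h'" "\<And>p. p \<in> polyset A \<Longrightarrow> h' (poly p x) = poly (map_poly h p) z"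
    "\<And>a. a \<in> A \<Longrightarrow> h' a = h a"
proof -
  note P = subring_polyset[OF A] and Hh = hom_on_map_poly[OF A h]
  define h' where "h' y = poly (map_poly h (SOME p. p \<in> polyset A \<and> poly p x = y)) z" for y
  have h': "h' (poly p x) = poly (map_poly h p) z" if p: "p \<in> polyset A" for p
  proof -
    define q where "q = (SOME q. q \<in> polyset A \<and> poly q x = poly p x)"
    have q: "q \<in> polyset A \<and> poly q x = poly p x"
      unfolding q_def by (rule someI[of _ p]) (use p in auto)
    have "poly (map_poly h (q - p)) z = 0"
      using q p by (intro z subring_diff[OF P]) auto
    then show ?thesis
      using q p by (simp add: h'_def q_def[symmetric] hom_on_diff[OF P Hh])
  qed
  have "hom_on (adjoin A x) h'"
    unfolding hom_on_def
  proof (intro conjI ballI)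
    show "h' 1 = 1"
      using h'[OF subring_1[OF P]] hom_on_1[OF P Hh] by simp
    fix y y' assume "y \<in> adjoin A x" "y' \<in> adjoin A x"
    then obtain p q where *: "y = poly p x" "y' = poly q x" "p \<in> polyset A" "q \<in> polyset A"
      by (auto simp: adjoin_def)
    show "h' (y - y') = h' y - h' y'"
      using h'[OF subring_diff[OF P *(3,4)]] h'[OF *(3)] h'[OF *(4)] *
      by (simp add: hom_on_diff[OF P Hh])
    show "h' (y * y') = h' y * h' y'"
      using h'[OF subring_mult[OF P *(3,4)]] h'[OF *(3)] h'[OF *(4)] *
      by (simp add: hom_on_mult[OF P Hh])
  qed
  moreover have "h' a = h a" if "a \<in> A" for a
    using h'[of "[:a:]"] that subring_0[OF A] hom_on_0[OF A h]
    by (simp add: polyset_pCons[OF A] subring_0[OF P] map_poly_pCons)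
  ultimately show ?thesis using that h' by blast
qed

text \<open>Asking for a homomorphism that avoids any prescribed nonzero b is the strengthening that
  makes the induction over generators work: in the step, leading coefficients and a constant term
  have to survive.\<close>

definition specializable :: "('k::field \<Rightarrow> 'w::field) \<Rightarrow> 'w set \<Rightarrow> bool" where
  "specializable \<iota> A \<longleftrightarrow> subring_set A \<and> range \<iota> \<subseteq> A \<and>
     (\<forall>b\<in>A. b \<noteq> 0 \<longrightarrow> (\<exists>h. hom_on A h \<and> (\<forall>c. h (\<iota> c) = c) \<and> h b \<noteq> 0))"

text \<open>For nonconstant p, a root of p - 1 is a point where p does not vanish.\<close>

lemma alg_closed_nonroot_exists:
  fixes p :: "'k::alg_closed_field poly"
  assumes "p \<noteq> 0"
  shows "\<exists>z. poly p z \<noteq> 0"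
proof (cases "degree p = 0")
  case True
  then show ?thesis using assms by (auto elim: degree_eq_zeroE)
next
  case False
  have "coeff (p - 1) (degree p) = lead_coeff p" using False by simp
  then have "degree (p - 1) > 0" using False assms by (metis gr0I le_degree leading_coeff_0_iff le_zero_eq)
  then obtain z where "poly (p - 1) z = 0" using alg_closed_imp_poly_has_root by blast
  then have "poly p z = 1" by simp
  then show ?thesis by (intro exI[of _ z]) simp
qed

theorem specializable_adjoin:
  fixes \<iota> :: "'k::alg_closed_field \<Rightarrow> 'w::field"
  assumes S: "specializable \<iota> A"
  shows "specializable \<iota> (adjoin A x)"
  unfolding specializable_def
proof (intro conjI ballI impI)
  have A: "subring_set A" and \<iota>A: "range \<iota> \<subseteq> A" using S by (auto simp: specializable_def)
  have spec: "\<exists>h. hom_on A h \<and> (\<forall>c. h (\<iota> c) = c) \<and> h b \<noteq> 0" if "b \<in> A" "b \<noteq> 0" for b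
    using S that by (auto simp: specializable_def)
  note P = subring_polyset[OF A]
  show "subring_set (adjoin A x)" by (rule subring_adjoin[OF A])
  show "range \<iota> \<subseteq> adjoin A x" using \<iota>A adjoin_base[OF A] by blast
  fix b assume b: "b \<in> adjoin A x" "b \<noteq> 0"
  then obtain pb where pb: "pb \<in> polyset A" "b = poly pb x" by (auto simp: adjoin_def)
  show "\<exists>h. hom_on (adjoin A x) h \<and> (\<forall>c. h (\<iota> c) = c) \<and> h b \<noteq> 0"
  proof (cases "\<exists>g\<in>polyset A. g \<noteq> 0 \<and> poly g x = 0")
    \<comment> \<open>For transcendental x any z may be its image. Keeping the leading coefficient
      of \<open>pb\<close> alive makes the image of \<open>pb\<close> a nonzero polynomial, and z is
      chosen off its roots.\<close>
    case False
    have "pb \<noteq> 0" using pb b by auto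
    then have "lead_coeff pb \<in> A" "lead_coeff pb \<noteq> 0" using pb by (auto simp: polyset_def)
    then obtain h where h: "hom_on A h" "\<And>c. h (\<iota> c) = c" "h (lead_coeff pb) \<noteq> 0" using spec by blast
    have "map_poly h pb \<noteq> 0"
      using h(3) coeff_map_poly_hom[OF A h(1), of pb "degree pb"] by auto
    then obtain z where z: "poly (map_poly h pb) z \<noteq> 0" using alg_closed_nonroot_exists by blast
    have "poly (map_poly h p) z = 0" if "p \<in> polyset A" "poly p x = 0" for p
      using that False by (metis map_poly_0 poly_0)
    then obtain h' where h': "hom_on (adjoin A x) h'"
      "\<And>p. p \<in> polyset A \<Longrightarrow> h' (poly p x) = poly (map_poly h p) z"
      "\<And>a. a \<in> A \<Longrightarrow> h' a = h a" using hom_on_adjoin_extend[OF A h(1)] by metis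
    have "h' b \<noteq> 0" using h'(2)[OF pb(1)] z pb(2) by simp
    moreover have "h' (\<iota> c) = c" for c using h'(3)[of "\<iota> c"] h(2) \<iota>A by auto
    ultimately show ?thesis using h'(1) by blast
  next
    case True
    then obtain g where g: "g \<in> polyset A" "g \<noteq> 0 \<and> poly g x = 0"
      and gmin: "\<And>q. q \<in> polyset A \<Longrightarrow> q \<noteq> 0 \<and> poly q x = 0 \<Longrightarrow> degree g \<le> degree q"
      using minimal_degree_relation[of _ "polyset A" "\<lambda>g. g \<noteq> 0 \<and> poly g x = 0"] by metis
    obtain t where t: "t \<in> polyset A" "t \<noteq> 0 \<and> poly t b = 0"
      and tmin: "\<And>q. q \<in> polyset A \<Longrightarrow> q \<noteq> 0 \<and> poly q b = 0 \<Longrightarrow> degree t \<le> degree q"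
      using minimal_degree_relation[of _ "polyset A" "\<lambda>t. t \<noteq> 0 \<and> poly t b = 0"]
        algebraic_adjoin[OF A g(1) _ _ b(1)] g(2) by metis
    have t0: "coeff t 0 \<noteq> 0"
    proof
      assume "coeff t 0 = 0"
      then obtain t' where t': "t = pCons 0 t'" by (metis coeff_pCons_0 pCons_cases)
      then have "t' \<in> polyset A" "t' \<noteq> 0" "poly t' b = 0" "degree t' < degree t"
        using t b by (auto simp: polyset_pCons[OF A])
      then show False using tmin[of t'] by simp
    qed
    \<comment> \<open>Two quantities are kept alive by h: d, so that the image of g keeps its degree
      and has a root z, and the constant term of t, so that b cannot be sent to 0.\<close>
    define d where "d = lead_coeff g"
    have "d \<in> A" "d \<noteq> 0" "coeff t 0 \<in> A" using g t by (auto simp: d_def polyset_def)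
    then obtain h where h: "hom_on A h" "\<And>c. h (\<iota> c) = c" "h (d * coeff t 0) \<noteq> 0"
      using spec[of "d * coeff t 0"] t0 subring_mult[OF A] by auto
    then have hd: "h d \<noteq> 0" "h (coeff t 0) \<noteq> 0"
      using \<open>d \<in> A\<close> \<open>coeff t 0 \<in> A\<close> hom_on_mult[OF A h(1)] by auto
    have "degree g \<noteq> 0"
      using g by (metis degree_eq_zeroE mult_zero_right pCons_0_0 poly_pCons add_0_right poly_0)
    moreover have "degree g \<le> degree (map_poly h g)"
      using hd(1) coeff_map_poly_hom[OF A h(1), of g "degree g"] by (intro le_degree) (simp add: d_def)
    ultimately obtain z where z: "poly (map_poly h g) z = 0"
      using alg_closed_imp_poly_has_root[of "map_poly h g"] by auto
    note Hh = hom_on_map_poly[OF A h(1)]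
    \<comment> \<open>The remainder of p modulo g vanishes at x and has smaller degree, so it is 0
      by minimality of g. Up to a power of d, which h does not kill, p is a multiple of g.\<close>
    have "poly (map_poly h p) z = 0" if p: "p \<in> polyset A" "poly p x = 0" for p
    proof -
      obtain N q r where *: "q \<in> polyset A" "r \<in> polyset A" "smult (d ^ N) p = g * q + r"
        "r = 0 \<or> degree r < degree g"
        using polyset_division[OF A g(1) _ p(1)] g(2) unfolding d_def by blast
      have "poly r x = 0" using arg_cong[OF *(3), of "\<lambda>p. poly p x"] p g by simp
      then have "r = 0" using gmin[of r] * by (meson leD)
      then have "map_poly h (smult (d ^ N) p) = map_poly h g * map_poly h q"
        using * g by (simp add: hom_on_mult[OF P Hh])
      moreover have "map_poly h (smult (d ^ N) p) = smult (h d ^ N) (map_poly h p)"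
      proof (rule poly_eqI)
        fix i
        have "coeff p i \<in> A" "d ^ N \<in> A" using p \<open>d \<in> A\<close> subring_power[OF A] by (auto simp: polyset_def)
        then show "coeff (map_poly h (smult (d ^ N) p)) i = coeff (smult (h d ^ N) (map_poly h p)) i"
          using \<open>d \<in> A\<close> by (simp add: coeff_map_poly_hom[OF A h(1)] hom_on_mult[OF A h(1)] hom_on_power[OF A h(1)])
      qed
      ultimately have "h d ^ N * poly (map_poly h p) z = poly (map_poly h g) z * poly (map_poly h q) z"
        by (metis poly_mult poly_smult)
      then show ?thesis using z hd by simp
    qed
    then obtain h' where h': "hom_on (adjoin A x) h'"
      "\<And>p. p \<in> polyset A \<Longrightarrow> h' (poly p x) = poly (map_poly h p) z"
      "\<And>a. a \<in> A \<Longrightarrow> h' a = h a" using hom_on_adjoin_extend[OF A h(1)] by metis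
    have "h' b \<noteq> 0"
    proof
      assume h'b: "h' b = 0"
      note A' = subring_adjoin[OF A, of x]
      have tA': "t \<in> polyset (adjoin A x)" using t(1) adjoin_base[OF A] by (auto simp: polyset_def)
      have "h' (poly t b) = poly (map_poly h' t) (h' b)"
        by (rule hom_on_poly[OF A' h'(1) tA' b(1)])
      then have "h' (coeff t 0) = 0"
        using t h'b hom_on_0[OF A' h'(1)] coeff_map_poly_hom[OF A' h'(1), of t 0] by (simp add: poly_0_coeff_0)
      then show False using h'(3)[of "coeff t 0"] \<open>coeff t 0 \<in> A\<close> hd by simp
    qed
    moreover have "h' (\<iota> c) = c" for c using h'(3)[of "\<iota> c"] h(2) \<iota>A by auto
    ultimately show ?thesis using h'(1) by blast
  qed
qed

lemma specializable_range:
  fixes \<iota> :: "'k::field \<Rightarrow> 'w::field"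
  assumes \<iota>: "ring_map \<iota>"
  shows "specializable \<iota> (range \<iota>)"
proof -
  have inj: "\<iota> a = \<iota> b \<longleftrightarrow> a = b" for a b
    using ring_map_inj_iff[OF \<iota>, of "a - b"] ring_map_diff[OF \<iota>, of a b] by auto
  define h where "h = the_inv \<iota>"
  have h: "h (\<iota> c) = c" for c unfolding h_def using inj by (intro the_inv_f_f injI) auto
  have "h 1 = 1" using h[of 1] ring_map_1[OF \<iota>] by simp
  moreover have "h (\<iota> a - \<iota> b) = a - b" "h (\<iota> a * \<iota> b) = a * b" for a b
    using h[of "a - b"] h[of "a * b"] by (simp_all add: ring_mapD[OF \<iota>])
  ultimately have "hom_on (range \<iota>) h" using h by (auto simp: hom_on_def)
  moreover have "subring_set (range \<iota>)"
    unfolding subring_set_def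
    by (auto simp flip: ring_map_1[OF \<iota>] ring_map_diff[OF \<iota>] ring_map_mult[OF \<iota>])
  ultimately show ?thesis
    unfolding specializable_def using h ring_map_0[OF \<iota>] by (auto intro!: exI[of _ h])
qed

text \<open>This is the Nullstellensatz for finitely generated subalgebras of an extension field.\<close>

corollary specialization_exists:
  fixes \<iota> :: "'k::alg_closed_field \<Rightarrow> 'w::field"
  assumes \<iota>: "ring_map \<iota>" and "finite Z"
  obtains A h where "subring_set A" "range \<iota> \<subseteq> A" "Z \<subseteq> A" "hom_on A h" "\<And>c. h (\<iota> c) = c"
proof -
  from \<open>finite Z\<close> have "\<exists>A. specializable \<iota> A \<and> Z \<subseteq> A"
  proof induction
    case empty
    then show ?case using specializable_range[OF \<iota>] by blast
  next
    case (insert z Z)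
    then obtain A where "specializable \<iota> A" "Z \<subseteq> A" by blast
    moreover from this have "subring_set A" by (simp add: specializable_def)
    ultimately show ?case
      using specializable_adjoin adjoin_base adjoin_self by (intro exI[of _ "adjoin A z"]) blast
  qed
  then obtain A where A: "specializable \<iota> A" "Z \<subseteq> A" by blast
  then have s: "subring_set A" by (simp add: specializable_def)
  then obtain h where "hom_on A h" "\<forall>c. h (\<iota> c) = c"
    using A subring_1[OF s] by (auto simp: specializable_def dest!: bspec[of _ _ 1])
  then show ?thesis using that[OF s] A by (auto simp: specializable_def)
qed


section \<open>Straight-line programs whose constants are parameters\<close>

lemma map_operand_wf [simp]: "wf_operand n k (map_operand f a) = wf_operand n k a"
  by (cases a) auto

lemma map_instr_wf [simp]: "wf_instr n k (map_instr f I) = wf_instr n k I"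
  by (cases I) auto

lemma wf_slp_map [simp]: "wf_slp n (map (map_instr f) P) = wf_slp n P"
  by (simp add: wf_slp_def)

abbreviation slp_vals :: "('c \<Rightarrow> 'a::comm_ring_1) \<Rightarrow> 'c slp \<Rightarrow> 'a mpoly list" where
  "slp_vals f P \<equiv> slp_results (map (map_instr f) P)"

lemma nth_slp_results_append:
  "j < length P \<Longrightarrow> slp_results (P @ Q) ! j = slp_results P ! j"
proof (induction Q rule: rev_induct)
  case (snoc I Q)
  then show ?case
    using slp_results_snoc[of "P @ Q" I] by (simp add: nth_append)
qed simp

lemma slp_results_nth:
  assumes "wf_slp n P" "j < length P"
  shows "slp_results P ! j = instr_val (slp_results P) (P ! j)"
proof -
  have P: "P = take j P @ [P ! j] @ drop (Suc j) P"
    using assms by (simp add: id_take_nth_drop)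
  have len: "length (take j P) = j" using assms by simp
  have "slp_results P ! j = slp_results (take j P @ [P ! j]) ! j"
    using nth_slp_results_append[of j "take j P @ [P ! j]" "drop (Suc j) P"] P len by simp
  also have "\<dots> = instr_val (slp_results (take j P)) (P ! j)"
    using len by (simp add: nth_append)
  also have "\<dots> = instr_val (slp_results P) (P ! j)"
  proof -
    have wf: "wf_instr n j (P ! j)" using assms by (auto simp: wf_slp_def)
    have "operand_val (slp_results (take j P)) a = operand_val (slp_results P) a"
      if "wf_operand n j a" for a
    proof (cases a)
      case (Res i)
      then show ?thesis
        using that nth_slp_results_append[of i "take j P" "drop j P"] len by simp
    qed auto
    then show ?thesis using wf by (cases "P ! j") auto
  qed
  finally show ?thesis .
qed

text \<open>A program only uses ring operations, and the monomials only involve 0 and 1, so every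
  compatible relation passes from the constants to all results. Each later change of the base ring
  is an instance of this.\<close>

lemma slp_vals_rel:
  assumes R: "ring_rel R" and wf: "wf_slp n P"
    and c: "\<And>I a. I \<in> set P \<Longrightarrow> a \<in> set_instr I \<Longrightarrow> R (f a) (g a)"
    and j: "j < length P"
  shows "mpoly_rel R (slp_vals f P ! j) (slp_vals g P ! j)"
  using j
proof (induction j rule: less_induct)
  case (less j)
  note RM = ring_rel_mpoly[OF R]
  have wfj: "wf_instr n j (P ! j)" using wf less.prems by (auto simp: wf_slp_def)
  have op: "mpoly_rel R (operand_val (slp_vals f P) (map_operand f a)) (operand_val (slp_vals g P) (map_operand g a))"
    if "wf_operand n j a" "set_operand a \<subseteq> set_instr (P ! j)" for a
  proof (cases a)
    case (Const b)
    then have "R (f b) (g b)" using c[of "P ! j" b] that less.prems by auto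
    then show ?thesis using Const ring_rel_0[OF R] by (simp add: mconst_def mpoly_rel_single)
  next
    case (Var i)
    then show ?thesis using ring_rel_0[OF R] ring_rel_1[OF R] by (simp add: mvar_def mpoly_rel_single)
  next
    case (Res i)
    then show ?thesis using that less by simp
  qed
  show ?case
    using slp_results_nth[of n "map (map_instr f) P" j] slp_results_nth[of n "map (map_instr g) P" j]
      wf less.prems wfj op
    by (cases "P ! j") (auto intro: ring_rel_diff[OF RM] ring_rel_mult[OF RM] ring_rel_add[OF RM])
qed

text \<open>Instruction \<open>i\<close> has at most one genuine parameter, which is named \<open>i + 2\<close>; the names \<open>0\<close>
  and \<open>1\<close> stand for the constants \<open>0\<close> and \<open>1\<close>.\<close>

definition params :: "(nat \<Rightarrow> 'a::comm_ring_1) \<Rightarrow> nat \<Rightarrow> 'a" where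
  "params y i = (if i = 0 then 0 else if i = 1 then 1 else y (i - 2))"

lemma params_simps [simp]: "params y 0 = 0" "params y (Suc 0) = 1" "params y (Suc (Suc i)) = y i"
  by (simp_all add: params_def)

definition plain_operand :: "nat operand \<Rightarrow> bool" where
  "plain_operand a \<longleftrightarrow> set_operand a \<subseteq> {0, 1}"

definition normal_instr :: "nat set \<Rightarrow> nat \<Rightarrow> nat instr \<Rightarrow> bool" where
  "normal_instr J i I \<longleftrightarrow> (\<exists>a b. I \<in> {Add a b, Sub a b, Mul a b} \<and>
     (if i \<in> J then a = Const (i + 2) \<and> plain_operand b \<or> plain_operand a \<and> b = Const (i + 2)
      else plain_operand a \<and> plain_operand b))"

definition normal_slp :: "nat set \<Rightarrow> nat slp \<Rightarrow> bool" where
  "normal_slp J P \<longleftrightarrow> J \<subseteq> {..<length P} \<and> (\<forall>i<length P. normal_instr J i (P ! i))"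

fun plain :: "'a operand \<Rightarrow> nat operand" where
  "plain (Const c) = Const 0"
| "plain (Var i) = Var i"
| "plain (Res i) = Res i"

text \<open>The arguments \<open>u\<close> and \<open>v\<close> matter when both operands are
  constants: these are merged into the single parameter \<open>v\<close>, and \<open>u\<close> is
  the neutral element that fills the other place. \<open>plain\<close> is applied only to operands
  that are not constants.\<close>

fun normalize_op :: "nat \<Rightarrow> 'a::comm_ring_1 operand \<Rightarrow> 'a operand \<Rightarrow> nat \<Rightarrow> 'a \<Rightarrow>
    (nat operand \<times> nat operand) \<times> 'a" where
  "normalize_op i (Const c) (Const d) u v = ((Const (i + 2), Const u), v)"
| "normalize_op i (Const c) b u v = ((Const (i + 2), plain b), c)"
| "normalize_op i a (Const d) u v = ((plain a, Const (i + 2)), d)"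
| "normalize_op i a b u v = ((plain a, plain b), 0)"

text \<open>The undefined value is harmless: \<open>normalize_op\<close> discards the combined
  constant unless both operands are constants.\<close>

fun op_consts :: "'a operand \<Rightarrow> 'a" where
  "op_consts (Const c) = c"
| "op_consts _ = undefined"

fun normalize_instr :: "nat \<Rightarrow> 'a::comm_ring_1 instr \<Rightarrow> nat instr \<times> 'a" where
  "normalize_instr i (Add a b) =
     (case normalize_op i a b 0 (op_consts a + op_consts b) of ((a', b'), y) \<Rightarrow> (Add a' b', y))"
| "normalize_instr i (Sub a b) =
     (case normalize_op i a b 0 (op_consts a - op_consts b) of ((a', b'), y) \<Rightarrow> (Sub a' b', y))"
| "normalize_instr i (Mul a b) =
     (case normalize_op i a b 1 (op_consts a * op_consts b) of ((a', b'), y) \<Rightarrow> (Mul a' b', y))"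

lemma mconst_simps:
  "mconst (a + b) = mconst a + mconst b" "mconst (a - b) = mconst a - mconst b"
  "mconst (a * b) = mconst a * mconst b" "mconst (0 :: 'a) = 0" "mconst (1 :: 'a) = 1"
  for a b :: "'a::comm_ring_1"
  using ring_mapD[OF ring_map_mconst] by simp_all

lemma slp_normalize:
  fixes P :: "'a::comm_ring_1 slp"
  assumes wf: "wf_slp n P"
  obtains P' J y where "normal_slp J P'" "wf_slp n P'" "length P' = length P"
    "slp_vals (params y) P' = slp_results P"
proof -
  define P' where "P' = map (\<lambda>i. fst (normalize_instr i (P ! i))) [0..<length P]"
  define y where "y i = snd (normalize_instr i (P ! i))" for i
  define J where "J = {i. i < length P \<and> i + 2 \<in> set_instr (P' ! i)}"
  have len: "length P' = length P" by (simp add: P'_def)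
  have P'i: "P' ! i = fst (normalize_instr i (P ! i))" if "i < length P" for i
    using that by (simp add: P'_def)
  have norm: "normal_instr J i (P' ! i)" if i: "i < length P" for i
  proof -
    have *: "i \<in> J \<longleftrightarrow> i + 2 \<in> set_instr (P' ! i)" using i by (simp add: J_def)
    obtain a b where ab: "P ! i = Add a b \<or> P ! i = Sub a b \<or> P ! i = Mul a b" by (cases "P ! i") auto
    show ?thesis
      using ab unfolding normal_instr_def * P'i[OF i]
      by (cases a; cases b) (auto simp: plain_operand_def)
  qed
  have wf': "wf_slp n P'"
    unfolding wf_slp_def
  proof (intro allI impI)
    fix i assume i: "i < length P'"
    then have "wf_instr n i (P ! i)" using wf len by (simp add: wf_slp_def)
    moreover obtain a b where ab: "P ! i = Add a b \<or> P ! i = Sub a b \<or> P ! i = Mul a b" by (cases "P ! i") auto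
    ultimately show "wf_instr n i (P' ! i)"
      using i len by (cases a; cases b) (auto simp: P'i)
  qed
  have res: "slp_vals (params y) P' ! i = slp_results P ! i" if "i < length P" for i
    using that
  proof (induction i rule: less_induct)
    case (less i)
    have wfi: "wf_instr n i (P ! i)" using wf less.prems by (simp add: wf_slp_def)
    have r: "slp_vals (params y) P' ! j = slp_results P ! j" if "j < i" for j
      using that less by simp
    have "slp_vals (params y) P' ! i = instr_val (slp_vals (params y) P') (map_instr (params y) (P' ! i))"
      using slp_results_nth[of n "map (map_instr (params y)) P'" i] wf' less.prems len by simp
    also have "\<dots> = instr_val (slp_results P) (P ! i)"
    proof -
      obtain a b where ab: "P ! i = Add a b \<or> P ! i = Sub a b \<or> P ! i = Mul a b" by (cases "P ! i") auto
      then show ?thesis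
        using wfi r less.prems
        by (cases a; cases b) (auto simp: P'i y_def mconst_simps)
    qed
    also have "\<dots> = slp_results P ! i" using slp_results_nth[OF wf less.prems] by simp
    finally show ?case .
  qed
  show ?thesis
  proof (rule that)
    show "normal_slp J P'" using norm len by (auto simp: normal_slp_def J_def)
    show "slp_vals (params y) P' = slp_results P"
      using res len by (intro nth_equalityI) auto
  qed (use wf' len in auto)
qed

section \<open>Degrees in the parameters\<close>

text \<open>The outer variables are those of the computed polynomial, the inner ones are the
  parameters; only the inner degrees are bounded.\<close>

definition coeffs_deg_le :: "'a::zero mpoly mpoly \<Rightarrow> (nat \<Rightarrow> nat) \<Rightarrow> bool" where
  "coeffs_deg_le p \<nu> \<longleftrightarrow> (\<forall>m. deg_le (lookup p m) \<nu>)"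

lemma coeffs_deg_le_mono: "coeffs_deg_le p \<nu> \<Longrightarrow> (\<And>i. \<nu> i \<le> \<mu> i) \<Longrightarrow> coeffs_deg_le p \<mu>"
  unfolding coeffs_deg_le_def using deg_le_mono by blast

lemma coeffs_deg_le_add:
  "coeffs_deg_le p \<nu> \<Longrightarrow> coeffs_deg_le q \<nu> \<Longrightarrow> coeffs_deg_le (p + q :: 'a::comm_ring_1 mpoly mpoly) \<nu>"
  by (auto simp: coeffs_deg_le_def lookup_add deg_le_add)

lemma coeffs_deg_le_diff:
  "coeffs_deg_le p \<nu> \<Longrightarrow> coeffs_deg_le q \<nu> \<Longrightarrow> coeffs_deg_le (p - q :: 'a::comm_ring_1 mpoly mpoly) \<nu>"
  by (auto simp: coeffs_deg_le_def lookup_minus deg_le_diff)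

lemma coeffs_deg_le_mult:
  assumes "coeffs_deg_le p \<nu>" "coeffs_deg_le q \<mu>"
  shows "coeffs_deg_le (p * q :: 'a::comm_ring_1 mpoly mpoly) (\<lambda>i. \<nu> i + \<mu> i)"
  unfolding coeffs_deg_le_def
proof
  fix m
  have "deg_le (lookup p a * lookup q b) (\<lambda>i. \<nu> i + \<mu> i)" for a b
    using assms by (intro deg_le_mult) (auto simp: coeffs_deg_le_def)
  then show "deg_le (lookup (p * q) m) (\<lambda>i. \<nu> i + \<mu> i)"
    by (subst mpoly_times_monomials[OF finite_keys subset_refl finite_keys subset_refl])
      (auto simp: lookup_sum lookup_single when_def intro!: deg_le_sum)
qed

lemma coeffs_deg_le_single: "deg_le c \<nu> \<Longrightarrow> coeffs_deg_le (single m c) \<nu>"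
  by (auto simp: coeffs_deg_le_def lookup_single when_def)

text \<open>A parameter first enters at the instruction bearing its number, so no earlier result
  involves it. An instruction with a parameter therefore leaves the other degrees as they were, and
  only the remaining instructions can double degrees.\<close>

lemma params_degree:
  fixes P :: "nat slp"
  assumes norm: "normal_slp J P" and wf: "wf_slp n P" and i: "i < length P"
  shows "coeffs_deg_le (slp_vals (params (mvar :: nat \<Rightarrow> 'k::comm_ring_1 mpoly)) P ! i)
    (\<lambda>k. if k \<in> J \<and> k \<le> i then 2 ^ card ({..i} - J) else 0)"
  using i
proof (induction i rule: less_induct)
  case (less i)
  let ?vs = "slp_vals (params (mvar :: nat \<Rightarrow> 'k mpoly)) P"
  let ?\<mu> = "\<lambda>k. if k \<in> J \<and> k < i then 2 ^ card ({..<i} - J) else 0 :: nat"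
  let ?\<nu> = "\<lambda>k. if k \<in> J \<and> k \<le> i then 2 ^ card ({..i} - J) else 0 :: nat"
  have wfi: "wf_instr n i (P ! i)" using wf less.prems by (simp add: wf_slp_def)
  have pl: "coeffs_deg_le (operand_val ?vs (map_operand (params mvar) a)) ?\<mu>"
    if "plain_operand a" "wf_operand n i a" for a
  proof (cases a)
    case (Const c)
    then have "params mvar c = (0 :: 'k mpoly) \<or> params mvar c = (1 :: 'k mpoly)"
      using that by (auto simp: plain_operand_def)
    then show ?thesis using Const by (auto simp: mconst_def intro!: coeffs_deg_le_single)
  next
    case (Var v)
    then show ?thesis by (auto simp: mvar_def intro!: coeffs_deg_le_single)
  next
    case (Res j)
    then have j: "j < i" using that by simp
    then have "coeffs_deg_le (?vs ! j) (\<lambda>k. if k \<in> J \<and> k \<le> j then 2 ^ card ({..j} - J) else 0)"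
      using less by simp
    moreover have "card ({..j} - J) \<le> card ({..<i} - J)" using j by (intro card_mono) auto
    ultimately have "coeffs_deg_le (?vs ! j) ?\<mu>" using j
      by (elim coeffs_deg_le_mono) (auto intro: power_increasing)
    then show ?thesis using Res by simp
  qed
  have par: "coeffs_deg_le (operand_val ?vs (map_operand (params mvar) (Const (i + 2)))) (\<lambda>k. if k = i then 1 else 0)"
    by (auto simp: mconst_def intro!: coeffs_deg_le_single deg_le_mvar)
  have val: "?vs ! i = instr_val ?vs (map_instr (params mvar) (P ! i))"
    using slp_results_nth[of n "map (map_instr (params mvar)) P" i] wf less.prems by simp
  obtain a b where ab: "P ! i \<in> {Add a b, Sub a b, Mul a b}"
    "if i \<in> J then a = Const (i + 2) \<and> plain_operand b \<or> plain_operand a \<and> b = Const (i + 2)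
      else plain_operand a \<and> plain_operand b"
    using norm less.prems unfolding normal_slp_def normal_instr_def by blast
  have wfab: "wf_operand n i a" "wf_operand n i b" using ab(1) wfi by auto
  let ?a = "operand_val ?vs (map_operand (params mvar) a)"
  let ?b = "operand_val ?vs (map_operand (params mvar) b)"
  obtain \<nu>1 \<nu>2 where \<nu>: "coeffs_deg_le ?a \<nu>1" "coeffs_deg_le ?b \<nu>2" "\<And>k. \<nu>1 k + \<nu>2 k \<le> ?\<nu> k"
  proof (cases "i \<in> J")
    case True
    then have "{..i} - J = {..<i} - J" using order_le_less by auto
    then have *: "?\<mu> k + (if k = i then 1 else 0) \<le> ?\<nu> k" "(if k = i then 1 else 0) + ?\<mu> k \<le> ?\<nu> k" for k
      using True by auto
    from ab(2) True consider "a = Const (i + 2)" "plain_operand b" | "plain_operand a" "b = Const (i + 2)" by auto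
    then show ?thesis
    proof cases
      case 1
      then show ?thesis using that[of "\<lambda>k. if k = i then 1 else 0" ?\<mu>] par pl[OF _ wfab(2)] * by auto
    next
      case 2
      then show ?thesis using that[of ?\<mu> "\<lambda>k. if k = i then 1 else 0"] par pl[OF _ wfab(1)] * by auto
    qed
  next
    case False
    then have "{..i} - J = insert i ({..<i} - J)" using order_le_less by auto
    then have "card ({..i} - J) = Suc (card ({..<i} - J))" by simp
    then have "?\<mu> k + ?\<mu> k \<le> ?\<nu> k" for k by auto
    then show ?thesis using that[of ?\<mu> ?\<mu>] ab(2) False pl wfab by auto
  qed
  have "\<nu>1 k \<le> ?\<nu> k" "\<nu>2 k \<le> ?\<nu> k" for k using \<nu>(3)[of k] by linarith+
  then have "coeffs_deg_le ?a ?\<nu>" "coeffs_deg_le ?b ?\<nu>"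
    using coeffs_deg_le_mono[OF \<nu>(1), of ?\<nu>] coeffs_deg_le_mono[OF \<nu>(2), of ?\<nu>] by blast+
  moreover have "coeffs_deg_le (?a * ?b) ?\<nu>"
    using coeffs_deg_le_mono[OF coeffs_deg_le_mult[OF \<nu>(1,2)] \<nu>(3)] .
  ultimately show ?case using ab(1) unfolding val by (auto intro: coeffs_deg_le_add coeffs_deg_le_diff)
qed


section \<open>Clearing denominators in a straight-line program\<close>

text \<open>If the parameters have poles of order at most \<open>e\<close>, then \<open>weight e P i\<close> bounds the pole order
  of the \<open>i\<close>-th result. In the scaled program the results are multiplied by the corresponding power of
  \<open>\<epsilon>\<close>; a sum costs one more instruction, which brings its operands to a common weight.\<close>

fun operand_weight :: "nat \<Rightarrow> (nat \<Rightarrow> nat) \<Rightarrow> nat operand \<Rightarrow> nat" where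
  "operand_weight e w (Const c) = (if c < 2 then 0 else e)"
| "operand_weight e w (Var i) = 0"
| "operand_weight e w (Res j) = w j"

fun instr_weight :: "nat \<Rightarrow> (nat \<Rightarrow> nat) \<Rightarrow> nat instr \<Rightarrow> nat" where
  "instr_weight e w (Add a b) = max (operand_weight e w a) (operand_weight e w b)"
| "instr_weight e w (Sub a b) = max (operand_weight e w a) (operand_weight e w b)"
| "instr_weight e w (Mul a b) = operand_weight e w a + operand_weight e w b"

text \<open>The guard \<open>j < i\<close> makes the recursion terminate for ill-formed programs as
  well; for well-formed ones \<open>weight_unfold\<close> removes it.\<close>

function weight :: "nat \<Rightarrow> nat slp \<Rightarrow> nat \<Rightarrow> nat" where
  "weight e P i = instr_weight e (\<lambda>j. if j < i then weight e P j else 0) (P ! i)"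
  by auto
termination by (relation "Wellfounded.measure (\<lambda>(e, P, i). i)") auto

declare weight.simps [simp del]

lemma weight_unfold:
  assumes "wf_slp n P" "i < length P"
  shows "weight e P i = instr_weight e (weight e P) (P ! i)"
proof -
  have wf: "wf_instr n i (P ! i)" using assms by (simp add: wf_slp_def)
  have "operand_weight e (\<lambda>j. if j < i then weight e P j else 0) a = operand_weight e (weight e P) a"
    if "wf_operand n i a" for a
    using that by (cases a) auto
  then show ?thesis
    using wf by (subst weight.simps, cases "P ! i") (simp_all)
qed

text \<open>An instruction with a parameter adds at most e to the weight of its other operand, any
  other instruction at most doubles the bound. Sums are estimated like products.\<close>

lemma weight_le:
  assumes norm: "normal_slp J P" and wf: "wf_slp n P" and i: "i < length P"
  shows "weight e P i \<le> e * card (J \<inter> {..i}) * 2 ^ card ({..i} - J)"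
  using i
proof (induction i rule: less_induct)
  case (less i)
  let ?B = "e * card (J \<inter> {..<i}) * 2 ^ card ({..<i} - J)"
  let ?w = "operand_weight e (weight e P)"
  have wfi: "wf_instr n i (P ! i)" using wf less.prems by (simp add: wf_slp_def)
  have pl: "?w a \<le> ?B" if "plain_operand a" "wf_operand n i a" for a
  proof (cases a)
    case (Const c)
    then show ?thesis using that by (auto simp: plain_operand_def)
  next
    case (Res j)
    then have j: "j < i" using that by simp
    have "card (J \<inter> {..j}) \<le> card (J \<inter> {..<i})" "card ({..j} - J) \<le> card ({..<i} - J)"
      using j by (auto intro!: card_mono)
    then have "e * card (J \<inter> {..j}) * 2 ^ card ({..j} - J) \<le> ?B"
      by (intro mult_mono power_increasing) auto
    moreover have "weight e P j \<le> e * card (J \<inter> {..j}) * 2 ^ card ({..j} - J)"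
      using less.IH[OF j] less.prems j by simp
    ultimately have "weight e P j \<le> ?B" by linarith
    then show ?thesis using Res by simp
  qed auto
  obtain a b where ab: "P ! i \<in> {Add a b, Sub a b, Mul a b}"
    "if i \<in> J then a = Const (i + 2) \<and> plain_operand b \<or> plain_operand a \<and> b = Const (i + 2)
      else plain_operand a \<and> plain_operand b"
    using norm less.prems unfolding normal_slp_def normal_instr_def by blast
  have wfab: "wf_operand n i a" "wf_operand n i b" using ab(1) wfi by auto
  have "weight e P i \<le> ?w a + ?w b"
    using ab(1) unfolding weight_unfold[OF wf less.prems] by auto
  also have "\<dots> \<le> e * card (J \<inter> {..i}) * 2 ^ card ({..i} - J)"
  proof (cases "i \<in> J")
    case True
    then have 1: "{..i} - J = {..<i} - J" using order_le_less by auto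
    have "J \<inter> {..i} = insert i (J \<inter> {..<i})" using True order_le_less by auto
    then have 2: "card (J \<inter> {..i}) = Suc (card (J \<inter> {..<i}))" by simp
    have "?w a + ?w b \<le> ?B + e" using ab(2) True pl wfab by auto
    also have "\<dots> \<le> ?B + e * 2 ^ card ({..<i} - J)" by simp
    finally show ?thesis by (simp add: 1 2 algebra_simps)
  next
    case False
    then have "{..i} - J = insert i ({..<i} - J)" using order_le_less by auto
    then have 1: "card ({..i} - J) = Suc (card ({..<i} - J))" by simp
    have 2: "J \<inter> {..i} = J \<inter> {..<i}" using False order_le_less by auto
    have "?w a + ?w b \<le> ?B + ?B" using ab(2) False pl wfab by (auto intro!: add_mono)
    then show ?thesis by (simp add: 1 2)
  qed
  finally show ?case .
qed

fun scaled_operand :: "nat operand \<Rightarrow> (nat + nat) operand" where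
  "scaled_operand (Const c) = Const (Inr c)"
| "scaled_operand (Var i) = Var i"
| "scaled_operand (Res j) = Res (2 * j + 1)"

text \<open>This fills the even positions: the operand of smaller weight is raised to the larger
  weight. A product gets the dummy 0 + 0, so that the scaled result i is always at position 2 i +
  1.\<close>

fun scaling_instr :: "(nat operand \<Rightarrow> nat) \<Rightarrow> nat instr \<Rightarrow> (nat + nat) instr" where
  "scaling_instr w (Mul a b) = Add (Const (Inr 0)) (Const (Inr 0))"
| "scaling_instr w (Add a b) = (if w b \<le> w a then Mul (Const (Inl (w a - w b))) (scaled_operand b)
     else Mul (Const (Inl (w b - w a))) (scaled_operand a))"
| "scaling_instr w (Sub a b) = (if w b \<le> w a then Mul (Const (Inl (w a - w b))) (scaled_operand b)
     else Mul (Const (Inl (w b - w a))) (scaled_operand a))"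

fun scaled_instr :: "nat \<Rightarrow> (nat operand \<Rightarrow> nat) \<Rightarrow> nat instr \<Rightarrow> (nat + nat) instr" where
  "scaled_instr i w (Mul a b) = Mul (scaled_operand a) (scaled_operand b)"
| "scaled_instr i w (Add a b) = (if w b \<le> w a then Add (scaled_operand a) (Res (2 * i))
     else Add (Res (2 * i)) (scaled_operand b))"
| "scaled_instr i w (Sub a b) = (if w b \<le> w a then Sub (scaled_operand a) (Res (2 * i))
     else Sub (Res (2 * i)) (scaled_operand b))"

definition scaled_slp :: "nat \<Rightarrow> nat slp \<Rightarrow> (nat + nat) slp" where
  "scaled_slp e P = map (\<lambda>k. let i = k div 2; w = operand_weight e (weight e P) in
     if even k then scaling_instr w (P ! i) else scaled_instr i w (P ! i)) [0..<2 * length P]"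

text \<open>\<open>Inl k\<close> names the power s^k, and \<open>Inr c\<close> names a parameter
  that has already been multiplied by s^e.\<close>

definition scaled_params :: "'a::comm_ring_1 \<Rightarrow> (nat \<Rightarrow> 'a) \<Rightarrow> nat + nat \<Rightarrow> 'a" where
  "scaled_params s u = case_sum (\<lambda>k. s ^ k) (params u)"

lemma length_scaled_slp [simp]: "length (scaled_slp e P) = 2 * length P"
  by (simp add: scaled_slp_def)

lemma scaled_slp_nth:
  assumes "i < length P"
  shows "scaled_slp e P ! (2 * i) = scaling_instr (operand_weight e (weight e P)) (P ! i)"
    and "scaled_slp e P ! (Suc (2 * i)) = scaled_instr i (operand_weight e (weight e P)) (P ! i)"
  using assms by (simp_all add: scaled_slp_def)

lemma wf_scaled_operand: "wf_operand n i a \<Longrightarrow> 2 * i \<le> k \<Longrightarrow> wf_operand n k (scaled_operand a)"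
  by (cases a) auto

lemma wf_scaled_slp:
  assumes wf: "wf_slp n P"
  shows "wf_slp n (scaled_slp e P)"
  unfolding wf_slp_def
proof (intro allI impI)
  fix k assume k: "k < length (scaled_slp e P)"
  define i where "i = k div 2"
  have i: "i < length P" using k by (simp add: i_def)
  have wfi: "wf_instr n i (P ! i)" using wf i by (simp add: wf_slp_def)
  show "wf_instr n k (scaled_slp e P ! k)"
  proof (cases "even k")
    case True
    then have "k = 2 * i" by (simp add: i_def)
    then show ?thesis
      using wfi scaled_slp_nth(1)[OF i] by (cases "P ! i") (auto intro!: wf_scaled_operand[of n i])
  next
    case False
    then have "k = Suc (2 * i)" by (simp add: i_def)
    then show ?thesis
      using wfi scaled_slp_nth(2)[OF i] by (cases "P ! i") (auto intro!: wf_scaled_operand[of n i])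
  qed
qed

lemma scaled_slp_vals:
  fixes s :: "'a::comm_ring_1"
  assumes wf: "wf_slp n P" and i: "i < length P"
    and u: "\<And>i. i + 2 \<in> \<Union>(set_instr ` set P) \<Longrightarrow> u i = s ^ e * y i"
  shows "slp_vals (scaled_params s u) (scaled_slp e P) ! (Suc (2 * i)) =
    mconst (s ^ weight e P i) * slp_vals (params y) P ! i"
  using i
proof (induction i rule: less_induct)
  case (less i)
  let ?vs = "slp_vals (scaled_params s u) (scaled_slp e P)"
  let ?us = "slp_vals (params y) P"
  let ?w = "operand_weight e (weight e P)"
  let ?s = "\<lambda>a. operand_val ?vs (map_operand (scaled_params s u) (scaled_operand a))"
  let ?v = "\<lambda>a. operand_val ?us (map_operand (params y) a)"
  have wfi: "wf_instr n i (P ! i)" using wf less.prems by (simp add: wf_slp_def)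
  have op: "?s a = mconst (s ^ ?w a) * ?v a"
    if "wf_operand n i a" "set_operand a \<subseteq> set_instr (P ! i)" for a
  proof (cases a)
    case (Const c)
    show ?thesis
    proof (cases "c < 2")
      case True
      then have "c = 0 \<or> c = 1" by auto
      then show ?thesis using Const by (auto simp: scaled_params_def mconst_simps)
    next
      case False
      then obtain j where j: "c = Suc (Suc j)" by (metis add_2_eq_Suc le_Suc_ex not_less)
      have "P ! i \<in> set P" using less.prems by simp
      then have "u j = s ^ e * y j" using u[of j] Const j that by auto
      then show ?thesis using Const j by (simp add: scaled_params_def mconst_simps)
    qed
  next
    case (Var v)
    then show ?thesis by (simp add: mconst_simps)
  next
    case (Res j)
    then show ?thesis using that less by simp
  qed
  have u: "?us ! i = instr_val ?us (map_instr (params y) (P ! i))"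
    using slp_results_nth[of n "map (map_instr (params y)) P" i] wf less.prems by simp
  have v0: "?vs ! (2 * i) = instr_val ?vs (map_instr (scaled_params s u) (scaling_instr ?w (P ! i)))"
    using slp_results_nth[of n "map (map_instr (scaled_params s u)) (scaled_slp e P)" "2 * i"]
      wf_scaled_slp[OF wf] less.prems by (simp add: scaled_slp_nth)
  have v1: "?vs ! (Suc (2 * i)) = instr_val ?vs (map_instr (scaled_params s u) (scaled_instr i ?w (P ! i)))"
    using slp_results_nth[of n "map (map_instr (scaled_params s u)) (scaled_slp e P)" "Suc (2 * i)"]
      wf_scaled_slp[OF wf] less.prems by (simp add: scaled_slp_nth)
  have shift: "mconst (scaled_params s u (Inl (k - l))) * (mconst (s ^ l) * p) = mconst (s ^ k) * p"
    if "l \<le> k" for k l p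
    using that by (simp add: scaled_params_def mult.assoc[symmetric] mconst_simps(3)[symmetric] power_add[symmetric])
  show ?case
  proof (cases "P ! i")
    case (Mul a b)
    then show ?thesis
      using op[of a] op[of b] wfi unfolding v1 u weight_unfold[OF wf less.prems]
      by (simp add: power_add mconst_simps mult_ac)
  next
    case (Add a b)
    then have *: "?s a = mconst (s ^ ?w a) * ?v a" "?s b = mconst (s ^ ?w b) * ?v b"
      using op[of a] op[of b] wfi by auto
    show ?thesis
      using shift[of "?w b" "?w a" "?v b"] shift[of "?w a" "?w b" "?v a"] v0
      unfolding v1 u weight_unfold[OF wf less.prems]
      by (cases "?w b \<le> ?w a") (auto simp: Add * algebra_simps)
  next
    case (Sub a b)
    then have *: "?s a = mconst (s ^ ?w a) * ?v a" "?s b = mconst (s ^ ?w b) * ?v b"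
      using op[of a] op[of b] wfi by auto
    show ?thesis
      using shift[of "?w b" "?w a" "?v b"] shift[of "?w a" "?w b" "?v a"] v0
      unfolding v1 u weight_unfold[OF wf less.prems]
      by (cases "?w b \<le> ?w a") (auto simp: Sub * algebra_simps)
  qed
qed


section \<open>Laurent expansions of rational functions\<close>

definition fls_of_poly :: "'k::field poly \<Rightarrow> 'k fls" where
  "fls_of_poly p = fps_to_fls (fps_of_poly p)"

lemma fls_of_poly_simps [simp]:
  "fls_of_poly 0 = 0" "fls_of_poly 1 = 1" "fls_of_poly (p + q) = fls_of_poly p + fls_of_poly q"
  "fls_of_poly (p - q) = fls_of_poly p - fls_of_poly q"
  "fls_of_poly (p * q) = fls_of_poly p * fls_of_poly q"
  by (simp_all add: fls_of_poly_def fps_of_poly_add fps_of_poly_diff fps_of_poly_mult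
      fls_times_fps_to_fls)

lemma fls_of_poly_eq_0_iff [simp]: "fls_of_poly p = 0 \<longleftrightarrow> p = 0"
  by (simp add: fls_of_poly_def)

definition fls_of_fract :: "'k::field poly fract \<Rightarrow> 'k fls" where
  "fls_of_fract x = (SOME z. \<exists>a b. b \<noteq> 0 \<and> x = Fract a b \<and> z = fls_of_poly a / fls_of_poly b)"

lemma fls_of_fract_Fract:
  assumes "b \<noteq> 0"
  shows "fls_of_fract (Fract a b) = fls_of_poly a / fls_of_poly b"
  unfolding fls_of_fract_def
proof (rule some_equality)
  fix z assume "\<exists>a' b'. b' \<noteq> 0 \<and> Fract a b = Fract a' b' \<and> z = fls_of_poly a' / fls_of_poly b'"
  then obtain a' b' where *: "b' \<noteq> 0" "Fract a b = Fract a' b'" "z = fls_of_poly a' / fls_of_poly b'" by blast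
  then have "a * b' = a' * b" using assms by (simp add: eq_fract)
  then have "fls_of_poly a * fls_of_poly b' = fls_of_poly a' * fls_of_poly b"
    by (metis fls_of_poly_simps(5))
  then show "z = fls_of_poly a / fls_of_poly b" using * assms by (simp add: frac_eq_eq)
qed (use assms in blast)

lemma ring_map_fls_of_fract: "ring_map (fls_of_fract :: 'k::field poly fract \<Rightarrow> _)"
proof (rule ring_mapI)
  show "fls_of_fract (1 :: 'k poly fract) = 1" by (simp add: One_fract_def fls_of_fract_Fract)
  fix x y :: "'k poly fract"
  obtain a b c d where *: "x = Fract a b" "b \<noteq> 0" "y = Fract c d" "d \<noteq> 0"
    by (metis Fract_cases)
  show "fls_of_fract (x - y) = fls_of_fract x - fls_of_fract y"
    using * by (simp add: fls_of_fract_Fract diff_frac_eq)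
  show "fls_of_fract (x * y) = fls_of_fract x * fls_of_fract y"
    using * by (simp add: fls_of_fract_Fract)
qed

text \<open>A denominator that does not vanish at 0 is a unit among the power series, so the
  expansion has no pole and its constant term is the value at 0.\<close>

lemma regular_at_0_fls:
  assumes "x \<in> regular_at_0"
  obtains g where "fls_of_fract x = fps_to_fls g" "fps_nth g 0 = at_eps_0 x"
proof -
  obtain a b where *: "x = Fract a b" "poly b 0 \<noteq> 0" using assms by (auto simp: regular_at_0_def)
  then have b0: "b \<noteq> 0" by auto
  define g where "g = fps_of_poly a * inverse (fps_of_poly b)"
  have nz: "fps_nth (fps_of_poly b) 0 \<noteq> 0" using *(2) by (simp add: poly_0_coeff_0)
  have "fps_to_fls g * fls_of_poly b = fps_to_fls (fps_of_poly a * (inverse (fps_of_poly b) * fps_of_poly b))"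
    by (simp add: g_def fls_of_poly_def fls_times_fps_to_fls mult_ac)
  also have "\<dots> = fls_of_poly a" using nz by (simp add: inverse_mult_eq_1 fls_of_poly_def)
  finally have "fls_of_fract x = fps_to_fls g" using b0 by (simp add: *(1) fls_of_fract_Fract field_simps)
  moreover have "fps_nth g 0 = at_eps_0 x"
    using *(2) by (simp add: g_def *(1) at_eps_0_Fract fps_inverse_nth_0 poly_0_coeff_0 field_class.field_divide_inverse)
  ultimately show ?thesis by (rule that)
qed


section \<open>The numerical estimate\<close>

lemma pow2_bound: "m \<le> 2 ^ (m - 1)" if "m \<ge> 1" for m :: nat
proof -
  have "Suc k \<le> 2 ^ k" for k by (induction k) auto
  from this[of "m - 1"] that show ?thesis by simp
qed

text \<open>Here \<open>m * 2 ^ (r - m)\<close> bounds the degree of a program of length \<open>r\<close> in its \<open>m\<close> parameters, and the other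
  factor bounds the pole orders of the parameters.\<close>

lemma order_estimate:
  fixes m r :: nat
  assumes "1 \<le> m" "m \<le> r"
  shows "m * 2 ^ (r - m) * (m ^ m * (2 ^ (r - m) + 1) ^ (m - 1)) \<le> 2 ^ (r\<^sup>2)"
proof (cases "m = r")
  case True
  \<comment> \<open>From m = 3 on, m \<le> 2^(m - 1) is too weak here. The bound m \<le> 2^(m - 2)
    suffices but holds only from 4 on, so the small cases are computed; for m = 2 the estimate is an
    equality.\<close>
  have "m ^ (m + 1) * 2 ^ (m - 1) \<le> 2 ^ (m\<^sup>2)"
  proof (cases "m \<le> 3")
    case True
    then have "m = 1 \<or> m = 2 \<or> m = 3" using assms by auto
    then show ?thesis by auto
  next
    case False
    define k where "k = m - 4"
    have k: "m = k + 4" using False by (simp add: k_def)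
    have "k + 4 \<le> 2 ^ (k + 2)" by (induction k) auto
    then have "m ^ (m + 1) * 2 ^ (m - 1) \<le> (2 ^ (k + 2)) ^ (m + 1) * 2 ^ (m - 1)"
      unfolding k by (intro mult_mono power_mono) auto
    also have "\<dots> = 2 ^ ((k + 2) * (m + 1) + (m - 1))" by (simp only: power_add power_mult)
    also have "\<dots> \<le> 2 ^ (m\<^sup>2)" unfolding k by (intro power_increasing) (auto simp: power2_eq_square algebra_simps)
    finally show ?thesis .
  qed
  then show ?thesis using True by (simp add: mult.assoc flip: numeral_2_eq_2)
next
  case False
  define d where "d = r - m"
  have r: "r = m + d" "d \<ge> 1" using assms False by (auto simp: d_def)
  \<comment> \<open>For r > m the terms 2 d m + d^2 of r^2 leave room for this rounding and for the
    cruder bound on m.\<close>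
  have "(2::nat) ^ d + 1 \<le> 2 ^ (d + 1)" by simp
  then have "m * 2 ^ d * (m ^ m * (2 ^ d + 1) ^ (m - 1)) \<le> m * 2 ^ d * (m ^ m * (2 ^ (d + 1)) ^ (m - 1))"
    by (intro mult_mono power_mono) auto
  also have "\<dots> = m ^ (m + 1) * 2 ^ (d + (d + 1) * (m - 1))"
    by (simp add: power_add power_mult)
  also have "\<dots> \<le> (2 ^ (m - 1)) ^ (m + 1) * 2 ^ (d + (d + 1) * (m - 1))"
    using pow2_bound[OF assms(1)] by (intro mult_mono power_mono) auto
  also have "\<dots> = 2 ^ ((m - 1) * (m + 1) + (d + (d + 1) * (m - 1)))" by (simp add: power_add power_mult)
  also have "\<dots> \<le> 2 ^ (r\<^sup>2)"
  proof (intro power_increasing)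
    obtain l where l: "m = Suc l" using assms by (cases m) auto
    obtain d' where d': "d = Suc d'" using r by (cases d) auto
    show "(m - 1) * (m + 1) + (d + (d + 1) * (m - 1)) \<le> r\<^sup>2"
      unfolding r(1) l d' by (simp add: power2_eq_square algebra_simps)
  qed simp
  finally show ?thesis by (simp add: d_def)
qed

section \<open>Graded pieces\<close>

definition mdeg :: "(nat \<Rightarrow>\<^sub>0 nat) \<Rightarrow> nat" where
  "mdeg \<alpha> = (\<Sum>i\<in>keys \<alpha>. lookup \<alpha> i)"

lemma mdeg_superset:
  "finite A \<Longrightarrow> keys \<alpha> \<subseteq> A \<Longrightarrow> mdeg \<alpha> = (\<Sum>i\<in>A. lookup \<alpha> i)"
  unfolding mdeg_def by (rule sum.mono_neutral_left) (auto simp: in_keys_iff)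

lemma mdeg_0 [simp]: "mdeg 0 = 0"
  by (simp add: mdeg_def)

lemma mdeg_single [simp]: "mdeg (single i k) = k"
  by (simp add: mdeg_def)

lemma mdeg_add: "mdeg (\<alpha> + \<beta>) = mdeg \<alpha> + mdeg \<beta>"
proof -
  let ?A = "keys \<alpha> \<union> keys \<beta>"
  have "keys (\<alpha> + \<beta>) \<subseteq> ?A" by (rule keys_add)
  then show ?thesis
    using mdeg_superset[of ?A "\<alpha> + \<beta>"] mdeg_superset[of ?A \<alpha>] mdeg_superset[of ?A \<beta>]
    by (simp add: lookup_add sum.distrib)
qed

lemma keys_add_nat: "keys (\<alpha> + \<beta> :: nat \<Rightarrow>\<^sub>0 nat) = keys \<alpha> \<union> keys \<beta>"
  by (auto simp: in_keys_iff lookup_add)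

lemma lookup_le_mdeg: "lookup \<alpha> i \<le> mdeg \<alpha>"
  unfolding mdeg_def by (cases "i \<in> keys \<alpha>") (auto intro: member_le_sum simp: in_keys_iff)

lemma keys_diff_subset: "keys (p - q :: 'a::comm_ring_1 mpoly) \<subseteq> keys p \<union> keys q"
  by (auto simp: in_keys_iff lookup_minus)

text \<open>With a singleton T these are forms, with T = {n..} polynomials vanishing at the origin
  to order n, and with T the universe all polynomials in the given variables.\<close>

definition graded :: "nat set \<Rightarrow> nat set \<Rightarrow> 'a::zero mpoly set" where
  "graded I T = {p. \<forall>\<alpha>\<in>keys p. keys \<alpha> \<subseteq> I \<and> mdeg \<alpha> \<in> T}"

lemma graded_0: "0 \<in> graded I T"
  by (simp add: graded_def)

lemma graded_single: "keys \<alpha> \<subseteq> I \<Longrightarrow> mdeg \<alpha> \<in> T \<Longrightarrow> single \<alpha> c \<in> graded I T"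
  by (simp add: graded_def)

lemma graded_mconst: "0 \<in> T \<Longrightarrow> mconst c \<in> graded I T"
  by (simp add: mconst_def graded_single)

lemma graded_1: "0 \<in> T \<Longrightarrow> (1 :: 'a::comm_ring_1 mpoly) \<in> graded I T"
  using graded_mconst[of T "1::'a"] by (simp add: mconst_simps)

lemma graded_diff: "p \<in> graded I T \<Longrightarrow> q \<in> graded I T \<Longrightarrow> p - q \<in> graded I T" for p :: "'a::comm_ring_1 mpoly"
  using keys_diff_subset[of p q] by (auto simp: graded_def)

lemma graded_add: "p \<in> graded I T \<Longrightarrow> q \<in> graded I T \<Longrightarrow> p + q \<in> graded I T"
  using keys_add[of p q] by (auto simp: graded_def)

lemma graded_sum: "(\<And>i. i \<in> A \<Longrightarrow> f i \<in> graded I T) \<Longrightarrow> sum f A \<in> graded I T"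
  by (induction A rule: infinite_finite_induct) (auto intro: graded_0 graded_add)

lemma graded_mono: "p \<in> graded I T \<Longrightarrow> I \<subseteq> I' \<Longrightarrow> T \<subseteq> T' \<Longrightarrow> p \<in> graded I' T'"
  by (force simp: graded_def)

lemma graded_mult:
  fixes p q :: "'a::comm_ring_1 mpoly"
  assumes "p \<in> graded I A" "q \<in> graded I B" "\<And>a b. a \<in> A \<Longrightarrow> b \<in> B \<Longrightarrow> a + b \<in> T"
  shows "p * q \<in> graded I T"
  unfolding graded_def
proof (intro CollectI ballI)
  fix \<gamma> assume "\<gamma> \<in> keys (p * q)"
  then obtain a b where "\<gamma> = a + b" "a \<in> keys p" "b \<in> keys q"
    using keys_mult[of p q] by auto
  then show "keys \<gamma> \<subseteq> I \<and> mdeg \<gamma> \<in> T"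
    using assms by (auto simp: graded_def keys_add_nat mdeg_add)
qed

lemma lookup_mconst_mult: "lookup (mconst c * p) m = c * lookup p m"
  for c :: "'a::comm_ring_1"
proof -
  have "mconst c * p = (\<Sum>a\<in>keys p. single a (c * lookup p a))"
    using mpoly_sum_monomials[OF finite_keys subset_refl, of p]
    by (simp add: mconst_def mult_single sum_distrib_left)
      (metis (no_types, lifting) mult_single add_0 sum.cong sum_distrib_left)
  then show ?thesis
    by (simp add: lookup_sum lookup_single when_def in_keys_iff)
qed

lemma mpoly_dependence:
  fixes G :: "'i \<Rightarrow> 'a::idom mpoly"
  assumes "finite B" "finite I" "card B < card I" and keys: "\<And>i. i \<in> I \<Longrightarrow> keys (G i) \<subseteq> B"
  obtains c where "\<exists>i\<in>I. c i \<noteq> 0" "(\<Sum>i\<in>I. mconst (c i) * G i) = 0"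
proof -
  obtain c where c: "\<exists>i\<in>I. c i \<noteq> 0" "\<forall>b\<in>B. (\<Sum>i\<in>I. c i * lookup (G i) b) = 0"
    using homogeneous_system[OF assms(1-3) subring_set_UNIV, of "\<lambda>i. lookup (G i)"] by auto
  have "lookup (G i) b = 0" if "b \<notin> B" "i \<in> I" for b i
    using keys[OF that(2)] that(1) by (auto simp: in_keys_iff)
  then have "(\<Sum>i\<in>I. c i * lookup (G i) b) = 0" for b
    using c(2) by (cases "b \<in> B") auto
  then have "(\<Sum>i\<in>I. mconst (c i) * G i) = 0"
    by (intro poly_mapping_eqI) (simp add: lookup_sum lookup_mconst_mult)
  with c(1) show ?thesis by (rule that)
qed

lemma monval_sum: "finite A \<Longrightarrow> monval x (sum f A) = (\<Prod>a\<in>A. monval x (f a))"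
  by (induction A rule: finite_induct) (auto simp: monval_add)

text \<open>Dividing by N^m and letting N tend to infinity compares the leading coefficients: p D
  \<le> (D m)^m.\<close>

lemma growth_bound:
  fixes p D m C :: nat
  assumes le: "\<And>N. p * (D * N + 1) * (N + 1) ^ (m - 1) \<le> (C + D * m * N) ^ m"
    and "m \<ge> 1" "D \<ge> 1"
  shows "p \<le> m ^ m * D ^ (m - 1)"
proof -
  have *: "real p * real D \<le> (real C / real N + real (D * m)) ^ m" if N: "N \<ge> 1" for N
  proof -
    obtain l where l: "m = Suc l" using assms(2) by (cases m) auto
    have "p * D * N ^ m \<le> p * (D * N + 1) * (N + 1) ^ (m - 1)"
    proof -
      have "p * D * N ^ m = p * (D * N) * N ^ (m - 1)" by (simp add: l mult_ac)
      also have "\<dots> \<le> p * (D * N + 1) * (N + 1) ^ (m - 1)" by (intro mult_mono power_mono) auto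
      finally show ?thesis .
    qed
    also have "\<dots> \<le> (C + D * m * N) ^ m" by (rule le)
    finally have "real (p * D * N ^ m) \<le> real ((C + D * m * N) ^ m)" by (rule of_nat_mono)
    also have "\<dots> = ((real C / real N + real (D * m)) * real N) ^ m"
      using N by (simp add: field_simps)
    finally have "real p * real D * real N ^ m \<le> (real C / real N + real (D * m)) ^ m * real N ^ m"
      by (simp add: power_mult_distrib)
    then show ?thesis using N by simp
  qed
  have "(\<lambda>N. (real C / real N + real (D * m)) ^ m) \<longlonglongrightarrow> (0 + real (D * m)) ^ m"
    by (intro tendsto_intros lim_const_over_n)
  then have "real p * real D \<le> (0 + real (D * m)) ^ m"
    by (rule LIMSEQ_le_const) (use * in blast)
  then have "real (p * D) \<le> real ((D * m) ^ m)" by simp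
  then have "p * D \<le> (D * m) ^ m" by (simp only: of_nat_le_iff)
  also have "\<dots> = m ^ m * D ^ (m - 1) * D"
    using assms(2) power_minus_mult[of m D] by (simp add: power_mult_distrib mult_ac)
  finally show ?thesis using assms(3) by simp
qed


section \<open>Places and expansions with small pole order\<close>

text \<open>The \<open>\<sigma> i = P i / Q\<close> are rational functions in the coordinates \<open>\<chi> j\<close>, which occur among them. Along the
  polynomial arcs \<open>\<xi> j\<close>, whose parameter is the variable of \<open>'k mpoly poly\<close>, all of them have
  positive order. The arcs have the \<open>\<chi> j\<close> themselves as coefficients, so that no polynomial
  vanishes on the whole family.\<close>

locale arc_family =
  fixes J :: "nat set" and N D h V0 :: nat
    and P :: "nat \<Rightarrow> 'k::field mpoly" and Q :: "'k mpoly" and Q' :: "'k mpoly poly"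
    and \<xi> :: "nat \<Rightarrow> 'k mpoly poly" and \<kappa> :: "'k mpoly \<Rightarrow> 'w::alg_closed_field"
  assumes J: "finite J" "J \<noteq> {}" and D1: "D \<ge> 1"
    and \<kappa>: "ring_map \<kappa>" and \<kappa>_inj: "\<kappa> p = 0 \<Longrightarrow> p = 0"
    and degP: "i < N \<Longrightarrow> deg_le (P i) (\<lambda>k. if k \<in> J then D else 0)"
    and Q0: "Q \<noteq> 0" and pos: "j \<in> J \<Longrightarrow> \<exists>i<N. P i = mvar j * Q"
    and arc_inj: "peval (\<lambda>c. [:mconst c:]) \<xi> p = 0 \<Longrightarrow> p = 0"
    and arc_degree: "degree (\<xi> j) \<le> h"
    and arc_Q: "peval (\<lambda>c. [:mconst c:]) \<xi> Q = monom 1 V0 * Q'" "coeff Q' 0 \<noteq> 0"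
    and arc_P: "i < N \<Longrightarrow> monom 1 (Suc V0) dvd peval (\<lambda>c. [:mconst c:]) \<xi> (P i)"
begin

abbreviation "m \<equiv> card J"
definition "\<sigma> i = \<kappa> (P i) / \<kappa> Q"
definition "\<chi> j = \<kappa> (mvar j)"
definition "\<iota> c = \<kappa> (mconst c)"
abbreviation "ev \<equiv> peval \<iota> \<sigma>"
abbreviation "arc \<equiv> peval (\<lambda>c. [:mconst c:]) \<xi>"
abbreviation "form S n \<equiv> graded S {n} :: 'k mpoly set"
abbreviation "high n \<equiv> graded {..<N} {n..} :: 'k mpoly set"

lemma m_pos: "m \<ge> 1" using J by (simp add: Suc_leI card_gt_0_iff)

lemma ring_map_\<iota>: "ring_map \<iota>"
  unfolding \<iota>_def by (rule ring_map_comp[OF \<kappa> ring_map_mconst])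

lemma ring_map_const: "ring_map (\<lambda>c::'k. [:mconst c:])"
  by (rule ring_mapI) (simp_all add: mconst_simps one_pCons)

lemmas ev_simps = peval_mult[OF ring_map_\<iota>] peval_add[OF ring_map_\<iota>] peval_diff[OF ring_map_\<iota>]
  peval_single[OF ring_map_\<iota>] peval_mconst[OF ring_map_\<iota>] peval_mvar[OF ring_map_\<iota>]
  peval_1[OF ring_map_\<iota>] peval_0[OF ring_map_\<iota>] peval_sum[OF ring_map_\<iota>] ring_map_1[OF ring_map_\<iota>]

lemma \<kappa>_eq_peval: "\<kappa> p = peval \<iota> \<chi> p"
  by (rule ring_map_eq_peval[OF ring_map_\<iota> \<kappa>]) (simp_all add: \<iota>_def \<chi>_def)

lemma \<kappa>_single: "\<kappa> (single \<gamma> c) = \<iota> c * monval \<chi> \<gamma>"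
  by (rule trans[OF \<kappa>_eq_peval peval_single[OF ring_map_\<iota>]])

lemma \<kappa>Q: "\<kappa> Q \<noteq> 0" using \<kappa>_inj Q0 by blast

lemma \<sigma>_pos: "j \<in> J \<Longrightarrow> \<exists>i<N. \<sigma> i = \<chi> j"
  using pos[of j] \<kappa>Q by (auto simp: \<sigma>_def \<chi>_def ring_map_mult[OF \<kappa>])

text \<open>This is p(\<sigma>) Q^l written without denominators. It is meaningful for l at least
  the degree of p, since the subtraction is truncated.\<close>

definition homog :: "nat \<Rightarrow> 'k mpoly \<Rightarrow> 'k mpoly" where
  "homog l p = (\<Sum>\<alpha>\<in>keys p. mconst (lookup p \<alpha>) * monval P \<alpha> * Q ^ (l - mdeg \<alpha>))"

lemma \<kappa>_monval: "\<kappa> (monval P \<alpha>) = monval \<sigma> \<alpha> * \<kappa> Q ^ mdeg \<alpha>"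
proof -
  have "\<kappa> (P i) = \<sigma> i * \<kappa> Q" for i using \<kappa>Q by (simp add: \<sigma>_def)
  then show ?thesis
    unfolding monval_def mdeg_def
    by (simp add: ring_map_prod[OF \<kappa>] ring_map_power[OF \<kappa>] power_mult_distrib prod.distrib power_sum)
qed

lemma \<kappa>_homog:
  assumes "\<And>\<alpha>. \<alpha> \<in> keys p \<Longrightarrow> mdeg \<alpha> \<le> l"
  shows "\<kappa> (homog l p) = ev p * \<kappa> Q ^ l"
  unfolding homog_def peval_def ring_map_sum[OF \<kappa>] sum_distrib_right
proof (rule sum.cong)
  fix \<alpha> assume "\<alpha> \<in> keys p"
  then have "\<kappa> Q ^ l = \<kappa> Q ^ mdeg \<alpha> * \<kappa> Q ^ (l - mdeg \<alpha>)" using assms by (simp flip: power_add)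
  then show "\<kappa> (mconst (lookup p \<alpha>) * monval P \<alpha> * Q ^ (l - mdeg \<alpha>)) =
      \<iota> (lookup p \<alpha>) * monval \<sigma> \<alpha> * \<kappa> Q ^ l"
    by (simp add: ring_map_mult[OF \<kappa>] ring_map_power[OF \<kappa>] \<kappa>_monval \<iota>_def mult_ac)
qed simp

text \<open>Along the arc the numerators have order at least V0 + 1 and Q has order V0. A monomial
  of degree d \<ge> n, brought to the denominator Q^l, thus has order at least (V0 + 1) d + V0 (l -
  d) = l V0 + d.\<close>

lemma arc_homog:
  assumes p: "p \<in> high n" and l: "\<And>\<alpha>. \<alpha> \<in> keys p \<Longrightarrow> mdeg \<alpha> \<le> l"
  shows "monom 1 (l * V0 + n) dvd arc (homog l p)"
  unfolding homog_def peval_sum[OF ring_map_const]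
proof (rule dvd_sum)
  fix \<alpha> assume \<alpha>: "\<alpha> \<in> keys p"
  then have \<alpha>N: "keys \<alpha> \<subseteq> {..<N}" "n \<le> mdeg \<alpha>" using p by (auto simp: graded_def)
  let ?d = "mdeg \<alpha>"
  have mp: "monom 1 a ^ b = (monom 1 (a * b) :: 'k mpoly poly)" for a b
    by (simp add: monom_power)
  have "(\<Prod>i\<in>keys \<alpha>. monom 1 (Suc V0) ^ lookup \<alpha> i) dvd
      (\<Prod>i\<in>keys \<alpha>. arc (P i) ^ lookup \<alpha> i)"
    using \<alpha>N(1) by (intro prod_dvd_prod dvd_power_same arc_P) auto
  moreover have "(\<Prod>i\<in>keys \<alpha>. monom 1 (Suc V0) ^ lookup \<alpha> i) =
      (monom 1 (Suc V0 * ?d) :: 'k mpoly poly)"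
    by (simp only: mp[symmetric]) (simp add: mdeg_def power_sum)
  moreover have "(\<Prod>i\<in>keys \<alpha>. arc (P i) ^ lookup \<alpha> i) = arc (monval P \<alpha>)"
    by (simp add: monval_def peval_prod[OF ring_map_const] peval_power[OF ring_map_const])
  ultimately have 1: "monom 1 (Suc V0 * ?d) dvd arc (monval P \<alpha>)" by simp
  have "arc (Q ^ (l - ?d)) = monom 1 (V0 * (l - ?d)) * Q' ^ (l - ?d)"
    by (simp add: peval_power[OF ring_map_const] arc_Q(1) power_mult_distrib mp)
  then have 2: "monom 1 (V0 * (l - ?d)) dvd arc (Q ^ (l - ?d))" by simp
  have "l * V0 + n \<le> Suc V0 * ?d + V0 * (l - ?d)"
  proof -
    obtain c where "l = ?d + c" using l[OF \<alpha>] le_Suc_ex by blast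
    then show ?thesis using \<alpha>N(2) by (simp add: algebra_simps)
  qed
  then have "(monom 1 (l * V0 + n) :: 'k mpoly poly) dvd monom 1 (Suc V0 * ?d + V0 * (l - ?d))"
    using le_imp_power_dvd[of "l * V0 + n" "Suc V0 * ?d + V0 * (l - ?d)" "monom (1::'k mpoly) 1"]
    by (simp only: mp mult_1)
  also have "\<dots> = monom 1 (Suc V0 * ?d) * monom 1 (V0 * (l - ?d))" by (simp only: mult_monom mult_1)
  also have "\<dots> dvd arc (monval P \<alpha>) * arc (Q ^ (l - ?d))" by (rule mult_dvd_mono[OF 1 2])
  finally show "monom 1 (l * V0 + n) dvd
      arc (mconst (lookup p \<alpha>) * monval P \<alpha> * Q ^ (l - ?d))"
    by (simp add: peval_mult[OF ring_map_const] mult.assoc dvd_mult)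
qed

lemma arc_degree_le:
  assumes H: "deg_le H (\<lambda>k. if k \<in> J then b else 0)"
  shows "degree (arc H) \<le> m * b * h"
  unfolding peval_def
proof (rule degree_sum_le)
  fix \<beta> assume "\<beta> \<in> keys H"
  then have \<beta>: "lookup \<beta> k \<le> (if k \<in> J then b else 0)" for k using H by (auto simp: deg_le_def)
  have keys: "keys \<beta> \<subseteq> J"
  proof
    fix k assume "k \<in> keys \<beta>"
    then show "k \<in> J" using \<beta>[of k] by (auto simp: in_keys_iff split: if_splits)
  qed
  have "degree (monval \<xi> \<beta>) \<le> (\<Sum>k\<in>keys \<beta>. degree (\<xi> k ^ lookup \<beta> k))"
    unfolding monval_def using degree_prod_sum_le[of "keys \<beta>" "\<lambda>k. \<xi> k ^ lookup \<beta> k"]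
    by (simp add: o_def)
  also have "\<dots> \<le> (\<Sum>k\<in>keys \<beta>. b * h)"
  proof (rule sum_mono)
    fix k
    have "degree (\<xi> k ^ lookup \<beta> k) \<le> degree (\<xi> k) * lookup \<beta> k"
      by (rule degree_power_le)
    also have "\<dots> \<le> h * b" using \<beta>[of k] arc_degree[of k] by (intro mult_mono) (auto split: if_splits)
    finally show "degree (\<xi> k ^ lookup \<beta> k) \<le> b * h" by (simp add: mult.commute)
  qed
  also have "\<dots> \<le> m * (b * h)" using card_mono[OF J(1) keys] by simp
  finally have "degree (monval \<xi> \<beta>) \<le> m * b * h" by (simp add: mult.assoc)
  then show "degree ([:mconst (lookup H \<beta>):] * monval \<xi> \<beta>) \<le> m * b * h"
    using degree_mult_le[of "[:mconst (lookup H \<beta>):]" "monval \<xi> \<beta>"] by simp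
qed simp

text \<open>Being a value of order n in the \<sigma> forces H to have order at least n along the
  arc, while H along the arc is a polynomial of degree at most m b h in the arc parameter. This is
  why the arcs are polynomials and not power series.\<close>

lemma arc_order:
  assumes H: "deg_le H (\<lambda>k. if k \<in> J then b else 0)" and w: "w \<in> high n" "\<kappa> H = ev w"
    and n: "m * b * h < n"
  shows "H = 0"
proof -
  define l where "l = (\<Sum>\<alpha>\<in>keys w. mdeg \<alpha>)"
  have l: "mdeg \<alpha> \<le> l" if "\<alpha> \<in> keys w" for \<alpha>
    unfolding l_def using that by (intro member_le_sum) auto
  have "\<kappa> (H * Q ^ l - homog l w) = 0"
    using \<kappa>_homog[of w l] l w(2) by (simp add: ring_mapD[OF \<kappa>])
  then have eq: "H * Q ^ l = homog l w" using \<kappa>_inj by fastforce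
  have "monom 1 (l * V0 + n) dvd arc (H * Q ^ l)" unfolding eq by (rule arc_homog[OF w(1) l])
  also have "arc (H * Q ^ l) = monom 1 (l * V0) * (arc H * Q' ^ l)"
    by (simp add: peval_mult[OF ring_map_const] peval_power[OF ring_map_const] arc_Q(1) power_mult_distrib
        monom_power mult_ac)
  also have "monom 1 (l * V0 + n) = monom 1 (l * V0) * (monom 1 n :: 'k mpoly poly)"
    by (simp add: mult_monom)
  finally have "monom 1 n dvd arc H * Q' ^ l" by (subst (asm) dvd_mult_cancel_left) simp
  then obtain r where r: "arc H * Q' ^ l = monom 1 n * r" by (elim dvdE)
  have Q'l: "coeff (Q' ^ l) 0 \<noteq> 0" using arc_Q(2) by (simp flip: poly_0_coeff_0)
  have "arc H = 0"
  proof (rule ccontr)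
    assume nz: "arc H \<noteq> 0"
    define d where "d = (LEAST i. coeff (arc H) i \<noteq> 0)"
    have ex: "coeff (arc H) (degree (arc H)) \<noteq> 0" using nz by simp
    have d: "coeff (arc H) d \<noteq> 0" "d \<le> degree (arc H)" "\<And>i. i < d \<Longrightarrow> coeff (arc H) i = 0"
      unfolding d_def using LeastI[of "\<lambda>i. coeff (arc H) i \<noteq> 0", OF ex]
        Least_le[of "\<lambda>i. coeff (arc H) i \<noteq> 0", OF ex] not_less_Least by blast+
    have "coeff (arc H * Q' ^ l) d = (\<Sum>i\<le>d. coeff (arc H) i * coeff (Q' ^ l) (d - i))" by (simp add: coeff_mult)
    also have "\<dots> = (\<Sum>i\<in>{d}. coeff (arc H) i * coeff (Q' ^ l) (d - i))"
      using d(3) by (intro sum.mono_neutral_right) auto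
    finally have "coeff (arc H * Q' ^ l) d \<noteq> 0" using d(1) Q'l by simp
    moreover have "coeff (monom 1 n * r) d = 0"
      using d(2) arc_degree_le[OF H] n by (simp add: coeff_monom_mult)
    ultimately show False using r by simp
  qed
  then show ?thesis by (rule arc_inj)
qed

text \<open>If every \<open>m\<close> of the \<open>\<sigma>\<close>'s had dependent initial forms, then the standard monomials would be too few
  to accommodate the polynomials in the \<open>m\<close> independent elements \<open>\<chi>\<close>, whose order along the arc is
  bounded linearly in the degree.\<close>

theorem independent_initial_forms:
  "\<exists>S. S \<subseteq> {..<N} \<and> card S = m \<and>
     (\<forall>n H w. H \<in> form S n \<longrightarrow> H \<noteq> 0 \<longrightarrow> w \<in> high (Suc n) \<longrightarrow> ev H \<noteq> ev w)"
proof (rule ccontr)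
  assume neg: "\<not> ?thesis"
  define SS where "SS = {S. S \<subseteq> {..<N} \<and> card S = m}"
  have finSS: "finite SS" unfolding SS_def by (rule finite_subset[of _ "Pow {..<N}"]) auto
  \<comment> \<open>The assumed dependence for S is solved for its largest monomial a, modulo values
    of higher order.\<close>
  have "\<exists>a n g w. keys a \<subseteq> S \<and> mdeg a = n \<and> g \<in> form S n \<and> (\<forall>b\<in>keys g. b < a) \<and>
      w \<in> high (Suc n) \<and> monval \<sigma> a = ev g + ev w" if S: "S \<in> SS" for S
  proof -
    obtain n H w where *: "H \<in> form S n" "H \<noteq> 0" "w \<in> high (Suc n)" "ev H = ev w"
      using neg S by (auto simp: SS_def)
    define a where "a = Max (keys H)"
    define c where "c = lookup H a"
    have ne: "keys H \<noteq> {}" using *(2) by simp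
    have a: "a \<in> keys H" unfolding a_def using ne by (intro Max_in) auto
    have aS: "keys a \<subseteq> S" "mdeg a = n" using a *(1) by (auto simp: graded_def)
    have c: "c \<noteq> 0" using a by (simp add: c_def in_keys_iff)
    define g where "g = single a 1 - mconst (inverse c) * H"
    define w' where "w' = mconst (inverse c) * w"
    have g: "g \<in> form S n"
      unfolding g_def using aS *(1)
      by (intro graded_diff graded_single graded_mult[OF graded_mconst[of "{0}"]]) auto
    have w': "w' \<in> high (Suc n)"
      unfolding w'_def using *(3) by (intro graded_mult[OF graded_mconst[of "{0}"]]) auto
    have lt: "b < a" if b: "b \<in> keys g" for b
    proof -
      have lg: "lookup g b = (1 when a = b) - inverse c * lookup H b"
        by (simp add: g_def lookup_minus lookup_single lookup_mconst_mult)
      have "b \<noteq> a" using b c lg by (auto simp: in_keys_iff c_def)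
      then have "b \<in> keys H" using b lg by (auto simp: in_keys_iff)
      then have "b \<le> a" unfolding a_def by (intro Max_ge) auto
      with \<open>b \<noteq> a\<close> show ?thesis by simp
    qed
    have "monval \<sigma> a = ev g + ev w'"
      by (simp add: g_def w'_def ev_simps *(4))
    then show ?thesis using aS g w' lt by blast
  qed
  then have "\<forall>S\<in>SS. \<exists>a g w. keys a \<subseteq> S \<and> g \<in> form S (mdeg a) \<and> (\<forall>b\<in>keys g. b < a) \<and>
      w \<in> high (Suc (mdeg a)) \<and> monval \<sigma> a = ev g + ev w" by blast
  then obtain A G W where AGW: "\<And>S. S \<in> SS \<Longrightarrow> keys (A S) \<subseteq> S"
    "\<And>S. S \<in> SS \<Longrightarrow> G S \<in> form S (mdeg (A S))"
    "\<And>S b. S \<in> SS \<Longrightarrow> b \<in> keys (G S) \<Longrightarrow> b < A S"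
    "\<And>S. S \<in> SS \<Longrightarrow> W S \<in> high (Suc (mdeg (A S)))"
    "\<And>S. S \<in> SS \<Longrightarrow> monval \<sigma> (A S) = ev (G S) + ev (W S)"
    by metis
  \<comment> \<open>Larger than every exponent in every leading monomial \<open>A S\<close>.
    Exponents of at least a at all places of S therefore imply divisibility by
    \<open>A S\<close>.\<close>
  define a where "a = Suc (\<Sum>S\<in>SS. mdeg (A S))"
  have a: "lookup (A S) i < a" if "S \<in> SS" for S i
  proof -
    have "lookup (A S) i \<le> mdeg (A S)" by (rule lookup_le_mdeg)
    also have "\<dots> \<le> (\<Sum>S\<in>SS. mdeg (A S))" using that finSS by (intro member_le_sum) auto
    finally show ?thesis by (simp add: a_def)
  qed
  \<comment> \<open>These are the standard monomials below degree n: fewer than m large exponents,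
    so that no \<open>A S\<close> is guaranteed to divide them.\<close>
  define Good where "Good n = {\<beta>. keys \<beta> \<subseteq> {..<N} \<and> mdeg \<beta> < n \<and>
    card {i\<in>{..<N}. a \<le> lookup \<beta> i} < m}" for n
  define red where "red n p \<longleftrightarrow> (\<exists>g w. keys g \<subseteq> Good n \<and> w \<in> high n \<and> ev p = ev g + ev w)"
    for n and p :: "'k mpoly"
  have red_sum: "red n (\<Sum>i\<in>I. mconst (c i) * f i)" if red_f: "\<And>i. i \<in> I \<Longrightarrow> red n (f i)" for n I c and f :: "_ \<Rightarrow> 'k mpoly"
  proof -
    obtain g w where gw: "\<And>i. i \<in> I \<Longrightarrow> keys (g i) \<subseteq> Good n"
      "\<And>i. i \<in> I \<Longrightarrow> w i \<in> high n" "\<And>i. i \<in> I \<Longrightarrow> ev (f i) = ev (g i) + ev (w i)"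
    proof -
      have "\<forall>i\<in>I. \<exists>x. keys (fst x) \<subseteq> Good n \<and> snd x \<in> high n \<and> ev (f i) = ev (fst x) + ev (snd x)"
        using red_f unfolding red_def by force
      from bchoice[OF this] obtain F where "\<forall>i\<in>I. keys (fst (F i)) \<subseteq> Good n \<and>
        snd (F i) \<in> high n \<and> ev (f i) = ev (fst (F i)) + ev (snd (F i))" by blast
      then show ?thesis by (intro that[of "\<lambda>i. fst (F i)" "\<lambda>i. snd (F i)"]) auto
    qed
    have "keys (\<Sum>i\<in>I. mconst (c i) * g i) \<subseteq> Good n"
    proof
      fix b assume "b \<in> keys (\<Sum>i\<in>I. mconst (c i) * g i)"
      then have "(\<Sum>i\<in>I. c i * lookup (g i) b) \<noteq> 0"
        by (simp add: in_keys_iff lookup_sum lookup_mconst_mult)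
      then obtain i where "i \<in> I" "c i * lookup (g i) b \<noteq> 0" by (rule sum.not_neutral_contains_not_neutral)
      then have "i \<in> I" "b \<in> keys (g i)" by (auto simp: in_keys_iff)
      then show "b \<in> Good n" using gw(1) by blast
    qed
    moreover have "(\<Sum>i\<in>I. mconst (c i) * w i) \<in> high n"
      using gw(2) by (intro graded_sum graded_mult[OF graded_mconst[of "{0}"]]) auto
    moreover have "ev (\<Sum>i\<in>I. mconst (c i) * f i) = ev (\<Sum>i\<in>I. mconst (c i) * g i) + ev (\<Sum>i\<in>I. mconst (c i) * w i)"
      using gw(3) by (simp add: ev_simps sum.distrib[symmetric] distrib_left)
    ultimately show ?thesis unfolding red_def by blast
  qed
  have red_poly: "red n p" if "\<And>\<alpha>. \<alpha> \<in> keys p \<Longrightarrow> red n (single \<alpha> 1)" for n p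
  proof -
    define r where "r = (\<Sum>\<alpha>\<in>keys p. mconst (lookup p \<alpha>) * single \<alpha> 1)"
    have "p = r"
      using mpoly_sum_monomials[OF finite_keys subset_refl, of p] by (simp add: r_def mconst_def mult_single)
    moreover have "red n r" unfolding r_def using that by (rule red_sum)
    ultimately show ?thesis by simp
  qed
  define Mon where "Mon d = {\<beta>. keys \<beta> \<subseteq> {..<N} \<and> mdeg \<beta> = d}" for d
  have finMon: "finite (Mon d)" for d
  proof (rule finite_subset)
    show "Mon d \<subseteq> box {..<N} (\<lambda>_. Suc d)"
      using lookup_le_mdeg by (auto simp: Mon_def box_def less_Suc_eq_le)
  qed (simp add: finite_box)
  \<comment> \<open>Replacing a factor \<open>A S\<close> gives monomials of the same degree that
    are smaller in the monomial order, or monomials of higher degree. The first can happen only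
    finitely often within one degree, and degrees from n on are absorbed by
    \<open>high n\<close>.\<close>
  have reduce: "red n (single \<alpha> 1)" if "keys \<alpha> \<subseteq> {..<N}" for n \<alpha>
  proof -
    let ?f = "\<lambda>\<alpha>. (n - mdeg \<alpha>, card {\<beta>\<in>Mon (mdeg \<alpha>). \<beta> < \<alpha>})"
    have "wf (inv_image (less_than <*lex*> less_than) ?f)" by auto
    then show ?thesis using that
    proof (induction \<alpha> rule: wf_induct_rule)
      case (less \<alpha>)
      have IH1: "red n (single \<beta> 1)" if "mdeg \<alpha> < n" "mdeg \<beta> > mdeg \<alpha>" "keys \<beta> \<subseteq> {..<N}" for \<beta>
        using that by (intro less.IH) auto
      have IH2: "red n (single \<beta> 1)" if "mdeg \<beta> = mdeg \<alpha>" "\<beta> < \<alpha>" "keys \<beta> \<subseteq> {..<N}" for \<beta>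
      proof (rule less.IH)
        have "{\<gamma>\<in>Mon (mdeg \<alpha>). \<gamma> < \<beta>} \<subset> {\<gamma>\<in>Mon (mdeg \<alpha>). \<gamma> < \<alpha>}"
          using that by (auto simp: Mon_def)
        then have "card {\<gamma>\<in>Mon (mdeg \<alpha>). \<gamma> < \<beta>} < card {\<gamma>\<in>Mon (mdeg \<alpha>). \<gamma> < \<alpha>}"
          using finMon by (intro psubset_card_mono) auto
        then show "(\<beta>, \<alpha>) \<in> inv_image (less_than <*lex*> less_than) ?f" using that(1) by simp
      qed fact
      consider "mdeg \<alpha> \<ge> n" | "\<alpha> \<in> Good n" | "mdeg \<alpha> < n" "m \<le> card {i\<in>{..<N}. a \<le> lookup \<alpha> i}"
        using less.prems by (fastforce simp: Good_def)
      then show ?case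
      proof cases
        case 1
        then show ?thesis unfolding red_def using less.prems
          by - (rule exI[of _ 0], rule exI[of _ "single \<alpha> 1"], auto simp: graded_single ev_simps)
      next
        case 2
        then show ?thesis unfolding red_def
          by - (rule exI[of _ "single \<alpha> 1"], rule exI[of _ 0], auto simp: graded_0 ev_simps)
      next
        case 3
        obtain S where S: "S \<subseteq> {i\<in>{..<N}. a \<le> lookup \<alpha> i}" "card S = m"
          using obtain_subset_with_card_n[OF 3(2)] by blast
        then have SS: "S \<in> SS" by (auto simp: SS_def)
        define \<gamma> where "\<gamma> = \<alpha> - A S"
        have \<alpha>\<gamma>: "\<alpha> = \<gamma> + A S"
        proof (rule poly_mapping_eqI)
          fix i
          have "lookup (A S) i \<le> lookup \<alpha> i"
          proof (cases "i \<in> keys (A S)")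
            case True
            then have "a \<le> lookup \<alpha> i" using AGW(1)[OF SS] S by auto
            then show ?thesis using a[OF SS, of i] by simp
          qed (simp add: in_keys_iff)
          then show "lookup \<alpha> i = lookup (\<gamma> + A S) i"
            by (simp add: \<gamma>_def lookup_add lookup_minus)
        qed
        have SN: "S \<subseteq> {..<N}" using S by auto
        have \<gamma>N: "keys \<gamma> \<subseteq> {..<N}" using less.prems by (auto simp: \<alpha>\<gamma> keys_add_nat)
        define g where "g = single \<gamma> 1 * G S"
        define w where "w = single \<gamma> 1 * W S"
        have keys_sub: "\<exists>b\<in>keys p. \<beta> = \<gamma> + b"
          if "\<beta> \<in> keys (single \<gamma> 1 * p)" for \<beta> and p :: "'k mpoly"
          using that keys_mult[of "single \<gamma> (1::'k)" p] by auto
        have "red n g"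
        proof (rule red_poly)
          fix \<beta> assume "\<beta> \<in> keys g"
          then obtain b where b: "b \<in> keys (G S)" "\<beta> = \<gamma> + b" using keys_sub by (auto simp: g_def)
          have bS: "keys b \<subseteq> S" "mdeg b = mdeg (A S)" using b AGW(2)[OF SS] by (auto simp: graded_def)
          show "red n (single \<beta> 1)"
          proof (rule IH2)
            show "mdeg \<beta> = mdeg \<alpha>" using bS by (simp add: b \<alpha>\<gamma> mdeg_add)
            show "\<beta> < \<alpha>" using AGW(3)[OF SS b(1)] unfolding b \<alpha>\<gamma> by (rule add_strict_left_mono)
            show "keys \<beta> \<subseteq> {..<N}" using bS SN \<gamma>N by (auto simp: b keys_add_nat)
          qed
        qed
        moreover have "red n w"
        proof (rule red_poly)
          fix \<beta> assume "\<beta> \<in> keys w"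
          then obtain b where b: "b \<in> keys (W S)" "\<beta> = \<gamma> + b" using keys_sub by (auto simp: w_def)
          have bS: "keys b \<subseteq> {..<N}" "mdeg b > mdeg (A S)" using b AGW(4)[OF SS] by (auto simp: graded_def)
          show "red n (single \<beta> 1)"
          proof (rule IH1[OF 3(1)])
            show "mdeg \<beta> > mdeg \<alpha>" using bS by (simp add: b \<alpha>\<gamma> mdeg_add)
            show "keys \<beta> \<subseteq> {..<N}" using bS \<gamma>N by (auto simp: b keys_add_nat)
          qed
        qed
        ultimately have "red n (\<Sum>i\<in>{True, False}. mconst 1 * (if i then g else w))"
          by (intro red_sum) auto
        then have "red n (g + w)" by (simp add: mconst_simps)
        moreover have "ev (single \<alpha> 1) = ev (g + w)"
          using AGW(5)[OF SS] by (simp add: g_def w_def ev_simps \<alpha>\<gamma> monval_add distrib_left)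
        ultimately show ?thesis unfolding red_def by simp
      qed
    qed
  qed
  have a1: "a \<ge> 1" by (simp add: a_def)
  \<comment> \<open>R is the set of places with large exponents: at most m - 1 places with exponents
    below n, while the other exponents stay below the fixed a. So the number grows only like n^(m -
    1).\<close>
  have Good_card: "finite (Good n)" "card (Good n) \<le> 2 ^ N * (a ^ N * n ^ (m - 1))" if n: "n \<ge> 1" for n
  proof -
    define RR where "RR = {R. R \<subseteq> {..<N} \<and> card R \<le> m - 1}"
    define Bx where "Bx R = box {..<N} (\<lambda>i. if i \<in> R then n else a)" for R
    have finRR: "finite RR" unfolding RR_def by (rule finite_subset[of _ "Pow {..<N}"]) auto
    have "Good n \<subseteq> (\<Union>R\<in>RR. Bx R)"
    proof
      fix \<beta> assume \<beta>: "\<beta> \<in> Good n"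
      let ?R = "{i\<in>{..<N}. a \<le> lookup \<beta> i}"
      have "?R \<in> RR" using \<beta> by (auto simp: RR_def Good_def)
      moreover have "\<beta> \<in> Bx ?R"
        using \<beta> lookup_le_mdeg[of \<beta>] by (auto simp: Bx_def box_def Good_def not_le intro: le_less_trans)
      ultimately show "\<beta> \<in> (\<Union>R\<in>RR. Bx R)" by blast
    qed
    moreover have fin: "finite (\<Union>R\<in>RR. Bx R)" using finRR by (auto simp: Bx_def finite_box)
    ultimately show "finite (Good n)" by (rule finite_subset)
    have "card (Good n) \<le> card (\<Union>R\<in>RR. Bx R)" by (rule card_mono) fact+
    also have "\<dots> \<le> (\<Sum>R\<in>RR. card (Bx R))" by (rule card_UN_le[OF finRR])
    also have "\<dots> \<le> (\<Sum>R\<in>RR. a ^ N * n ^ (m - 1))"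
    proof (rule sum_mono)
      fix R assume R: "R \<in> RR"
      have "card (Bx R) = (\<Prod>i\<in>{..<N}. if i \<in> R then n else a)" by (simp add: Bx_def card_box)
      also have "\<dots> \<le> (\<Prod>i\<in>{..<N}. (if i \<in> R then n else 1) * a)"
        using a1 n by (intro prod_mono) auto
      also have "\<dots> = a ^ N * n ^ card R"
        using R by (simp add: prod.distrib prod.If_cases RR_def Int_absorb1 mult.commute)
      also have "\<dots> \<le> a ^ N * n ^ (m - 1)" using R n by (intro mult_left_mono power_increasing) (auto simp: RR_def)
      finally show "card (Bx R) \<le> a ^ N * n ^ (m - 1)" .
    qed
    also have "\<dots> \<le> 2 ^ N * (a ^ N * n ^ (m - 1))"
    proof -
      have "card RR \<le> card (Pow {..<N})" unfolding RR_def by (intro card_mono) auto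
      then have "card RR \<le> 2 ^ N" by (simp add: card_Pow)
      then show ?thesis by simp
    qed
    finally show "card (Good n) \<le> 2 ^ N * (a ^ N * n ^ (m - 1))" .
  qed
  \<comment> \<open>Because n \<le> (m h + 1) (b + 1), this b turns the bound on standard monomials
    into b (b + 1)^(m - 1), fewer than the (b + 1)^m monomials in the \<chi>. And n is the first
    order that \<open>arc_order\<close> excludes for degree b.\<close>
  define b where "b = 2 ^ N * a ^ N * (m * h + 1) ^ (m - 1)"
  define n where "n = m * b * h + 1"
  have "card (Good n) < card (box J (\<lambda>_. Suc b))"
  proof -
    have "n \<le> (m * h + 1) * Suc b" by (simp add: n_def algebra_simps)
    then have "n ^ (m - 1) \<le> ((m * h + 1) * Suc b) ^ (m - 1)" by (rule power_mono) simp
    then have "2 ^ N * (a ^ N * n ^ (m - 1)) \<le> 2 ^ N * (a ^ N * ((m * h + 1) * Suc b) ^ (m - 1))" by simp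
    also have "\<dots> = b * Suc b ^ (m - 1)" by (simp only: b_def power_mult_distrib mult_ac)
    also have "\<dots> < Suc b * Suc b ^ (m - 1)" by simp
    also have "\<dots> = Suc b ^ m" using m_pos by (simp flip: power_Suc)
    also have "\<dots> = card (box J (\<lambda>_. Suc b))" using J by (simp add: card_box)
    finally show ?thesis using Good_card(2)[of n] by (simp add: n_def)
  qed
  have "\<exists>g w. keys g \<subseteq> Good n \<and> w \<in> high n \<and> monval \<chi> \<gamma> = ev g + ev w"
    if \<gamma>: "\<gamma> \<in> box J (\<lambda>_. Suc b)" for \<gamma>
  proof -
    obtain ps where ps: "\<And>j. j \<in> J \<Longrightarrow> ps j < N \<and> \<sigma> (ps j) = \<chi> j" using \<sigma>_pos by metis
    define \<alpha> where "\<alpha> = (\<Sum>j\<in>keys \<gamma>. single (ps j) (lookup \<gamma> j))"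
    have \<gamma>J: "keys \<gamma> \<subseteq> J" using \<gamma> by (simp add: box_def)
    have "monval \<sigma> \<alpha> = monval \<chi> \<gamma>"
      unfolding \<alpha>_def monval_sum[OF finite_keys] monval_single
      using ps \<gamma>J by (auto simp: monval_def intro!: prod.cong)
    moreover have "keys \<alpha> \<subseteq> {..<N}"
    proof
      fix i assume "i \<in> keys \<alpha>"
      then have "(\<Sum>j\<in>keys \<gamma>. lookup (single (ps j) (lookup \<gamma> j)) i) \<noteq> 0"
        by (simp add: in_keys_iff \<alpha>_def lookup_sum)
      then obtain j where "j \<in> keys \<gamma>" "lookup (single (ps j) (lookup \<gamma> j)) i \<noteq> 0"
        by (rule sum.not_neutral_contains_not_neutral)
      then show "i \<in> {..<N}" using ps \<gamma>J by (auto simp: lookup_single when_def split: if_splits)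
    qed
    ultimately show ?thesis using reduce[of \<alpha> n] by (auto simp: red_def ev_simps)
  qed
  then obtain g w where gw: "\<And>\<gamma>. \<gamma> \<in> box J (\<lambda>_. Suc b) \<Longrightarrow> keys (g \<gamma>) \<subseteq> Good n"
    "\<And>\<gamma>. \<gamma> \<in> box J (\<lambda>_. Suc b) \<Longrightarrow> w \<gamma> \<in> high n"
    "\<And>\<gamma>. \<gamma> \<in> box J (\<lambda>_. Suc b) \<Longrightarrow> monval \<chi> \<gamma> = ev (g \<gamma>) + ev (w \<gamma>)"
    by metis
  let ?B = "box J (\<lambda>_. Suc b)"
  have finB: "finite ?B" using J by (simp add: finite_box)
  have "finite (Good n)" using Good_card(1)[of n] by (simp add: n_def)
  then obtain c where c: "\<exists>\<gamma>\<in>?B. c \<gamma> \<noteq> 0" and c0: "(\<Sum>\<gamma>\<in>?B. mconst (c \<gamma>) * g \<gamma>) = 0"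
    by (rule mpoly_dependence[OF _ finB \<open>card (Good n) < card ?B\<close> gw(1)])
  \<comment> \<open>The dependence cancels the standard parts, so the value of H has order at least
    n; \<open>arc_order\<close> then makes H zero although its coefficients are not all
    zero.\<close>
  define H where "H = (\<Sum>\<gamma>\<in>?B. single \<gamma> (c \<gamma>))"
  have "ev (\<Sum>\<gamma>\<in>?B. mconst (c \<gamma>) * g \<gamma>) = 0" by (simp only: c0 ev_simps)
  then have "(\<Sum>\<gamma>\<in>?B. \<iota> (c \<gamma>) * ev (g \<gamma>)) = 0" by (simp add: ev_simps)
  moreover have "\<kappa> H = (\<Sum>\<gamma>\<in>?B. \<iota> (c \<gamma>) * (ev (g \<gamma>) + ev (w \<gamma>)))"
    unfolding H_def ring_map_sum[OF \<kappa>] \<kappa>_single using gw(3) by simp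
  ultimately have "\<kappa> H = ev (\<Sum>\<gamma>\<in>?B. mconst (c \<gamma>) * w \<gamma>)"
    by (simp add: ev_simps distrib_left sum.distrib)
  moreover have "(\<Sum>\<gamma>\<in>?B. mconst (c \<gamma>) * w \<gamma>) \<in> high n"
    using gw(2) by (intro graded_sum graded_mult[OF graded_mconst[of "{0}"]]) auto
  moreover have "deg_le H (\<lambda>k. if k \<in> J then b else 0)"
    unfolding H_def by (intro deg_le_sum deg_le_single) (auto simp: box_def in_keys_iff less_Suc_eq_le)
  ultimately have "H = 0" by (intro arc_order[of H b _ n]) (auto simp: n_def)
  moreover have "lookup H \<gamma> = c \<gamma>" if "\<gamma> \<in> ?B" for \<gamma>
    using that finB by (simp add: H_def lookup_sum lookup_single when_def)
  ultimately show False using c by auto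
qed

end

lemma greatest_exists:
  fixes f :: "'a \<Rightarrow> nat"
  assumes "Q z" "\<And>y. Q y \<Longrightarrow> f y \<le> b"
  shows "\<exists>x. Q x \<and> (\<forall>y. Q y \<longrightarrow> f y \<le> f x)"
  by (rule ex_has_greatest_nat[where P = Q and k = z and b = "Suc b"])
    (use assms in \<open>auto simp: le_imp_less_Suc\<close>)

lemma box_lookup_le: "\<beta> \<in> box I (\<lambda>_. Suc b) \<Longrightarrow> lookup \<beta> i \<le> (if i \<in> I then b else 0)"
  by (cases "i \<in> keys \<beta>") (auto simp: box_def in_keys_iff less_Suc_eq_le)

section \<open>The place that kills all \<sigma> and keeps the ratios of initial forms\<close>

context arc_family
begin

text \<open>For the S chosen below this is a field of transcendence degree m - 1 over the base
  field; its elements become the constants of the curve.\<close>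

definition form_fracs :: "nat set \<Rightarrow> 'w set" where
  "form_fracs S = {ev w / ev H | n w H. w \<in> form S n \<and> H \<in> form S n \<and> H \<noteq> 0}"

text \<open>Quotients w / H, with w of order at least the degree of the form H, constitute a ring;
  those with w of larger order constitute an ideal. Independence of initial forms says that 1 is not
  in this ideal, so \<open>valuation_ring_exists\<close> applies. Ratios of forms of equal degree
  form a field inside the ring and can be put into the coefficient field.\<close>

theorem place_exists:
  obtains V k S where "valuation_ring V" "subfield_set k" "k \<subseteq> V"
    "\<And>x. x \<in> V \<Longrightarrow> \<exists>c\<in>k. x - c \<in> valuation_ring.max_ideal V"
    "\<And>i. i < N \<Longrightarrow> \<sigma> i \<in> valuation_ring.max_ideal V"
    "S \<subseteq> {..<N}" "card S = m" "\<And>n H. H \<in> form S n \<Longrightarrow> H \<noteq> 0 \<Longrightarrow> ev H \<noteq> 0" "form_fracs S \<subseteq> k"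
proof -
  obtain S where S: "S \<subseteq> {..<N}" "card S = m"
    and indep: "\<And>n H w. H \<in> form S n \<Longrightarrow> H \<noteq> 0 \<Longrightarrow> w \<in> high (Suc n) \<Longrightarrow> ev H \<noteq> ev w"
    using independent_initial_forms by blast
  have nz: "ev H \<noteq> 0" if "H \<in> form S n" "H \<noteq> 0" for H n
    using indep[OF that, of 0] by (simp add: graded_0 ev_simps)
  define F where "F d = {ev w / ev H | n w H. w \<in> high (n + d) \<and> H \<in> form S n \<and> H \<noteq> 0}" for d
  have FI: "ev w / ev H \<in> F d" if "w \<in> high (n + d)" "H \<in> form S n" "H \<noteq> 0" for w H n d
    using that unfolding F_def by blast
  have FE: "\<exists>n w H. x = ev w / ev H \<and> w \<in> high (n + d) \<and> H \<in> form S n \<and> H \<noteq> 0" if "x \<in> F d" for x d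
    using that unfolding F_def by blast
  have form_high: "p \<in> high n" if "p \<in> form S n" for p n
    using that S by (intro graded_mono[OF that]) auto
  have form_mult: "p * q \<in> form S (n + l)" if "p \<in> form S n" "q \<in> form S l" for p q n l
    by (rule graded_mult[OF that]) auto
  have F_mult: "x * y \<in> F (d + d')" if xy: "x \<in> F d" "y \<in> F d'" for x y d d'
  proof -
    obtain n w H n' w' H' where *: "x = ev w / ev H" "w \<in> high (n + d)" "H \<in> form S n" "H \<noteq> 0"
      "y = ev w' / ev H'" "w' \<in> high (n' + d')" "H' \<in> form S n'" "H' \<noteq> 0"
      using FE[OF xy(1)] FE[OF xy(2)] by blast
    have "x * y = ev (w * w') / ev (H * H')" by (simp add: * ev_simps)
    moreover have "w * w' \<in> high (n + n' + (d + d'))" by (rule graded_mult[OF *(2,6)]) auto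
    ultimately show ?thesis using FI[of "w * w'" "n + n'"] form_mult[OF *(3,7)] *(4,8) by auto
  qed
  have F_diff: "x - y \<in> F d" if xy: "x \<in> F d" "y \<in> F d" for x y d
  proof -
    obtain n w H n' w' H' where *: "x = ev w / ev H" "w \<in> high (n + d)" "H \<in> form S n" "H \<noteq> 0"
      "y = ev w' / ev H'" "w' \<in> high (n' + d)" "H' \<in> form S n'" "H' \<noteq> 0"
      using FE[OF xy(1)] FE[OF xy(2)] by blast
    have "x - y = ev (w * H' - w' * H) / ev (H * H')"
      using nz[OF *(3,4)] nz[OF *(7,8)] by (simp add: * ev_simps diff_frac_eq)
    moreover have "w * H' \<in> high (n + n' + d)" by (rule graded_mult[OF *(2) form_high[OF *(7)]]) auto
    moreover have "w' * H \<in> high (n + n' + d)" by (rule graded_mult[OF *(6) form_high[OF *(3)]]) auto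
    ultimately show ?thesis using FI[of "w * H' - w' * H" "n + n'"] form_mult[OF *(3,7)] *(4,8)
      by (simp add: graded_diff)
  qed
  have one: "(1 :: 'k mpoly) \<in> form S 0" by (rule graded_1) simp
  have F0: "subring_set (F 0)"
    unfolding subring_set_def
  proof (intro conjI ballI)
    show "1 \<in> F 0" using FI[of 1 0 0 1] form_high[OF one] one by (simp add: ev_simps)
    show "x * y \<in> F 0" if "x \<in> F 0" "y \<in> F 0" for x y using F_mult[OF that] by simp
  qed (rule F_diff)
  have F10: "F 1 \<subseteq> F 0"
  proof
    fix x assume "x \<in> F 1"
    then obtain n w H where *: "x = ev w / ev H" "w \<in> high (n + 1)" "H \<in> form S n" "H \<noteq> 0" using FE by blast
    have "w \<in> high (n + 0)" using *(2) by (rule graded_mono) auto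
    then show "x \<in> F 0" unfolding *(1) using FI * by blast
  qed
  have "1 \<notin> ideal_gen (F 1) (F 0)"
  proof
    assume "1 \<in> ideal_gen (F 1) (F 0)"
    \<comment> \<open>\<open>F 1\<close> is already closed under sums and under multiples from
      \<open>F 0\<close>, so the ideal it generates is \<open>F 1\<close> itself.\<close>
    moreover have "x \<in> F 1" if "x \<in> ideal_gen (F 1) (F 0)" for x
      using that
    proof induction
      case zero
      show ?case using F10 FI[of 0 0 1 1] one by (simp add: ev_simps graded_0)
    next
      case (step a r x)
      have "0 - a * r \<in> F 1" using F_mult[OF step(1,2)] FI[of 0 0 1 1] one
        by (intro F_diff) (simp_all add: ev_simps graded_0)
      with step(4) have "x - (0 - a * r) \<in> F 1" by (rule F_diff)
      then show ?case by (simp add: add.commute)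
    qed
    ultimately obtain n w H where *: "1 = ev w / ev H" "w \<in> high (n + 1)" "H \<in> form S n" "H \<noteq> 0"
      using FE by blast
    then have "ev H = ev w" using nz by (metis divide_eq_1_iff)
    then show False using indep[OF *(3,4), of w] *(2) by simp
  qed
  then obtain V where V: "valuation_ring V" "F 0 \<subseteq> V" "F 1 \<subseteq> valuation_ring.max_ideal V"
    using valuation_ring_exists[OF F0 F10] by blast
  have K: "subfield_set (form_fracs S)"
    unfolding subfield_set_def subring_set_def
  proof (intro conjI ballI)
    have FF: "ev w / ev H \<in> form_fracs S" if "w \<in> form S n" "H \<in> form S n" "H \<noteq> 0" for w H n
      using that unfolding form_fracs_def by blast
    show "1 \<in> form_fracs S" using FF[of 1 0 1] one by (simp add: ev_simps)
    fix x assume "x \<in> form_fracs S"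
    then obtain n w H where *: "x = ev w / ev H" "w \<in> form S n" "H \<in> form S n" "H \<noteq> 0"
      unfolding form_fracs_def by blast
    show "inverse x \<in> form_fracs S"
    proof (cases "w = 0")
      case True
      then have "inverse x = ev w / ev H" by (simp add: *(1) ev_simps)
      then show ?thesis using FF * by metis
    next
      case False
      have "inverse x = ev H / ev w" by (simp add: *(1))
      then show ?thesis using FF * False by metis
    qed
    fix y assume "y \<in> form_fracs S"
    then obtain n' w' H' where **: "y = ev w' / ev H'" "w' \<in> form S n'" "H' \<in> form S n'" "H' \<noteq> 0"
      unfolding form_fracs_def by blast
    have "x - y = ev (w * H' - w' * H) / ev (H * H')"
      using nz[OF *(3,4)] nz[OF **(3,4)] by (simp add: * ** ev_simps diff_frac_eq)
    moreover have "w' * H \<in> form S (n + n')" using form_mult[OF **(2) *(3)] by (simp add: add.commute)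
    ultimately show "x - y \<in> form_fracs S"
      using FF[of "w * H' - w' * H" "n + n'"] form_mult[OF *(2) **(3)] form_mult[OF *(3) **(3)] *(4) **(4)
      by (simp add: graded_diff)
    have "x * y = ev (w * w') / ev (H * H')" by (simp add: * ** ev_simps)
    then show "x * y \<in> form_fracs S"
      using FF[of "w * w'" "n + n'"] form_mult[OF *(2) **(2)] form_mult[OF *(3) **(3)] *(4) **(4) by simp
  qed
  have KV: "form_fracs S \<subseteq> V"
  proof
    fix x assume "x \<in> form_fracs S"
    then obtain n w H where *: "x = ev w / ev H" "w \<in> form S n" "H \<in> form S n" "H \<noteq> 0"
      unfolding form_fracs_def by blast
    then have "x \<in> F 0" using FI[of w n 0 H] form_high by simp
    then show "x \<in> V" using V by blast
  qed
  have \<sigma>M: "\<sigma> i \<in> valuation_ring.max_ideal V" if "i < N" for i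
  proof -
    have "(mvar i :: 'k mpoly) \<in> high (0 + 1)" using that by (auto simp: mvar_def intro: graded_single)
    then have "\<sigma> i \<in> F 1" using FI[of "mvar i" 0 1 1] one by (simp add: ev_simps)
    then show ?thesis using V by blast
  qed
  obtain k where "subfield_set k" "form_fracs S \<subseteq> k" "k \<subseteq> V"
    "\<And>x. x \<in> V \<Longrightarrow> \<exists>c\<in>k. x - c \<in> valuation_ring.max_ideal V"
    using coefficient_field_exists[OF V(1) K KV] by blast
  then show ?thesis using that V(1) \<sigma>M S nz by blast
qed

end

text \<open>From here on \<open>k\<close> is the coefficient field of the place, a subfield of the
  large field; the base field is the type variable \<open>'k\<close>, embedded by \<iota>.\<close>

locale placed_family = arc_family J N D h V0 P Q Q' \<xi> \<kappa> + valuation_ring V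
  for J N D h V0 P Q Q' \<xi> and \<kappa> :: "'k::field mpoly \<Rightarrow> 'w::alg_closed_field" and V :: "'w set" +
  fixes k :: "'w set" and S :: "nat set"
  assumes k: "subfield_set k" "k \<subseteq> V"
    and residue: "x \<in> V \<Longrightarrow> \<exists>c\<in>k. x - c \<in> max_ideal"
    and \<sigma>_max: "i < N \<Longrightarrow> \<sigma> i \<in> max_ideal"
    and S: "S \<subseteq> {..<N}" "card S = m"
    and form_nz: "H \<in> form S n \<Longrightarrow> H \<noteq> 0 \<Longrightarrow> ev H \<noteq> 0" and form_fracs_k: "form_fracs S \<subseteq> k"
begin

abbreviation "val_id \<equiv> peval (\<lambda>x::'w. x) \<chi>"

definition kpolys :: "'w mpoly set" where
  "kpolys = {p. (\<forall>\<beta>. lookup p \<beta> \<in> k) \<and> (\<forall>\<beta>\<in>keys p. keys \<beta> \<subseteq> J)}"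

text \<open>This is k(\<chi>), the function field of the curve. V itself need not be discrete; only
  on L is the maximal ideal shown to be principal.\<close>

definition L :: "'w set" where
  "L = fracs (val_id ` kpolys)"

lemma sk: "subring_set k" by (rule subfield_subring[OF k(1)])

lemma subring_kpolys: "subring_set kpolys"
  unfolding subring_set_def
proof (intro conjI ballI)
  have R: "ring_rel (mpoly_rel (\<lambda>a b. a \<in> k \<and> b \<in> k))"
    by (rule ring_rel_mpoly) (use sk in \<open>auto simp: ring_rel_def subring_set_def\<close>)
  have R': "mpoly_rel (\<lambda>a b. a \<in> k \<and> b \<in> k) p p \<longleftrightarrow> (\<forall>\<beta>. lookup p \<beta> \<in> k)" for p :: "'w mpoly"
    by (simp add: mpoly_rel_def)
  show "1 \<in> kpolys"
    using ring_rel_1[OF R] unfolding R' by (simp add: kpolys_def)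
  fix p q assume pq: "p \<in> kpolys" "q \<in> kpolys"
  then have *: "mpoly_rel (\<lambda>a b. a \<in> k \<and> b \<in> k) p p" "mpoly_rel (\<lambda>a b. a \<in> k \<and> b \<in> k) q q"
    by (auto simp: R' kpolys_def)
  have "keys \<beta> \<subseteq> J" if "\<beta> \<in> keys (p - q)" for \<beta>
    using that keys_diff_subset[of p q] pq unfolding kpolys_def by blast
  then show "p - q \<in> kpolys"
    using ring_rel_diff[OF R *] unfolding R' by (simp add: kpolys_def)
  have "keys \<beta> \<subseteq> J" if \<beta>: "\<beta> \<in> keys (p * q)" for \<beta>
  proof -
    obtain a b where "\<beta> = a + b" "a \<in> keys p" "b \<in> keys q"
      using \<beta> keys_mult[of p q] by auto
    then show ?thesis using pq by (auto simp: kpolys_def keys_add_nat)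
  qed
  then show "p * q \<in> kpolys"
    using ring_rel_mult[OF R *] unfolding R' by (auto simp: kpolys_def)
qed

lemmas val_id_simps = peval_mult[OF ring_map_ident] peval_diff[OF ring_map_ident]
  peval_single[OF ring_map_ident] peval_1[OF ring_map_ident] peval_mvar[OF ring_map_ident]
  peval_power[OF ring_map_ident] peval_mconst[OF ring_map_ident]

lemma subring_val_kpolys: "subring_set (val_id ` kpolys)"
  unfolding subring_set_def
proof (intro conjI ballI)
  note sp = subring_kpolys
  show "1 \<in> val_id ` kpolys" using subring_1[OF sp] by (auto simp: val_id_simps intro!: image_eqI[of _ _ 1])
  fix x y assume "x \<in> val_id ` kpolys" "y \<in> val_id ` kpolys"
  then obtain p q where *: "x = val_id p" "y = val_id q" "p \<in> kpolys" "q \<in> kpolys" by blast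
  show "x - y \<in> val_id ` kpolys" "x * y \<in> val_id ` kpolys"
    using subring_diff[OF sp *(3,4)] subring_mult[OF sp *(3,4)] *(1,2)
    by (auto simp flip: val_id_simps)
qed

lemma subfield_L: "subfield_set L"
  unfolding L_def by (rule subfield_fracs[OF subring_val_kpolys])

lemmas sL = subfield_subring[OF subfield_L]

lemma val_in_L: "p \<in> kpolys \<Longrightarrow> val_id p \<in> L"
  unfolding L_def using fracs_base[OF subring_val_kpolys] by blast

lemma mvar_kpolys: "j \<in> J \<Longrightarrow> mvar j \<in> kpolys"
  using sk by (auto simp: kpolys_def mvar_def lookup_single when_def subring_0 subring_1)

lemma mconst_kpolys: "c \<in> k \<Longrightarrow> mconst c \<in> kpolys"
  using sk by (auto simp: kpolys_def mconst_def lookup_single when_def subring_0)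

lemma \<chi>_L: "j \<in> J \<Longrightarrow> \<chi> j \<in> L"
  using val_in_L[OF mvar_kpolys] by (simp add: val_id_simps)

lemma k_L: "c \<in> k \<Longrightarrow> c \<in> L"
  using val_in_L[OF mconst_kpolys] by (simp add: val_id_simps)

lemma \<iota>_k: "\<iota> c \<in> k"
proof -
  have "ev (mconst c) / ev 1 \<in> form_fracs S"
    unfolding form_fracs_def using graded_mconst[of "{0}" c S] graded_1[of "{0}" S] by force
  then show ?thesis using form_fracs_k by (auto simp: ev_simps)
qed

lemma \<kappa>_L:
  assumes "deg_le p (\<lambda>i. if i \<in> J then b else 0)"
  shows "\<kappa> p \<in> L"
proof -
  have keys: "keys \<beta> \<subseteq> J" if "\<beta> \<in> keys p" for \<beta>
    using deg_le_keys_box[OF assms] that by (auto simp: box_def)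
  have "\<kappa> p = (\<Sum>\<beta>\<in>keys p. \<iota> (lookup p \<beta>) *
      (\<Prod>i\<in>keys \<beta>. \<chi> i ^ lookup \<beta> i))"
    by (rule trans[OF \<kappa>_eq_peval]) (simp add: peval_def monval_def)
  also have "\<dots> \<in> L" using keys \<chi>_L \<iota>_k k_L
    by (intro subring_sum[OF sL] subring_mult[OF sL] subring_prod[OF sL] subring_power[OF sL]) auto
  finally show ?thesis .
qed

lemma \<chi>_max: "j \<in> J \<Longrightarrow> \<chi> j \<in> max_ideal"
  using \<sigma>_pos \<sigma>_max by metis

lemma \<chi>_nz: "\<chi> j \<noteq> 0"
proof
  assume "\<chi> j = 0"
  then have "(mvar j :: 'k mpoly) = 0" using \<kappa>_inj by (simp add: \<chi>_def)
  then show False by (metis mvar_def lookup_single_eq lookup_zero zero_neq_one)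
qed

text \<open>Over the quotients of forms the \<open>\<chi> j\<close> generate the function field of a curve, whose Hilbert function
  is bounded here; counting monomials over \<open>'k\<close> avoids intersection theory.\<close>

lemma monomial_basis:
  obtains B where "B \<subseteq> box J (\<lambda>_. Suc M)"
    "\<And>\<gamma>. \<gamma> \<in> box J (\<lambda>_. Suc M) \<Longrightarrow> \<exists>t. (\<forall>\<beta>\<in>B. t \<beta> \<in> k) \<and> monval \<chi> \<gamma> = (\<Sum>\<beta>\<in>B. t \<beta> * monval \<chi> \<beta>)"
    "\<And>b. card B * Suc b ^ (m - 1) \<le> Suc (M + D * ((m - 1) * b)) ^ m"
proof -
  let ?K = "form_fracs S"
  let ?Bx = "box J (\<lambda>_. Suc M)"
  have finBx: "finite ?Bx" using J by (simp add: finite_box)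
  define indep where "indep B \<longleftrightarrow> B \<subseteq> ?Bx \<and> (\<forall>c. (\<forall>\<beta>\<in>B. c \<beta> \<in> ?K) \<longrightarrow> (\<Sum>\<beta>\<in>B. c \<beta> * monval \<chi> \<beta>) = 0 \<longrightarrow> (\<forall>\<beta>\<in>B. c \<beta> = 0))" for B
  have "indep {}" by (simp add: indep_def)
  moreover have "card B \<le> card ?Bx" if "indep B" for B
    using that finBx by (auto simp: indep_def intro: card_mono)
  ultimately have "\<exists>B. indep B \<and> (\<forall>B'. indep B' \<longrightarrow> card B' \<le> card B)"
    by (rule greatest_exists)
  then obtain B where B: "indep B" "\<And>B'. indep B' \<Longrightarrow> card B' \<le> card B" by blast
  have BBx: "B \<subseteq> ?Bx" using B(1) by (simp add: indep_def)
  have finB: "finite B" using BBx finBx by (rule finite_subset)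
  have span: "\<exists>t. (\<forall>\<beta>\<in>B. t \<beta> \<in> k) \<and> monval \<chi> \<gamma> = (\<Sum>\<beta>\<in>B. t \<beta> * monval \<chi> \<beta>)" if \<gamma>: "\<gamma> \<in> ?Bx" for \<gamma>
  proof (cases "\<gamma> \<in> B")
    case True
    then show ?thesis using finB sk
      by (intro exI[of _ "\<lambda>\<beta>. if \<beta> = \<gamma> then 1 else 0"]) (auto simp: subring_0 subring_1 if_distrib[of "\<lambda>x. x * _"] cong: if_cong)
  next
    case False
    then have "card (insert \<gamma> B) > card B" using finB by simp
    then have "\<not> indep (insert \<gamma> B)" using B(2) by (metis not_less)
    then obtain c where c: "\<forall>\<beta>\<in>insert \<gamma> B. c \<beta> \<in> ?K" "(\<Sum>\<beta>\<in>insert \<gamma> B. c \<beta> * monval \<chi> \<beta>) = 0"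
      "\<exists>\<beta>\<in>insert \<gamma> B. c \<beta> \<noteq> 0"
      using \<gamma> BBx by (auto simp: indep_def)
    have sum0: "c \<gamma> * monval \<chi> \<gamma> + (\<Sum>\<beta>\<in>B. c \<beta> * monval \<chi> \<beta>) = 0" using c(2) False finB by simp
    have c\<gamma>: "c \<gamma> \<noteq> 0"
    proof
      assume "c \<gamma> = 0"
      then have "\<forall>\<beta>\<in>B. c \<beta> = 0" using B(1) sum0 c(1) by (auto simp: indep_def)
      then show False using c(3) \<open>c \<gamma> = 0\<close> by auto
    qed
    have ck: "c \<beta> \<in> k" if "\<beta> \<in> insert \<gamma> B" for \<beta> using that c(1) form_fracs_k by blast
    have "monval \<chi> \<gamma> = - (\<Sum>\<beta>\<in>B. c \<beta> * monval \<chi> \<beta>) / c \<gamma>"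
      using sum0 c\<gamma> by (simp add: field_simps eq_neg_iff_add_eq_0)
    also have "\<dots> = (\<Sum>\<beta>\<in>B. (- c \<beta> / c \<gamma>) * monval \<chi> \<beta>)"
      by (simp add: sum_divide_distrib sum_negf)
    finally show ?thesis using ck
      by (intro exI[of _ "\<lambda>\<beta>. - c \<beta> / c \<gamma>"]) (auto intro!: subfield_divide[OF k(1)] subring_minus[OF sk])
  qed
  have "card B * Suc b ^ (m - 1) \<le> Suc (M + D * ((m - 1) * b)) ^ m" for b
  proof (rule ccontr)
    assume "\<not> ?thesis"
    then have less: "Suc (M + D * ((m - 1) * b)) ^ m < card B * Suc b ^ (m - 1)" by simp
    have "S \<noteq> {}" using S(2) m_pos by auto
    then obtain i1 where i1: "i1 \<in> S" by blast
    have finS: "finite S" using S(1) finite_subset by blast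
    \<comment> \<open>One index of S is set apart to fill up degrees: exponents of at most b at the
      other m - 1 places are completed to total degree n = (m - 1) b.\<close>
    define T where "T = S - {i1}"
    have T: "finite T" "card T = m - 1" "T \<subseteq> S" "i1 \<notin> T" using finS S i1 by (auto simp: T_def)
    define n where "n = (m - 1) * b"
    let ?A = "box T (\<lambda>_. Suc b)"
    define \<alpha> where "\<alpha> a = a + single i1 (n - mdeg a)" for a
    have mdeg_a: "mdeg a \<le> n" if "a \<in> ?A" for a
    proof -
      have "mdeg a = (\<Sum>i\<in>T. lookup a i)" using that T by (intro mdeg_superset) (auto simp: box_def)
      also have "\<dots> \<le> (\<Sum>i\<in>T. b)" using that by (intro sum_mono) (auto simp: box_def less_Suc_eq_le)
      finally show ?thesis using T by (simp add: n_def)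
    qed
    have \<alpha>: "mdeg (\<alpha> a) = n" "keys (\<alpha> a) \<subseteq> S" if "a \<in> ?A" for a
      using that mdeg_a[OF that] T i1 by (auto simp: \<alpha>_def mdeg_add keys_add_nat box_def split: if_splits)
    have \<alpha>_inj: "inj_on \<alpha> ?A"
    proof (rule inj_onI)
      fix a a' assume *: "a \<in> ?A" "a' \<in> ?A" "\<alpha> a = \<alpha> a'"
      show "a = a'"
      proof (rule poly_mapping_eqI)
        fix i
        show "lookup a i = lookup a' i"
        proof (cases "i = i1")
          case True
          then have "i \<notin> keys a" "i \<notin> keys a'" using * T by (auto simp: box_def)
          then show ?thesis by (simp add: in_keys_iff)
        next
          case False
          then show ?thesis using arg_cong[OF *(3), of "\<lambda>p. lookup p i"]
            by (simp add: \<alpha>_def lookup_add lookup_single)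
        qed
      qed
    qed
    have finA: "finite ?A" using T by (simp add: finite_box)
    \<comment> \<open>Products of a basis monomial in the \<chi> and a monomial of degree n in the
      \<sigma> of S, multiplied by Q^n. They are polynomials of degree at most M + D n in each
      coordinate, so too many of them are dependent over the base field.\<close>
    define G where "G = (\<lambda>(\<beta>, a). single \<beta> 1 * monval P (\<alpha> a))"
    let ?Eq = "box J (\<lambda>_. Suc (M + D * n))"
    have degG: "deg_le (G (\<beta>, a)) (\<lambda>i. if i \<in> J then M + D * n else 0)" if "\<beta> \<in> B" "a \<in> ?A" for \<beta> a
    proof -
      have "deg_le (monval P (\<alpha> a)) (\<lambda>i. \<Sum>j\<in>keys (\<alpha> a). lookup (\<alpha> a) j * (if i \<in> J then D else 0))"
        unfolding monval_def using \<alpha>(2)[OF that(2)] S(1)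
        by (intro deg_le_prod deg_le_power degP) auto
      moreover have "(\<Sum>j\<in>keys (\<alpha> a). lookup (\<alpha> a) j * (if i \<in> J then D else 0)) = (if i \<in> J then D * n else 0)" for i
        using \<alpha>(1)[OF that(2)] by (simp add: mdeg_def mult.commute flip: sum_distrib_left)
      ultimately have 1: "deg_le (monval P (\<alpha> a)) (\<lambda>i. if i \<in> J then D * n else 0)" by simp
      have 2: "deg_le (single \<beta> 1) (\<lambda>i. if i \<in> J then M else 0)"
        using that(1) BBx by (intro deg_le_single box_lookup_le) blast
      show ?thesis unfolding G_def using deg_le_mult[OF 2 1] by (auto elim: deg_le_mono)
    qed
    have "card ?Eq < card (B \<times> ?A)"
      using less J T by (simp add: card_box card_cartesian_product n_def)
    then obtain c where c: "\<exists>i\<in>B \<times> ?A. c i \<noteq> 0" "(\<Sum>i\<in>B \<times> ?A. mconst (c i) * G i) = 0"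
    proof (rule mpoly_dependence[rotated 2])
      fix i assume "i \<in> B \<times> ?A"
      then show "keys (G i) \<subseteq> ?Eq" using deg_le_keys_box[OF degG, of "fst i" "snd i"] by auto
    qed (use finB finA J in \<open>auto simp: finite_box\<close>)
    have \<kappa>0: "\<kappa> (\<Sum>i\<in>B \<times> ?A. mconst (c i) * G i) = 0" by (simp only: c(2) ring_map_0[OF \<kappa>])
    \<comment> \<open>Collected by basis elements, the dependence has forms of degree n as
      coefficients. Division by the fixed form \<open>Fr\<close> of the same degree moves them into
      \<open>form_fracs S\<close>, over which B is independent.\<close>
    define Hf where "Hf \<beta> = (\<Sum>a\<in>?A. single (\<alpha> a) (c (\<beta>, a)))" for \<beta>
    define Fr where "Fr = single (single i1 n) (1::'k)"
    have Fr: "Fr \<in> form S n" "Fr \<noteq> 0"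
    proof -
      have "lookup Fr (single i1 n) \<noteq> 0" by (simp add: Fr_def)
      then show "Fr \<noteq> 0" by auto
      show "Fr \<in> form S n" unfolding Fr_def using i1 by (intro graded_single) auto
    qed
    have Hf: "Hf \<beta> \<in> form S n" for \<beta> unfolding Hf_def using \<alpha> by (intro graded_sum graded_single) auto
    have "0 = \<kappa> (\<Sum>i\<in>B \<times> ?A. mconst (c i) * G i)" by (rule \<kappa>0[symmetric])
    also have "\<dots> = (\<Sum>\<beta>\<in>B. \<Sum>a\<in>?A. \<iota> (c (\<beta>, a)) * (monval \<chi> \<beta> * (monval \<sigma> (\<alpha> a) * \<kappa> Q ^ n)))"
      unfolding ring_map_sum[OF \<kappa>] sum.cartesian_product
      using \<alpha>(1) by (intro sum.cong refl)
        (auto simp: G_def ring_map_mult[OF \<kappa>] \<kappa>_monval \<kappa>_single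
          ring_map_1[OF ring_map_\<iota>] simp flip: \<iota>_def)
    also have "\<dots> = (\<Sum>\<beta>\<in>B. ev (Hf \<beta>) / ev Fr * monval \<chi> \<beta>) * (\<kappa> Q ^ n * ev Fr)"
      using form_nz[OF Fr] unfolding Hf_def peval_sum[OF ring_map_\<iota>] peval_single[OF ring_map_\<iota>] sum_distrib_right
      by (intro sum.cong refl) (simp add: sum_divide_distrib sum_distrib_right sum_distrib_left mult_ac)
    finally have "(\<Sum>\<beta>\<in>B. ev (Hf \<beta>) / ev Fr * monval \<chi> \<beta>) = 0" using form_nz[OF Fr] \<kappa>Q by simp
    moreover have "ev (Hf \<beta>) / ev Fr \<in> ?K" for \<beta> unfolding form_fracs_def using Hf Fr by blast
    ultimately have "ev (Hf \<beta>) / ev Fr = 0" if "\<beta> \<in> B" for \<beta>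
      using conjunct2[OF B(1)[unfolded indep_def], rule_format, of "\<lambda>\<beta>. ev (Hf \<beta>) / ev Fr" \<beta>] that by blast
    then have Hf0: "Hf \<beta> = 0" if "\<beta> \<in> B" for \<beta>
      using that form_nz[OF Fr] form_nz[OF Hf, of \<beta>] by auto
    have "c (\<beta>, a) = 0" if "\<beta> \<in> B" "a \<in> ?A" for \<beta> a
    proof -
      have "lookup (Hf \<beta>) (\<alpha> a) = (\<Sum>a'\<in>?A. if a' = a then c (\<beta>, a) else 0)"
        unfolding Hf_def lookup_sum lookup_single when_def
        using \<alpha>_inj that(2) by (intro sum.cong) (auto dest: inj_onD)
      also have "\<dots> = c (\<beta>, a)" using that finA by simp
      finally show ?thesis using Hf0[OF that(1)] by simp
    qed
    then show False using c(1) by auto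
  qed
  then show ?thesis using that BBx span by blast
qed

section \<open>Ramification of the coordinates and a uniformizer\<close>

lemma kpolys_bound:
  "finite A \<Longrightarrow> A \<subseteq> kpolys \<Longrightarrow> \<exists>b. \<forall>p\<in>A. deg_le p (\<lambda>i. if i \<in> J then b else 0)"
proof (induction A rule: finite_induct)
  case (insert p A)
  then obtain b where b: "\<forall>p\<in>A. deg_le p (\<lambda>i. if i \<in> J then b else 0)" by auto
  define b' where "b' = b + (\<Sum>\<alpha>\<in>keys p. mdeg \<alpha>)"
  have "deg_le p (\<lambda>i. if i \<in> J then b' else 0)"
    unfolding deg_le_def
  proof (intro ballI allI)
    fix \<alpha> i assume \<alpha>: "\<alpha> \<in> keys p"
    have "lookup \<alpha> i \<le> mdeg \<alpha>" by (rule lookup_le_mdeg)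
    also have "\<dots> \<le> (\<Sum>\<alpha>\<in>keys p. mdeg \<alpha>)" using \<alpha> by (intro member_le_sum) auto
    finally have "lookup \<alpha> i \<le> b'" by (simp add: b'_def)
    moreover have "lookup \<alpha> i = 0" if "i \<notin> J"
    proof -
      have "keys \<alpha> \<subseteq> J" using insert.prems \<alpha> unfolding kpolys_def by blast
      then show ?thesis using that by (auto simp: in_keys_iff)
    qed
    ultimately show "lookup \<alpha> i \<le> (if i \<in> J then b' else 0)" by auto
  qed
  moreover have "\<forall>p\<in>A. deg_le p (\<lambda>i. if i \<in> J then b' else 0)"
    using b by (auto simp: b'_def elim!: deg_le_mono)
  ultimately show ?case by auto
qed simp

text \<open>Since \<chi> j has at least p times the value of w, the products of w^i with i < p and
  powers of \<chi> j have distinct values, and so are independent over k. Their number is limited by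
  the basis from \<open>monomial_basis\<close>.\<close>

lemma ramification_bound:
  assumes w: "w \<in> L" "w \<in> max_ideal" "w \<noteq> 0" and j: "j \<in> J" and p: "p \<ge> 1" "\<chi> j / w ^ p \<in> V"
  shows "p \<le> m ^ m * D ^ (m - 1)"
proof -
  define z where "z = \<chi> j"
  have z: "z \<in> max_ideal" "z \<noteq> 0" using \<chi>_max[OF j] \<chi>_nz by (auto simp: z_def)
  obtain pa pb where ab: "w = val_id pa / val_id pb" "pa \<in> kpolys" "pb \<in> kpolys" "val_id pb \<noteq> 0"
    using w(1) by (auto simp: L_def fracs_def)
  \<comment> \<open>The power p - 1 of the denominator of w clears the denominators of w^0, ...,
    w^(p - 1) at once; its degree enters only the constant C, which disappears in the limit.\<close>
  define q0 where "q0 i = pa ^ i * pb ^ (p - 1 - i)" for i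
  have q0: "q0 i \<in> kpolys" for i
    unfolding q0_def using ab by (intro subring_mult[OF subring_kpolys] subring_power[OF subring_kpolys])
  obtain C where C: "\<forall>q\<in>q0 ` {..<p}. deg_le q (\<lambda>i. if i \<in> J then C else 0)"
    using kpolys_bound[of "q0 ` {..<p}"] q0 by auto
  have "p * (D * b + 1) * (b + 1) ^ (m - 1) \<le> (C + 1 + D * m * b) ^ m" for b
  proof -
    \<comment> \<open>The balanced choice: x b^(m - 1) / (x + D (m - 1) b)^m is largest at x = D
      b.\<close>
    define A where "A = D * b"
    define M where "M = C + A"
    obtain B where B: "B \<subseteq> box J (\<lambda>_. Suc M)"
      and span: "\<And>\<gamma>. \<gamma> \<in> box J (\<lambda>_. Suc M) \<Longrightarrow> \<exists>t. (\<forall>\<beta>\<in>B. t \<beta> \<in> k) \<and> monval \<chi> \<gamma> = (\<Sum>\<beta>\<in>B. t \<beta> * monval \<chi> \<beta>)"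
      and cardB: "\<And>b. card B * Suc b ^ (m - 1) \<le> Suc (M + D * ((m - 1) * b)) ^ m"
      using monomial_basis by blast
    obtain t where t: "\<And>\<gamma> \<beta>. \<gamma> \<in> box J (\<lambda>_. Suc M) \<Longrightarrow> \<beta> \<in> B \<Longrightarrow> t \<gamma> \<beta> \<in> k"
      "\<And>\<gamma>. \<gamma> \<in> box J (\<lambda>_. Suc M) \<Longrightarrow> monval \<chi> \<gamma> = (\<Sum>\<beta>\<in>B. t \<gamma> \<beta> * monval \<chi> \<beta>)"
      using span by metis
    have finBx: "finite (box J (\<lambda>_. Suc M))" using J by (simp add: finite_box)
    then have finB: "finite B" using B finite_subset by blast
    \<comment> \<open>The index e encodes the exponents e mod p of w and e div p of \<chi> j; in
      this order the values strictly increase.\<close>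
    define q where "q e = q0 (e mod p) * mvar j ^ (e div p)" for e
    let ?I = "{..<p * Suc A}"
    have q: "q e \<in> kpolys" "deg_le (q e) (\<lambda>i. if i \<in> J then M else 0)" if "e \<in> ?I" for e
    proof -
      have e: "e mod p < p" "e div p \<le> A"
        using that p by (auto simp: less_mult_imp_div_less mult.commute less_Suc_eq_le[symmetric])
      show "q e \<in> kpolys" unfolding q_def using q0 mvar_kpolys[OF j]
        by (intro subring_mult[OF subring_kpolys] subring_power[OF subring_kpolys])
      have 1: "deg_le (q0 (e mod p)) (\<lambda>i. if i \<in> J then C else 0)" using C e by auto
      have 2: "deg_le (mvar j ^ (e div p) :: 'w mpoly) (\<lambda>i. if i \<in> J then A else 0)"
        unfolding mvar_power using e j by (intro deg_le_single) (auto simp: lookup_single when_def)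
      show "deg_le (q e) (\<lambda>i. if i \<in> J then M else 0)"
        unfolding q_def using deg_le_mult[OF 1 2] by (rule deg_le_mono) (auto simp: M_def)
    qed
    define coef where "coef e \<beta> = (\<Sum>\<gamma>\<in>box J (\<lambda>_. Suc M). lookup (q e) \<gamma> * t \<gamma> \<beta>)" for e \<beta>
    have val_q: "val_id (q e) = (\<Sum>\<beta>\<in>B. coef e \<beta> * monval \<chi> \<beta>)" if "e \<in> ?I" for e
    proof -
      have "val_id (q e) = (\<Sum>\<gamma>\<in>box J (\<lambda>_. Suc M). lookup (q e) \<gamma> * monval \<chi> \<gamma>)"
        using finBx deg_le_keys_box[OF q(2)[OF that]] by (rule peval_superset[OF ring_map_ident])
      also have "\<dots> = (\<Sum>\<gamma>\<in>box J (\<lambda>_. Suc M). \<Sum>\<beta>\<in>B. lookup (q e) \<gamma> * t \<gamma> \<beta> * monval \<chi> \<beta>)"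
        using t(2) by (intro sum.cong) (auto simp: sum_distrib_left mult.assoc)
      also have "\<dots> = (\<Sum>\<beta>\<in>B. coef e \<beta> * monval \<chi> \<beta>)"
        unfolding coef_def sum_distrib_right by (rule sum.swap)
      finally show ?thesis .
    qed
    have "p * Suc A \<le> card B"
    proof (rule ccontr)
      assume "\<not> ?thesis"
      then have "card B < card ?I" by simp
      moreover have "coef e \<beta> \<in> k" if "e \<in> ?I" "\<beta> \<in> B" for e \<beta>
        unfolding coef_def using q(1)[OF that(1)] t(1) that(2)
        by (intro subring_sum[OF sk] subring_mult[OF sk]) (auto simp: kpolys_def)
      ultimately obtain c where c: "\<forall>e\<in>?I. c e \<in> k" "\<exists>e\<in>?I. c e \<noteq> 0"
        "\<forall>\<beta>\<in>B. (\<Sum>e\<in>?I. c e * coef e \<beta>) = 0"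
        using homogeneous_system[of B ?I k coef] finB sk by auto
      define y where "y e = w ^ (e mod p) * z ^ (e div p)" for e
      have val_qy: "val_id (q e) = val_id pb ^ (p - 1) * y e" if "e \<in> ?I" for e
      proof -
        have "e mod p < p" using p by simp
        then have "(p - 1 - e mod p) + e mod p = p - 1" by linarith
        then have "val_id pb ^ (p - 1) = val_id pb ^ (p - 1 - e mod p) * val_id pb ^ (e mod p)" by (simp only: power_add[symmetric])
        then show ?thesis
          using ab by (simp add: q_def q0_def y_def z_def val_id_simps power_divide)
      qed
      have "val_id pb ^ (p - 1) * (\<Sum>e\<in>?I. c e * y e) = (\<Sum>e\<in>?I. c e * val_id (q e))"
        unfolding sum_distrib_left using val_qy by (intro sum.cong) auto
      also have "\<dots> = (\<Sum>e\<in>?I. \<Sum>\<beta>\<in>B. c e * coef e \<beta> * monval \<chi> \<beta>)"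
        using val_q by (intro sum.cong) (auto simp: sum_distrib_left mult.assoc)
      also have "\<dots> = (\<Sum>\<beta>\<in>B. (\<Sum>e\<in>?I. c e * coef e \<beta>) * monval \<chi> \<beta>)"
        unfolding sum_distrib_right by (rule sum.swap)
      also have "\<dots> = 0" using c(3) by simp
      finally have sum0: "(\<Sum>e\<in>?I. c e * y e) = 0" using ab(4) by simp
      \<comment> \<open>All later terms are smaller than the first one with nonzero coefficient.
        Divided by y e0, the relation would place this coefficient, a unit, in the maximal
        ideal.\<close>
      define e0 where "e0 = (LEAST e. e \<in> ?I \<and> c e \<noteq> 0)"
      have e0: "e0 \<in> ?I" "c e0 \<noteq> 0" and least: "\<And>e. e \<in> ?I \<Longrightarrow> e < e0 \<Longrightarrow> c e = 0"
        using LeastI_ex[of "\<lambda>e. e \<in> ?I \<and> c e \<noteq> 0"] c(2) not_less_Least[of _ "\<lambda>e. e \<in> ?I \<and> c e \<noteq> 0"]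
        unfolding e0_def by blast+
      have y_nz: "y e \<noteq> 0" for e using w z by (simp add: y_def)
      have ratio: "y e / y e0 \<in> max_ideal" if "e > e0" for e
      proof (cases "e div p = e0 div p")
        case True
        then have lt: "e mod p > e0 mod p"
          using that by (metis div_mult_mod_eq nat_add_left_cancel_less)
        have "y e / y e0 = w ^ (e mod p - e0 mod p)"
          using True lt w z by (simp add: y_def power_diff)
        then show ?thesis using lt w by (simp add: max_ideal_power)
      next
        case False
        then have lt: "e div p > e0 div p" using that div_le_mono[of e0 e p] by simp
        define d where "d = e div p - e0 div p - 1"
        have d: "e div p = e0 div p + Suc d" using lt by (simp add: d_def)
        have i0: "e0 mod p < p" using p by simp
        have "w ^ p = w ^ (p - e0 mod p) * w ^ (e0 mod p)" using i0 by (simp flip: power_add)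
        then have 1: "y e / y e0 = w ^ (p - e0 mod p) * (w ^ (e mod p) * z ^ d * (z / w ^ p))"
          using w z by (simp add: y_def d power_add field_simps)
        have 2: "w ^ (e mod p) * z ^ d * (z / w ^ p) \<in> V"
          using w(2) z(1) p(2) max_ideal_subset unfolding z_def
          by (intro subring_mult[OF subring] subring_power[OF subring]) auto
        have 3: "w ^ (p - e0 mod p) \<in> max_ideal" using i0 w by (intro max_ideal_power) auto
        show ?thesis unfolding 1 by (rule max_ideal_mult[OF 3 2])
      qed
      have "0 = (\<Sum>e\<in>?I. c e * (y e / y e0))" using sum0 by (simp add: sum_divide_distrib[symmetric])
      also have "\<dots> = c e0 + (\<Sum>e\<in>?I - {e0}. c e * (y e / y e0))"
        using e0 y_nz by (subst sum.remove[of _ e0]) auto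
      finally have "c e0 = - (\<Sum>e\<in>?I - {e0}. c e * (y e / y e0))" by (simp add: eq_neg_iff_add_eq_0)
      moreover have "(\<Sum>e\<in>?I - {e0}. c e * (y e / y e0)) \<in> max_ideal"
      proof (rule max_ideal_sum)
        fix e assume e: "e \<in> ?I - {e0}"
        show "c e * (y e / y e0) \<in> max_ideal"
        proof (cases "e < e0")
          case True
          then show ?thesis using least e by (simp add: max_ideal_0)
        next
          case False
          then have "e > e0" using e by auto
          then have "(y e / y e0) * c e \<in> max_ideal"
            using c(1) k(2) e by (intro max_ideal_mult ratio) auto
          then show ?thesis by (simp add: mult.commute)
        qed
      qed
      ultimately have "c e0 \<in> max_ideal" by (simp add: max_ideal_minus)
      then show False using subfield_notin_max_ideal[OF k _ e0(2)] c(1) e0(1) by blast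
    qed
    then have "p * Suc A * Suc b ^ (m - 1) \<le> card B * Suc b ^ (m - 1)" by (rule mult_right_mono) simp
    also have "\<dots> \<le> Suc (M + D * ((m - 1) * b)) ^ m" by (rule cardB)
    also have "Suc (M + D * ((m - 1) * b)) = C + 1 + D * m * b"
    proof -
      obtain l where "m = Suc l" using m_pos by (cases m) auto
      then show ?thesis by (simp add: M_def A_def algebra_simps)
    qed
    finally show ?thesis by (simp add: A_def)
  qed
  then show ?thesis using m_pos D1 by (rule growth_bound)
qed

text \<open>\<open>ramification_bound\<close> allows to choose s with the largest power dividing one
  fixed coordinate. If some x in L had smaller positive value than s, then x or s / x would admit a
  larger power.\<close>

theorem uniformizer_exists:
  obtains s where "s \<in> L" "s \<in> max_ideal" "s \<noteq> 0"
    "\<And>x. x \<in> L \<Longrightarrow> x \<in> max_ideal \<Longrightarrow> x / s \<in> V"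
    "\<And>j. j \<in> J \<Longrightarrow> s ^ (m ^ m * D ^ (m - 1)) / \<chi> j \<in> V"
proof -
  let ?\<delta> = "m ^ m * D ^ (m - 1)"
  obtain j0 where j0: "j0 \<in> J" using J by blast
  define good where "good e \<longleftrightarrow> e \<ge> 1 \<and> (\<exists>w\<in>L. w \<in> max_ideal \<and> w \<noteq> 0 \<and> \<chi> j0 / w ^ e \<in> V)" for e
  have "good 1" unfolding good_def
    using \<chi>_L[OF j0] \<chi>_max[OF j0] \<chi>_nz subring_1[OF subring] by (intro conjI bexI[of _ "\<chi> j0"]) auto
  moreover have "e \<le> ?\<delta>" if "good e" for e using that ramification_bound[OF _ _ _ j0] unfolding good_def by blast
  ultimately have "\<exists>e. good e \<and> (\<forall>e'. good e' \<longrightarrow> e' \<le> e)"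
    by (rule greatest_exists)
  then obtain e where e: "good e" "\<And>e'. good e' \<Longrightarrow> e' \<le> e" by blast
  then obtain s where s: "s \<in> L" "s \<in> max_ideal" "s \<noteq> 0" "\<chi> j0 / s ^ e \<in> V" and e1: "e \<ge> 1"
    unfolding good_def by blast
  have no_better: "\<chi> j0 / w ^ Suc e \<notin> V" if "w \<in> L" "w \<in> max_ideal" "w \<noteq> 0" for w
    using e(2)[of "Suc e"] that unfolding good_def by auto
  have sV: "s \<in> V" using s max_ideal_subset by blast
  have min: "x / s \<in> V" if x: "x \<in> L" "x \<in> max_ideal" for x
  proof (rule ccontr)
    assume xs: "x / s \<notin> V"
    then have x0: "x \<noteq> 0" using subring_0[OF subring] by auto
    define t where "t = s / x"
    have t: "t \<in> max_ideal" "t \<in> L" "t \<noteq> 0"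
      using inverse_in_max_ideal[OF xs] subfield_divide[OF subfield_L s(1) x(1)] s x0 by (auto simp: t_def)
    have "inverse (\<chi> j0 / x ^ Suc e) \<in> V" using no_better[OF x x0] total by blast
    then have "x ^ Suc e / \<chi> j0 \<in> V" by simp
    \<comment> \<open>In terms of values, \<chi> j0 has at most e + 1 times that of x and at least e
      times that of s, so \<chi> j0 / t^(e + 1) has at least e - 1 times the value of s. Here e
      \<ge> 1 is used.\<close>
    then have "x ^ Suc e / \<chi> j0 * (\<chi> j0 / s ^ e) * s ^ (e - 1) * (\<chi> j0 / s ^ e) \<in> V"
      using s sV by (intro subring_mult[OF subring] subring_power[OF subring])
    moreover have "s ^ e = s ^ (e - 1) * s" using e1 power_minus_mult[of e s] by simp
    then have "x ^ Suc e / \<chi> j0 * (\<chi> j0 / s ^ e) * s ^ (e - 1) * (\<chi> j0 / s ^ e) = \<chi> j0 / t ^ Suc e"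
      using s x0 \<chi>_nz[of j0] by (simp add: t_def field_simps)
    ultimately show False using no_better[OF t(2,1,3)] by simp
  qed
  have "s ^ ?\<delta> / \<chi> j \<in> V" if j: "j \<in> J" for j
  proof -
    define P' where "P' e \<longleftrightarrow> \<chi> j / s ^ e \<in> V" for e
    have "P' 0" using max_ideal_subset[OF \<chi>_max[OF j]] by (simp add: P'_def)
    moreover have "e \<le> ?\<delta>" if "P' e" for e
      using ramification_bound[OF s(1-3) j, of e] that unfolding P'_def by (cases "e = 0") auto
    ultimately have "\<exists>e'. P' e' \<and> (\<forall>e''. P' e'' \<longrightarrow> e'' \<le> e')"
      by (rule greatest_exists)
    then obtain e' where e': "P' e'" "\<And>e''. P' e'' \<Longrightarrow> e'' \<le> e'" by blast
    have e'\<delta>: "e' \<le> ?\<delta>" using ramification_bound[OF s(1-3) j, of e'] e'(1) unfolding P'_def by (cases "e' = 0") auto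
    define y where "y = \<chi> j / s ^ e'"
    have y: "y \<in> V" "y \<in> L"
      using e'(1) \<chi>_L[OF j] s by (auto simp: y_def P'_def intro!: subfield_divide[OF subfield_L] subring_power[OF sL])
    \<comment> \<open>Otherwise one more factor s could be split off. So \<chi> j is s^e' times a
      unit of V, with e' within the ramification bound.\<close>
    have "y \<notin> max_ideal"
    proof
      assume "y \<in> max_ideal"
      then have "y / s \<in> V" using min y by blast
      then have "P' (Suc e')" using s by (simp add: P'_def y_def mult.commute)
      then show False using e'(2) by fastforce
    qed
    then have "inverse y \<in> V" using unit_inverse y by blast
    then have "s ^ (?\<delta> - e') * inverse y \<in> V" using sV by (intro subring_mult[OF subring] subring_power[OF subring])
    moreover have "s ^ (?\<delta> - e') * s ^ e' = s ^ ?\<delta>" using e'\<delta> by (simp flip: power_add)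
    then have "s ^ (?\<delta> - e') * inverse y = s ^ ?\<delta> / \<chi> j"
      by (simp add: y_def field_simps)
    ultimately show ?thesis by simp
  qed
  then show ?thesis using that s min by blast
qed

text \<open>Each digit is the residue of the current quotient, lifted to k. The difference stays in
  L, where divisibility by s is known, so the step can be repeated; finitely many digits are enough
  and V need not be complete.\<close>

lemma expansion:
  assumes s: "s \<in> L" "s \<in> max_ideal" "s \<noteq> 0" "\<And>x. x \<in> L \<Longrightarrow> x \<in> max_ideal \<Longrightarrow> x / s \<in> V"
    and x: "x \<in> L" "x \<in> V"
  shows "\<exists>c. (\<forall>l. c l \<in> k) \<and> (\<exists>y\<in>V. x = (\<Sum>l<n. c l * s ^ l) + s ^ n * y)"
proof -
  have "\<exists>c. (\<forall>l. c l \<in> k) \<and> (\<exists>y\<in>V. y \<in> L \<and> x = (\<Sum>l<n. c l * s ^ l) + s ^ n * y)"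
  proof (induction n)
    case 0
    then show ?case using x subring_0[OF sk] by (intro exI[of _ "\<lambda>_. 0"]) auto
  next
    case (Suc n)
    then obtain c y where c: "\<forall>l. c l \<in> k" "y \<in> V" "y \<in> L" "x = (\<Sum>l<n. c l * s ^ l) + s ^ n * y" by blast
    obtain c' where c': "c' \<in> k" "y - c' \<in> max_ideal" using residue[OF c(2)] by blast
    define y' where "y' = (y - c') / s"
    have "y - c' \<in> L" using c c' k_L by (intro subring_diff[OF sL]) auto
    then have y': "y' \<in> V" "y' \<in> L" using s c' by (auto simp: y'_def intro: subfield_divide[OF subfield_L])
    have "y = c' + s * y'" using s by (simp add: y'_def)
    then have "x = (\<Sum>l<Suc n. (c(n := c')) l * s ^ l) + s ^ Suc n * y'"
      by (simp add: c(4) algebra_simps)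
    moreover have "\<forall>l. (c(n := c')) l \<in> k" using c c' by simp
    ultimately show ?case using y' by blast
  qed
  then show ?thesis by blast
qed

end

section \<open>Choice of local coordinates\<close>

text \<open>The coordinate \<open>x\<close> is \<open>y - a\<close> at a finite point and \<open>1 / y\<close> at a pole, where \<open>y ^ b\<close> becomes
  \<open>x ^ (D1 - b)\<close> over the common denominator \<open>x ^ D1\<close>.\<close>

locale local_coordinates =
  fixes J Pole :: "nat set" and a :: "nat \<Rightarrow> 'k::field" and D1 :: nat
  assumes finJ: "finite J" and Pole: "Pole \<subseteq> J"
begin

definition factor :: "nat \<Rightarrow> nat \<Rightarrow> 'k mpoly" where
  "factor j b = (if j \<in> Pole then mvar j ^ (D1 - b) else (mvar j + mconst (a j)) ^ b)"

definition numerator :: "'k mpoly \<Rightarrow> 'k mpoly" where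
  "numerator p = (\<Sum>\<beta>\<in>keys p.
     mconst (lookup p \<beta>) * (\<Prod>j\<in>J. factor j (lookup \<beta> j)))"

definition denominator :: "'k mpoly" where
  "denominator = (\<Prod>j\<in>Pole. mvar j ^ D1)"

lemma finPole: "finite Pole" using Pole finJ finite_subset by blast

lemma deg_denominator: "deg_le denominator (\<lambda>k. if k \<in> J then D1 else 0)"
proof -
  have "deg_le denominator (\<lambda>i. \<Sum>j\<in>Pole. if i = j then D1 else 0)"
    unfolding denominator_def mvar_power
    by (intro deg_le_prod deg_le_single) (simp add: lookup_single when_def)
  moreover have "(\<Sum>j\<in>Pole. if i = j then D1 else 0) \<le> (if i \<in> J then D1 else 0)" for i
    using Pole finPole by auto
  ultimately show ?thesis by (rule deg_le_mono)
qed

lemma deg_numerator: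
  assumes p: "deg_le p (\<lambda>k. if k \<in> J then D1 else 0)"
  shows "deg_le (numerator p) (\<lambda>k. if k \<in> J then D1 else 0)"
  unfolding numerator_def
proof (rule deg_le_sum)
  fix \<beta> assume \<beta>: "\<beta> \<in> keys p"
  have le: "lookup \<beta> j \<le> D1" for j
    using p \<beta> by (auto simp: deg_le_def split: if_splits dest!: bspec[of _ _ \<beta>] spec[of _ j])
  have fac: "deg_le (factor j (lookup \<beta> j)) (\<lambda>i. if i = j then D1 else 0)" for j
  proof (cases "j \<in> Pole")
    case True
    then show ?thesis unfolding factor_def mvar_power
      by (auto intro!: deg_le_single simp: lookup_single when_def)
  next
    case False
    have "deg_le (mvar j + mconst (a j)) (\<lambda>i. if i = j then 1 else 0)"
      by (intro deg_le_add deg_le_mvar deg_le_mconst) simp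
    then have "deg_le ((mvar j + mconst (a j)) ^ lookup \<beta> j)
        (\<lambda>i. lookup \<beta> j * (if i = j then 1 else 0))" by (rule deg_le_power)
    then show ?thesis unfolding factor_def using False le[of j] by (auto elim!: deg_le_mono)
  qed
  have "deg_le (\<Prod>j\<in>J. factor j (lookup \<beta> j)) (\<lambda>i. \<Sum>j\<in>J. if i = j then D1 else 0)"
    by (intro deg_le_prod fac)
  then have "deg_le (mconst (lookup p \<beta>) * (\<Prod>j\<in>J. factor j (lookup \<beta> j)))
      (\<lambda>i. 0 + (\<Sum>j\<in>J. if i = j then D1 else 0))" by (intro deg_le_mult deg_le_mconst)
  then show "deg_le (mconst (lookup p \<beta>) * (\<Prod>j\<in>J. factor j (lookup \<beta> j)))
      (\<lambda>i. if i \<in> J then D1 else 0)" by (rule deg_le_mono) (use finJ in auto)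
qed

lemma peval_denominator: "ring_map h \<Longrightarrow> peval h x denominator = (\<Prod>j\<in>Pole. x j ^ D1)"
  by (simp add: denominator_def peval_prod peval_power)

text \<open>The identity is needed twice, for Laurent series along the given arc and for the new
  parameters at the place, hence the general ring.\<close>

lemma peval_numerator:
  assumes h: "ring_map h" and p: "deg_le p (\<lambda>k. if k \<in> J then D1 else 0)"
    and y: "\<And>j. j \<in> J \<Longrightarrow> j \<notin> Pole \<Longrightarrow> y j = x j + h (a j)" "\<And>j. j \<in> Pole \<Longrightarrow> x j * y j = 1"
  shows "peval h x (numerator p) = peval h x denominator * peval h y p"
proof -
  have "peval h x (\<Prod>j\<in>J. factor j (lookup \<beta> j)) = (\<Prod>j\<in>Pole. x j ^ D1) * monval y \<beta>"
    if \<beta>: "\<beta> \<in> keys p" for \<beta>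
  proof -
    have le: "lookup \<beta> j \<le> (if j \<in> J then D1 else 0)" for j
      using p \<beta> unfolding deg_le_def by blast
    have keys: "keys \<beta> \<subseteq> J"
    proof
      fix j assume "j \<in> keys \<beta>"
      then show "j \<in> J" using le[of j] by (auto simp: in_keys_iff split: if_splits)
    qed
    have "peval h x (factor j (lookup \<beta> j)) =
        (if j \<in> Pole then x j ^ D1 else 1) * y j ^ lookup \<beta> j" if j: "j \<in> J" for j
    proof (cases "j \<in> Pole")
      case True
      let ?b = "lookup \<beta> j"
      have "x j ^ D1 = x j ^ (D1 - ?b) * x j ^ ?b" using le[of j] j by (simp flip: power_add)
      then have "x j ^ D1 * y j ^ ?b = x j ^ (D1 - ?b) * (x j * y j) ^ ?b" by (simp add: power_mult_distrib mult.assoc)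
      then show ?thesis using True y(2) by (simp add: factor_def peval_power[OF h] peval_mvar[OF h])
    next
      case False
      then show ?thesis using y(1)[OF j]
        by (simp add: factor_def peval_power[OF h] peval_add[OF h] peval_mvar[OF h] peval_mconst[OF h])
    qed
    then have "peval h x (\<Prod>j\<in>J. factor j (lookup \<beta> j)) =
        (\<Prod>j\<in>J. (if j \<in> Pole then x j ^ D1 else 1)) * (\<Prod>j\<in>J. y j ^ lookup \<beta> j)"
      by (simp add: peval_prod[OF h] prod.distrib)
    also have "(\<Prod>j\<in>J. (if j \<in> Pole then x j ^ D1 else 1)) = (\<Prod>j\<in>Pole. x j ^ D1)"
      using finJ Pole by (intro prod.mono_neutral_cong_right) auto
    also have "(\<Prod>j\<in>J. y j ^ lookup \<beta> j) = monval y \<beta>"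
      using monval_superset[OF finJ keys, of y] by simp
    finally show ?thesis .
  qed
  then have "peval h x (numerator p) =
      (\<Sum>\<beta>\<in>keys p. h (lookup p \<beta>) * ((\<Prod>j\<in>Pole. x j ^ D1) * monval y \<beta>))"
    unfolding numerator_def peval_sum[OF h] peval_mult[OF h] peval_mconst[OF h] by (intro sum.cong) auto
  then show ?thesis
    by (simp add: peval_denominator[OF h] peval_def[of h y] sum_distrib_left mult_ac)
qed

end


section \<open>Approximation with bounded pole orders\<close>

lemma normal_consts:
  assumes "normal_slp J P" "I \<in> set P" "c \<in> set_instr I"
  shows "c = 0 \<or> c = 1 \<or> (\<exists>j\<in>J. c = j + 2)"
proof -
  obtain i where i: "i < length P" "I = P ! i" using assms(2) by (metis in_set_conv_nth)
  then obtain a b where "I \<in> {Add a b, Sub a b, Mul a b}"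
    "if i \<in> J then a = Const (i + 2) \<and> plain_operand b \<or> plain_operand a \<and> b = Const (i + 2)
      else plain_operand a \<and> plain_operand b"
    using assms(1) unfolding normal_slp_def normal_instr_def by blast
  then show ?thesis using assms(3) by (auto simp: plain_operand_def split: if_splits)
qed

lemma params_vals_rel:
  assumes R: "ring_rel R" and P: "normal_slp J P" "wf_slp n P" and y: "\<And>j. j \<in> J \<Longrightarrow> R (y j) (y' j)"
    and l: "l < length P"
  shows "mpoly_rel R (slp_vals (params y) P ! l) (slp_vals (params y') P ! l)"
proof (rule slp_vals_rel[OF R P(2) _ l])
  fix I c assume "I \<in> set P" "c \<in> set_instr I"
  then consider "c = 0" | "c = 1" | j where "j \<in> J" "c = j + 2" using normal_consts[OF P(1)] by blast
  then show "R (params y c) (params y' c)"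
    using y ring_rel_0[OF R] ring_rel_1[OF R] by cases simp_all
qed

lemma set_scaled_operand: "Inr c \<in> set_operand (scaled_operand a) \<Longrightarrow> c \<in> set_operand a"
  by (cases a) auto

lemma scaled_consts:
  assumes "I \<in> set (scaled_slp e P)" "Inr c \<in> set_instr I"
  shows "c = 0 \<or> (\<exists>I\<in>set P. c \<in> set_instr I)"
proof -
  obtain l where l: "l < 2 * length P" "I = scaled_slp e P ! l"
    using assms(1) by (metis in_set_conv_nth length_scaled_slp)
  define i where "i = l div 2"
  have i: "i < length P" using l by (simp add: i_def)
  consider "l = 2 * i" | "l = Suc (2 * i)" unfolding i_def by linarith
  then have "c = 0 \<or> c \<in> set_instr (P ! i)"
  proof cases
    case 1
    then show ?thesis using assms(2) l scaled_slp_nth(1)[OF i]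
      by (cases "P ! i") (auto split: if_splits dest: set_scaled_operand)
  next
    case 2
    then show ?thesis using assms(2) l scaled_slp_nth(2)[OF i]
      by (cases "P ! i") (auto split: if_splits dest: set_scaled_operand)
  qed
  then show ?thesis using i by auto
qed

lemma scaled_vals_rel:
  assumes R: "ring_rel R" and P: "normal_slp J P" "wf_slp n P" and s: "R s s'"
    and u: "\<And>j. j \<in> J \<Longrightarrow> R (u j) (u' j)" and l: "l < length P"
  shows "mpoly_rel R (slp_vals (scaled_params s u) (scaled_slp e P) ! Suc (2 * l))
    (slp_vals (scaled_params s' u') (scaled_slp e P) ! Suc (2 * l))"
proof (rule slp_vals_rel[OF R wf_scaled_slp[OF P(2)]])
  fix I c assume *: "I \<in> set (scaled_slp e P)" "c \<in> set_instr I"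
  show "R (scaled_params s u c) (scaled_params s' u' c)"
  proof (cases c)
    case (Inl k)
    then show ?thesis using ring_rel_power[OF R s] by (simp add: scaled_params_def)
  next
    case (Inr d)
    then have "d = 0 \<or> d = 1 \<or> (\<exists>j\<in>J. d = j + 2)"
      using scaled_consts[of I e P d] * normal_consts[OF P(1)] by blast
    then show ?thesis using Inr u ring_rel_0[OF R] ring_rel_1[OF R] by (auto simp: scaled_params_def)
  qed
qed (use l in simp)

lemma scaled_slp_vals':
  assumes P: "normal_slp J P" "wf_slp n P" and l: "l < length P"
    and u: "\<And>j. j \<in> J \<Longrightarrow> u j = s ^ e * y j"
  shows "slp_vals (scaled_params s u) (scaled_slp e P) ! Suc (2 * l) =
    mconst (s ^ weight e P l) * slp_vals (params y) P ! l"
proof (rule scaled_slp_vals[OF P(2) l])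
  fix i assume "i + 2 \<in> \<Union>(set_instr ` set P)"
  then have "i \<in> J" using normal_consts[OF P(1), of _ "i + 2"] by auto
  then show "u i = s ^ e * y i" by (rule u)
qed

lemma generic_val:
  assumes h: "ring_map h" and P: "normal_slp J P" "wf_slp n P" and l: "l < length P"
  shows "lookup (slp_vals (params y) P ! l) \<mu> =
    peval h y (lookup (slp_vals (params mvar) P ! l) \<mu>)"
  using params_vals_rel[OF ring_map_peval[OF h, unfolded ring_map_def] P _ l, where y = mvar and y' = y]
  by (simp add: mpoly_rel_def peval_mvar[OF h])

lemma fls_not_fps:
  fixes z :: "'k::field fls"
  assumes "\<nexists>g. z = fps_to_fls g"
  obtains g where "inverse z = fps_to_fls g" "fps_nth g 0 = 0" "z \<noteq> 0"
proof -
  have "fls_subdegree z < 0"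
  proof (rule ccontr)
    assume "\<not> ?thesis"
    then have "z = fps_to_fls (fls_regpart z)" by (intro fls_eqI) (auto simp: fls_eq0_below_subdegree)
    then show False using assms by blast
  qed
  moreover have z: "z \<noteq> 0" using assms fps_zero_to_fls by metis
  ultimately have sub: "fls_subdegree (inverse z) > 0" by (simp add: fls_inverse_subdegree)
  then have "inverse z = fps_to_fls (fls_regpart (inverse z))"
    by (intro fls_eqI) (auto simp: fls_eq0_below_subdegree)
  moreover have "fps_nth (fls_regpart (inverse z)) 0 = 0" using sub by (simp add: fls_eq0_below_subdegree)
  ultimately show ?thesis using that z by blast
qed

lemma ring_map_fps_const: "ring_map (fps_const :: 'k::field \<Rightarrow> _)"
  by (rule ring_mapI) simp_all

lemma ring_map_fps_to_fls: "ring_map (fps_to_fls :: 'k::field fps \<Rightarrow> _)"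
  by (rule ring_mapI) (simp_all add: fls_times_fps_to_fls)

lemma ring_map_fls_const: "ring_map (fls_const :: 'k::field \<Rightarrow> _)"
  using ring_map_comp[OF ring_map_fps_to_fls ring_map_fps_const] by simp

text \<open>Digits with respect to s are unique: nonzero elements of k are units, so the lowest
  coefficient must vanish and a factor s can be cancelled.\<close>

lemma (in valuation_ring) poly_coeffs_eq_0:
  assumes k: "subfield_set k" "k \<subseteq> V" and s: "s \<in> max_ideal" "s \<noteq> 0"
  shows "p \<in> polyset k \<Longrightarrow> v \<in> V \<Longrightarrow> poly p s = s ^ Suc q * v \<Longrightarrow> l \<le> q \<Longrightarrow> coeff p l = 0"
proof (induction q arbitrary: p l)
  case (0 p l)
  obtain c p' where p: "p = pCons c p'" by (cases p)
  have cp: "c \<in> k" "p' \<in> polyset k" using 0(1) by (auto simp: p polyset_pCons[OF subfield_subring[OF k(1)]])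
  have "poly p' s \<in> V" using cp k s max_ideal_subset
    by (intro poly_in_subring[OF subring]) (auto simp: polyset_def)
  then have "s * (v - poly p' s) \<in> max_ideal" using s 0 by (intro max_ideal_mult subring_diff[OF subring])
  moreover have "c = s * (v - poly p' s)" using 0(3) by (simp add: p algebra_simps)
  ultimately have "c = 0" using subfield_notin_max_ideal[OF k cp(1)] by blast
  then show ?case using 0 by (simp add: p)
next
  case (Suc q p l)
  obtain c p' where p: "p = pCons c p'" by (cases p)
  have cp: "c \<in> k" "p' \<in> polyset k" using Suc.prems(1) by (auto simp: p polyset_pCons[OF subfield_subring[OF k(1)]])
  have sV: "s \<in> V" using s max_ideal_subset by blast
  have "poly p' s \<in> V" using cp k sV
    by (intro poly_in_subring[OF subring]) (auto simp: polyset_def)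
  then have "s * (s ^ Suc q * v - poly p' s) \<in> max_ideal"
    using s sV Suc.prems(2) by (intro max_ideal_mult subring_diff[OF subring] subring_mult[OF subring] subring_power[OF subring])
  moreover have c: "c = s * (s ^ Suc q * v - poly p' s)" using Suc.prems(3) by (simp add: p algebra_simps)
  ultimately have "c = 0" using subfield_notin_max_ideal[OF k cp(1)] by metis
  then have "poly p' s = s ^ Suc q * v" using c s by simp
  then show ?case using Suc.IH[OF cp(2) Suc.prems(2)] \<open>c = 0\<close> Suc.prems(4) by (cases l) (auto simp: p)
qed

text \<open>The series \<open>u\<close> are the parameters already multiplied by \<epsilon>^e. Up to
  order q, the weight of the output, the scaled program computes \<epsilon>^q f.\<close>

definition bounded_approx :: "nat \<Rightarrow> nat slp \<Rightarrow> nat \<Rightarrow> 'k::field mpoly \<Rightarrow> bool" where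
  "bounded_approx e P l f \<longleftrightarrow> (\<exists>u. \<forall>\<mu> i. i \<le> weight e P l \<longrightarrow>
     fps_nth (lookup (slp_vals (scaled_params fps_X u) (scaled_slp e P) ! Suc (2 * l)) \<mu>) i =
       (if i = weight e P l then lookup f \<mu> else 0))"

lemma bounded_approx_regular:
  fixes c :: "nat \<Rightarrow> 'k::field fls"
  assumes P: "normal_slp J P" "wf_slp n P" and l: "l < length P"
    and c: "\<And>j. j \<in> J \<Longrightarrow> \<exists>g. c j = fps_to_fls g"
    and f: "\<And>\<mu>. \<exists>g. lookup (slp_vals (params c) P ! l) \<mu> = fps_to_fls g \<and>
      fps_nth g 0 = lookup f \<mu>"
  shows "bounded_approx 0 P l f"
proof -
  obtain u where u: "\<And>j. j \<in> J \<Longrightarrow> c j = fps_to_fls (u j)" using c by metis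
  let ?T = "\<lambda>s u. slp_vals (scaled_params s u) (scaled_slp 0 P) ! Suc (2 * l)"
  let ?q = "weight 0 P l"
  show ?thesis
    unfolding bounded_approx_def
  proof (intro exI[of _ u] allI impI)
    fix \<mu> i assume i: "i \<le> ?q"
    obtain g where g: "lookup (slp_vals (params c) P ! l) \<mu> = fps_to_fls g"
      "fps_nth g 0 = lookup f \<mu>" using f by blast
    have "mpoly_rel (\<lambda>a b. b = fps_to_fls a) (?T fps_X u) (?T fls_X c)"
      using u by (intro scaled_vals_rel[OF ring_map_fps_to_fls[unfolded ring_map_def] P _ _ l]) auto
    then have "fps_to_fls (lookup (?T fps_X u) \<mu>) = lookup (?T fls_X c) \<mu>"
      by (simp add: mpoly_rel_def)
    also have "?T fls_X c = mconst (fls_X ^ ?q) * slp_vals (params c) P ! l"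
      by (rule scaled_slp_vals'[OF P l]) simp
    also have "lookup \<dots> \<mu> = fps_to_fls (fps_X ^ ?q * g)"
      by (simp add: lookup_mconst_mult g fls_times_fps_to_fls fps_to_fls_power)
    finally have "lookup (?T fps_X u) \<mu> = fps_X ^ ?q * g" by simp
    then show "fps_nth (lookup (?T fps_X u) \<mu>) i = (if i = ?q then lookup f \<mu> else 0)"
      using i g(2) by (simp add: fps_X_power_mult_nth)
  qed
qed

theorem bounded_approx_pole:
  fixes c :: "nat \<Rightarrow> 'k::alg_closed_field fls" and f :: "'k mpoly"
  assumes P: "normal_slp J P" "wf_slp n P" and l: "l < length P"
    and pole: "j0 \<in> J" "\<nexists>g. c j0 = fps_to_fls g"
    and f: "\<And>\<mu>. \<exists>g. lookup (slp_vals (params c) P ! l) \<mu> = fps_to_fls g \<and>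
      fps_nth g 0 = lookup f \<mu>"
  shows "bounded_approx (card J ^ card J * (2 ^ (length P - card J) + 1) ^ (card J - 1)) P l f"
proof -

  \<comment> \<open>Generic coefficients and local coordinates along the given arc\<close>
  define Pole where "Pole = {j\<in>J. \<nexists>g. c j = fps_to_fls g}"
  have JP: "J \<subseteq> {..<length P}" using P(1) by (simp add: normal_slp_def)
  have finJ: "finite J" using JP finite_subset by blast
  define D1 :: nat where "D1 = 2 ^ (length P - card J)"
  define \<Phi> where "\<Phi> \<mu> = lookup (slp_vals (params (mvar :: nat \<Rightarrow> 'k mpoly)) P ! l) \<mu>" for \<mu>
  have \<Phi>_deg: "deg_le (\<Phi> \<mu>) (\<lambda>k. if k \<in> J then D1 else 0)" for \<mu>
  proof -
    have "card ({..l} - J) \<le> card ({..<length P} - J)" using l by (intro card_mono) auto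
    also have "\<dots> = length P - card J" using JP finJ by (simp add: card_Diff_subset)
    finally have "(2::nat) ^ card ({..l} - J) \<le> D1" unfolding D1_def by (intro power_increasing) auto
    moreover have "deg_le (\<Phi> \<mu>) (\<lambda>k. if k \<in> J \<and> k \<le> l then 2 ^ card ({..l} - J) else 0)"
      using params_degree[OF P l, where 'k = 'k] unfolding coeffs_deg_le_def \<Phi>_def by blast
    ultimately show ?thesis by (elim deg_le_mono) auto
  qed
  have "\<exists>xj aj. (j \<in> Pole \<longrightarrow> fps_to_fls xj * c j = 1) \<and> (j \<in> J \<and> j \<notin> Pole \<longrightarrow> c j = fps_to_fls xj + fls_const aj) \<and>
      fps_nth xj 0 = 0" for j
  proof -
    consider "j \<in> Pole" | "j \<in> J" "j \<notin> Pole" | "j \<notin> J" unfolding Pole_def by blast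
    then show ?thesis
    proof cases
      case 1
      then obtain g where "inverse (c j) = fps_to_fls g" "fps_nth g 0 = 0" "c j \<noteq> 0"
        using fls_not_fps[of "c j"] by (auto simp: Pole_def)
      then show ?thesis using 1 by (intro exI[of _ g]) (metis left_inverse)
    next
      case 2
      then obtain g where g: "c j = fps_to_fls g" by (auto simp: Pole_def)
      have "c j = fps_to_fls (g - fps_const (fps_nth g 0)) + fls_const (fps_nth g 0)" by (simp add: g)
      then show ?thesis using 2
        by (intro exI[of _ "g - fps_const (fps_nth g 0)"] exI[of _ "fps_nth g 0"]) simp
    next
      case 3
      then show ?thesis by (intro exI[of _ 0]) (auto simp: Pole_def)
    qed
  qed
  then obtain x a where x: "\<And>j. j \<in> Pole \<Longrightarrow> fps_to_fls (x j) * c j = 1"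
    "\<And>j. j \<in> J \<Longrightarrow> j \<notin> Pole \<Longrightarrow> c j = fps_to_fls (x j) + fls_const (a j)" "\<And>j. fps_nth (x j) 0 = 0"
    by metis
  interpret local_coordinates J Pole a D1
    by unfold_locales (use finJ in \<open>auto simp: Pole_def\<close>)
  define Q where "Q = denominator"
  define Nm where "Nm \<mu> = numerator (\<Phi> \<mu>) - mconst (lookup f \<mu>) * Q" for \<mu>
  obtain ms where ms: "set ms = keys (slp_vals (params (mvar :: nat \<Rightarrow> 'k mpoly)) P ! l) \<union> keys f"
    using finite_list[of "keys (slp_vals (params (mvar :: nat \<Rightarrow> 'k mpoly)) P ! l) \<union> keys f"] by auto
  obtain js where js: "set js = J" using finite_list[OF finJ] by blast
  \<comment> \<open>Besides the equations for the coefficients, each \<chi> j must itself be one of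
    the \<sigma>, so it is listed as a quotient with denominator Q. This raises the degree bound to
    D1 + 1.\<close>
  define Ps where "Ps = map Nm ms @ map (\<lambda>j. mvar j * Q) js"
  have Ps_cases: "(\<exists>\<mu>. Ps ! i = Nm \<mu>) \<or> (\<exists>j\<in>J. Ps ! i = mvar j * Q)" if "i < length Ps" for i
    using that js by (auto simp: Ps_def nth_append)
  define Qx where "Qx = peval fps_const x Q"
  have Qx: "Qx \<noteq> 0"
  proof -
    have "x j \<noteq> 0" if "j \<in> Pole" for j using x(1)[OF that] by auto
    then show ?thesis unfolding Qx_def Q_def peval_denominator[OF ring_map_fps_const] using finPole by auto
  qed
  \<comment> \<open>The order of the common denominator along the given arc. Positive order of all
    \<sigma> means order above V0 for the numerators, so only terms up to V0 matter.\<close>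
  define V0 where "V0 = subdegree Qx"
  have Nm_x: "\<exists>g. peval fps_const x (Nm \<mu>) = Qx * g \<and> fps_nth g 0 = 0" for \<mu>
  proof -
    obtain g where g: "lookup (slp_vals (params c) P ! l) \<mu> = fps_to_fls g"
      "fps_nth g 0 = lookup f \<mu>" using f by blast
    have \<Phi>c: "peval fls_const c (\<Phi> \<mu>) = fps_to_fls g"
      using generic_val[OF ring_map_fls_const P l, of c \<mu>] g by (simp add: \<Phi>_def)
    have hom: "fps_to_fls (peval fps_const x p) = peval fls_const (\<lambda>j. fps_to_fls (x j)) p" for p
      using peval_hom[OF ring_map_fps_const ring_map_fps_to_fls, of x p] by simp
    have "fps_to_fls (peval fps_const x (numerator (\<Phi> \<mu>))) = fps_to_fls Qx * fps_to_fls g"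
      unfolding hom Qx_def Q_def \<Phi>c[symmetric] using x(1,2)
      by (intro peval_numerator[OF ring_map_fls_const \<Phi>_deg]) auto
    then have "peval fps_const x (numerator (\<Phi> \<mu>)) = Qx * g"
      by (simp flip: fls_times_fps_to_fls)
    then have "peval fps_const x (Nm \<mu>) = Qx * (g - fps_const (lookup f \<mu>))"
      by (simp add: Nm_def peval_diff[OF ring_map_fps_const] peval_mult[OF ring_map_fps_const]
          peval_mconst[OF ring_map_fps_const] Qx_def algebra_simps)
    then show ?thesis using g(2) by (intro exI[of _ "g - fps_const (lookup f \<mu>)"]) simp
  qed
  have Ps_x: "fps_nth (peval fps_const x (Ps ! i)) t = 0" if i: "i < length Ps" and t: "t \<le> V0" for i t
  proof -
    have "\<exists>g. peval fps_const x (Ps ! i) = Qx * g \<and> fps_nth g 0 = 0"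
      using Ps_cases[OF i]
    proof (elim disjE exE bexE)
      fix j assume "Ps ! i = mvar j * Q"
      then have "peval fps_const x (Ps ! i) = Qx * x j"
        by (simp add: peval_mult[OF ring_map_fps_const] peval_mvar[OF ring_map_fps_const] Qx_def mult.commute)
      then show ?thesis using x(3) by blast
    qed (use Nm_x in simp)
    then obtain g where g: "peval fps_const x (Ps ! i) = Qx * g" "fps_nth g 0 = 0" by blast
    have "fps_nth Qx i' * fps_nth g (t - i') = 0" if "i' \<le> t" for i'
    proof (cases "i' < V0")
      case True
      then have "fps_nth Qx i' = 0" unfolding V0_def by (rule nth_less_subdegree_zero)
      then show ?thesis by simp
    next
      case False
      then have "t - i' = 0" using that t by linarith
      then show ?thesis using g(2) by (simp only: mult_zero_right)
    qed
    then show ?thesis unfolding g(1) fps_mult_nth by (intro sum.neutral) auto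
  qed
  \<comment> \<open>The given arc is truncated after order V0, which preserves the order of Q and
    the vanishing of the numerators up to V0. The free term of order V0 + 1 turns it into a family
    on which no nonzero polynomial vanishes identically.\<close>
  define \<xi> where "\<xi> j = (\<Sum>t\<le>V0. monom (mconst (fps_nth (x j) t)) t) + monom (mvar j :: 'k mpoly) (Suc V0)" for j
  let ?const = "\<lambda>c::'k. [:mconst c:]"
  have const: "ring_map ?const" by (rule ring_mapI) (simp_all add: mconst_simps one_pCons)
  have coeff_\<xi>: "coeff (\<xi> j) t = mconst (fps_nth (x j) t)" if "t \<le> V0" for j t
    using that by (simp add: \<xi>_def coeff_sum)
  define R where "R A B \<longleftrightarrow> (\<forall>t\<le>V0. coeff A t = mconst (fps_nth B t))" for A :: "'k mpoly poly" and B :: "'k fps"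
  have ringR: "ring_rel R"
    unfolding ring_rel_def R_def
    by (auto simp: mconst_simps coeff_mult fps_mult_nth ring_map_sum[OF ring_map_mconst] coeff_1
        atLeast0AtMost intro!: sum.cong)
  have arc: "coeff (peval ?const \<xi> p) t = mconst (fps_nth (peval fps_const x p) t)" if "t \<le> V0" for p t
  proof -
    have "R (peval ?const \<xi> p) (peval fps_const x p)"
      by (rule peval_rel[OF ringR const ring_map_fps_const])
        (auto simp: R_def coeff_\<xi> coeff_pCons mconst_simps split: nat.splits)
    then show ?thesis using that by (simp add: R_def)
  qed
  define Q' where "Q' = poly_shift V0 (peval ?const \<xi> Q)"
  have arc_Q: "peval ?const \<xi> Q = monom 1 V0 * Q'" "coeff Q' 0 \<noteq> 0"
  proof -
    have "coeff (peval ?const \<xi> Q) t = 0" if "t < V0" for t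
    proof -
      have "fps_nth Qx t = 0" using that unfolding V0_def by (rule nth_less_subdegree_zero)
      then show ?thesis using that arc[of t Q] by (simp add: Qx_def mconst_simps)
    qed
    then show "peval ?const \<xi> Q = monom 1 V0 * Q'"
    proof (intro poly_eqI)
      fix t
      show "coeff (peval ?const \<xi> Q) t = coeff (monom 1 V0 * Q') t"
        using \<open>\<And>t. t < V0 \<Longrightarrow> coeff (peval ?const \<xi> Q) t = 0\<close>[of t]
        by (cases "t < V0") (simp_all add: coeff_monom_mult Q'_def coeff_poly_shift)
    qed
    have "fps_nth Qx V0 \<noteq> 0" using Qx by (simp add: V0_def)
    then have "mconst (fps_nth Qx V0) \<noteq> 0" by (metis mconst_def lookup_single_eq lookup_zero)
    then show "coeff Q' 0 \<noteq> 0" using arc[of V0 Q] by (simp add: Q'_def coeff_poly_shift Qx_def)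
  qed
  \<comment> \<open>The coordinates become algebraically independent elements of an algebraically
    closed field, as \<open>coefficient_field_exists\<close> requires.\<close>
  define \<kappa> :: "'k mpoly \<Rightarrow> 'k mpoly fract alg_closure" where "\<kappa> p = to_ac (Fract p 1)" for p
  have \<kappa>: "ring_map \<kappa>"
    by (rule ring_mapI) (simp_all add: \<kappa>_def One_fract_def[symmetric] to_ac_mult[symmetric] to_ac_diff[symmetric] del: to_ac_mult to_ac_diff)
  have Q0: "Q \<noteq> 0" using Qx peval_0[OF ring_map_fps_const, of x] by (auto simp: Qx_def)
  have deg_Q: "deg_le Q (\<lambda>k. if k \<in> J then D1 else 0)" unfolding Q_def by (rule deg_denominator)
  interpret arc_family J "length Ps" "D1 + 1" "Suc V0" V0 "\<lambda>i. Ps ! i" Q Q' \<xi> \<kappa>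
  proof
    show "J \<noteq> {}" using pole by auto
    show "p = 0" if "\<kappa> p = 0" for p using that by (simp add: \<kappa>_def Zero_fract_def eq_fract)
    show "deg_le (Ps ! i) (\<lambda>k. if k \<in> J then D1 + 1 else 0)" if "i < length Ps" for i
      using Ps_cases[OF that]
    proof (elim disjE exE bexE)
      fix \<mu> assume "Ps ! i = Nm \<mu>"
      moreover have "deg_le (mconst (lookup f \<mu>) * Q) (\<lambda>i. 0 + (if i \<in> J then D1 else 0))"
        by (intro deg_le_mult deg_le_mconst deg_Q)
      then have "deg_le (Nm \<mu>) (\<lambda>k. if k \<in> J then D1 else 0)"
        unfolding Nm_def by (intro deg_le_diff deg_numerator \<Phi>_deg) simp
      ultimately show ?thesis by (auto elim!: deg_le_mono)
    next
      fix j assume j: "j \<in> J" "Ps ! i = mvar j * Q"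
      have "deg_le (mvar j * Q) (\<lambda>i. (if i = j then 1 else 0) + (if i \<in> J then D1 else 0))"
        by (intro deg_le_mult deg_Q deg_le_mvar) simp
      then show ?thesis unfolding j(2) using j(1) by (auto elim!: deg_le_mono)
    qed
    show "\<exists>i<length Ps. Ps ! i = mvar j * Q" if "j \<in> J" for j
    proof -
      have "mvar j * Q \<in> set Ps" using that js by (auto simp: Ps_def)
      then show ?thesis by (metis in_set_conv_nth)
    qed
    show "p = 0" if p: "peval ?const \<xi> p = 0" for p
    proof -
      \<comment> \<open>At arc parameter 1 the family is the translation of each variable X_j to X_j
        + b j, and translations are invertible.\<close>
      define b where "b j = (\<Sum>t\<le>V0. fps_nth (x j) t)" for j
      have at1: "ring_map (\<lambda>q::'k mpoly poly. poly q 1)" by (rule ring_mapI) simp_all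
      have \<xi>1: "poly (\<xi> j) 1 = mconst (b j) + mvar j" for j
        by (simp add: \<xi>_def b_def poly_sum poly_monom ring_map_sum[OF ring_map_mconst])
      have "0 = poly (peval ?const \<xi> p) 1" using p by simp
      also have "\<dots> = peval mconst (\<lambda>j. mconst (b j) + mvar j) p"
        using peval_hom[OF const at1, of \<xi> p] by (simp add: \<xi>1)
      finally have "0 = peval mconst (\<lambda>j. mvar j - mconst (b j)) (peval mconst (\<lambda>j. mconst (b j) + mvar j) p)"
        by (simp add: peval_0[OF ring_map_mconst])
      also have "\<dots> = peval mconst mvar p"
        using peval_hom[OF ring_map_mconst ring_map_peval[OF ring_map_mconst, of "\<lambda>j. mvar j - mconst (b j)"],
            of "\<lambda>j. mconst (b j) + mvar j" p]
        by (simp add: peval_mconst[OF ring_map_mconst] peval_mvar[OF ring_map_mconst] peval_add[OF ring_map_mconst])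
      finally show ?thesis by (simp add: peval_mvar_id)
    qed
    show "degree (\<xi> j) \<le> Suc V0" for j
      unfolding \<xi>_def
      by (intro degree_add_le degree_sum_le order_trans[OF degree_monom_le]) auto
    show "monom 1 (Suc V0) dvd peval ?const \<xi> (Ps ! i)" if "i < length Ps" for i
      unfolding monom_1_dvd_iff' using arc Ps_x[OF that] by (auto simp: less_Suc_eq_le mconst_simps)
  qed (use finJ \<kappa> Q0 arc_Q in auto)

  \<comment> \<open>The new parameters at a point of the curve\<close>
  obtain V k S where VkS: "valuation_ring V" "subfield_set k" "k \<subseteq> V"
    "\<And>x. x \<in> V \<Longrightarrow> \<exists>c\<in>k. x - c \<in> valuation_ring.max_ideal V"
    "\<And>i. i < length Ps \<Longrightarrow> \<sigma> i \<in> valuation_ring.max_ideal V"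
    "S \<subseteq> {..<length Ps}" "card S = card J" "\<And>n H. H \<in> form S n \<Longrightarrow> H \<noteq> 0 \<Longrightarrow> ev H \<noteq> 0" "form_fracs S \<subseteq> k"
    using place_exists by metis
  interpret valuation_ring V by (rule VkS(1))
  interpret placed_family J "length Ps" "D1 + 1" "Suc V0" V0 "\<lambda>i. Ps ! i" Q Q' \<xi> \<kappa> V k S
    by unfold_locales (use VkS in auto)
  define \<delta> where "\<delta> = card J ^ card J * (D1 + 1) ^ (card J - 1)"
  obtain s where s: "s \<in> L" "s \<in> max_ideal" "s \<noteq> 0"
    "\<And>x. x \<in> L \<Longrightarrow> x \<in> max_ideal \<Longrightarrow> x / s \<in> V" "\<And>j. j \<in> J \<Longrightarrow> s ^ \<delta> / \<chi> j \<in> V"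
    using uniformizer_exists unfolding \<delta>_def by blast
  have sV: "s \<in> V" using s max_ideal_subset by blast
  define y where "y j = (if j \<in> Pole then inverse (\<chi> j) else \<chi> j + \<iota> (a j))" for j
  \<comment> \<open>At a pole coordinate the parameter is 1 / \<chi> j, and s^\<delta> / \<chi> j
    lies in V. So this scaling clears every pole of the new parameters.\<close>
  define u where "u j = s ^ \<delta> * y j" for j
  have u: "u j \<in> L" "u j \<in> V" if j: "j \<in> J" for j
  proof -
    have "y j \<in> L" using \<chi>_L[OF j] k_L \<iota>_k sL
      by (auto simp: y_def intro: subfield_inverse[OF subfield_L] subring_add)
    then show "u j \<in> L" unfolding u_def using s sL by (intro subring_mult subring_power)
    show "u j \<in> V"
    proof (cases "j \<in> Pole")
      case True
      then show ?thesis using s(5)[OF j] by (simp add: u_def y_def field_class.field_divide_inverse)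
    next
      case False
      then show ?thesis using \<chi>_max[OF j] \<iota>_k k(2) sV max_ideal_subset
        by (auto simp: u_def y_def intro!: subring_mult[OF subring] subring_power[OF subring] subring_add[OF subring])
    qed
  qed
  define q where "q = weight \<delta> P l"
  let ?T = "\<lambda>s u. slp_vals (scaled_params s u) (scaled_slp \<delta> P) ! Suc (2 * l)"
  \<comment> \<open>At the place a coefficient of the program differs from that of f by some
    \<sigma> i. It lies in L and in the maximal ideal and is thus divisible by s; the scaling
    contributes the factor s^q.\<close>
  have T\<Omega>: "\<exists>v\<in>V. lookup (?T s u) \<mu> = s ^ q * \<iota> (lookup f \<mu>) + s ^ Suc q * v" for \<mu>
  proof -
    have "?T s u = mconst (s ^ q) * slp_vals (params y) P ! l"
      unfolding q_def by (rule scaled_slp_vals'[OF P l]) (simp add: u_def)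
    then have T: "lookup (?T s u) \<mu> = s ^ q * peval \<iota> y (\<Phi> \<mu>)"
      using generic_val[OF ring_map_\<iota> P l, of y \<mu>] by (simp add: lookup_mconst_mult \<Phi>_def)
    show ?thesis
    proof (cases "\<mu> \<in> set ms")
      case False
      then have "\<Phi> \<mu> = 0" "lookup f \<mu> = 0" using ms by (auto simp: \<Phi>_def in_keys_iff)
      then show ?thesis unfolding T using subring_0[OF subring] by (intro bexI[of _ 0]) (auto simp: ev_simps ring_map_0[OF ring_map_\<iota>])
    next
      case True
      then obtain i where i: "i < length ms" "ms ! i = \<mu>" by (metis in_set_conv_nth)
      have Psi: "i < length Ps" "Ps ! i = Nm \<mu>" using i by (auto simp: Ps_def nth_append)
      have \<kappa>num: "\<kappa> (numerator (\<Phi> \<mu>)) = \<kappa> Q * peval \<iota> y (\<Phi> \<mu>)"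
      proof -
        have "peval \<iota> \<chi> (numerator (\<Phi> \<mu>)) = peval \<iota> \<chi> denominator * peval \<iota> y (\<Phi> \<mu>)"
          using \<chi>_nz by (intro peval_numerator[OF ring_map_\<iota> \<Phi>_deg]) (auto simp: y_def)
        then show ?thesis by (simp only: \<kappa>_eq_peval[of "numerator (\<Phi> \<mu>)"] \<kappa>_eq_peval[of denominator] Q_def)
      qed
      have "\<sigma> i = (\<kappa> Q * peval \<iota> y (\<Phi> \<mu>) - \<iota> (lookup f \<mu>) * \<kappa> Q) / \<kappa> Q"
        unfolding \<sigma>_def Psi(2) Nm_def ring_map_diff[OF \<kappa>] ring_map_mult[OF \<kappa>] \<kappa>num \<iota>_def ..
      then have \<sigma>i: "\<sigma> i = peval \<iota> y (\<Phi> \<mu>) - \<iota> (lookup f \<mu>)"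
        using \<kappa>Q by (simp add: field_simps)
      have "\<sigma> i \<in> L"
        unfolding \<sigma>_def using \<kappa>_L[OF degP[OF Psi(1)]] \<kappa>_L[OF deg_Q] by (rule subfield_divide[OF subfield_L])
      then have "\<sigma> i / s \<in> V" using s(4) \<sigma>_max[OF Psi(1)] by blast
      moreover have "s ^ q * peval \<iota> y (\<Phi> \<mu>) = s ^ q * \<iota> (lookup f \<mu>) + s ^ Suc q * (\<sigma> i / s)"
        using s(3) by (simp add: \<sigma>i algebra_simps)
      ultimately show ?thesis unfolding T by blast
    qed
  qed
  have "\<exists>cj. (\<forall>t. cj t \<in> k) \<and> (j \<in> J \<longrightarrow> (\<exists>v\<in>V. u j = (\<Sum>t<Suc q. cj t * s ^ t) + s ^ Suc q * v))" for j
  proof (cases "j \<in> J")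
    case True
    then show ?thesis using expansion[OF s(1-4) u[OF True], of "Suc q"] by blast
  next
    case False
    then show ?thesis using subring_0[OF sk] by (intro exI[of _ "\<lambda>_. 0"]) blast
  qed
  then have "\<forall>j. \<exists>cj. (\<forall>t. cj t \<in> k) \<and> (j \<in> J \<longrightarrow> (\<exists>v\<in>V. u j = (\<Sum>t<Suc q. cj t * s ^ t) + s ^ Suc q * v))" ..
  from choice[OF this] obtain cf where
    cf_all: "\<forall>j. (\<forall>t. cf j t \<in> k) \<and> (j \<in> J \<longrightarrow> (\<exists>v\<in>V. u j = (\<Sum>t<Suc q. cf j t * s ^ t) + s ^ Suc q * v))" ..
  have cf: "\<And>j t. cf j t \<in> k"
    "\<And>j. j \<in> J \<Longrightarrow> \<exists>v\<in>V. u j = (\<Sum>t<Suc q. cf j t * s ^ t) + s ^ Suc q * v"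
    using cf_all by simp_all
  \<comment> \<open>Digits beyond order q cannot affect the result up to order q. The truncations
    leave finitely many elements of k to be specialized.\<close>
  define U where "U j = (\<Sum>t<Suc q. monom (cf j t) t)" for j
  define t1 :: "'k mpoly fract alg_closure poly" where "t1 = monom 1 1"
  \<comment> \<open>Congruence of b with p(s) modulo s^(q + 1) V; the indeterminate
    \<open>t1\<close> corresponds to s.\<close>
  define R1 where "R1 p b \<longleftrightarrow> p \<in> polyset k \<and> b \<in> V \<and> (\<exists>v\<in>V. b = poly p s + s ^ Suc q * v)" for p b
  have polyV: "poly p s \<in> V" if "p \<in> polyset k" for p
    using that k(2) sV by (intro poly_in_subring[OF subring]) (auto simp: polyset_def)
  have R1: "ring_rel R1"
    unfolding ring_rel_def
  proof (intro conjI allI impI)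
    note sp = subring_polyset[OF sk]
    show "R1 1 1" unfolding R1_def using subring_1[OF sp] subring_1[OF subring] subring_0[OF subring]
      by (intro conjI bexI[of _ 0]) auto
    fix p b p' b' assume "R1 p b" "R1 p' b'"
    then obtain v v' where *: "p \<in> polyset k" "p' \<in> polyset k" "b \<in> V" "b' \<in> V" "v \<in> V" "v' \<in> V"
      "b = poly p s + s ^ Suc q * v" "b' = poly p' s + s ^ Suc q * v'" unfolding R1_def by blast
    have "b - b' = poly (p - p') s + s ^ Suc q * (v - v')" unfolding *(7,8) by (simp add: algebra_simps)
    then show "R1 (p - p') (b - b')" unfolding R1_def using *
      by (intro conjI bexI[of _ "v - v'"] subring_diff[OF sp] subring_diff[OF subring])
    have "b * b' = poly (p * p') s + s ^ Suc q * (v * b' + poly p s * v')"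
      unfolding *(7,8) by (simp add: algebra_simps)
    moreover have "v * b' + poly p s * v' \<in> V" using * polyV
      by (intro subring_add[OF subring] subring_mult[OF subring])
    ultimately show "R1 (p * p') (b * b')" unfolding R1_def using *
      by (intro conjI bexI[of _ "v * b' + poly p s * v'"] subring_mult[OF sp] subring_mult[OF subring])
  qed
  have "mpoly_rel R1 (?T t1 U) (?T s u)"
  proof (rule scaled_vals_rel[OF R1 P _ _ l])
    show "R1 t1 s" unfolding R1_def t1_def using sV subring_0[OF subring] subring_1[OF sk]
      by (intro conjI polyset_monom[OF sk] bexI[of _ 0]) (auto simp: poly_monom)
    fix j assume j: "j \<in> J"
    have "U j \<in> polyset k" unfolding U_def
      using cf(1) by (intro subring_sum[OF subring_polyset[OF sk]] polyset_monom[OF sk])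
    moreover have "poly (U j) s = (\<Sum>t<Suc q. cf j t * s ^ t)" by (simp add: U_def poly_sum poly_monom)
    ultimately show "R1 (U j) (u j)" unfolding R1_def using cf(2)[OF j] u(2)[OF j] by simp
  qed
  then have rel: "R1 (lookup (?T t1 U) \<mu>) (lookup (?T s u) \<mu>)" for \<mu>
    by (simp add: mpoly_rel_def)
  \<comment> \<open>Uniqueness of digits turns the congruence at the place into an identity of
    polynomial coefficients, which mentions neither V nor s and can be specialized.\<close>
  have coeffs: "coeff (lookup (?T t1 U) \<mu>) i = (if i = q then \<iota> (lookup f \<mu>) else 0)"
    if i: "i \<le> q" for \<mu> i
  proof -
    let ?p = "lookup (?T t1 U) \<mu>"
    let ?p' = "?p - monom (\<iota> (lookup f \<mu>)) q"
    obtain v where v: "v \<in> V" "lookup (?T s u) \<mu> = s ^ q * \<iota> (lookup f \<mu>) + s ^ Suc q * v"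
      using T\<Omega> by blast
    obtain v' where v': "?p \<in> polyset k" "v' \<in> V" "lookup (?T s u) \<mu> = poly ?p s + s ^ Suc q * v'"
      using rel[of \<mu>] unfolding R1_def by blast
    have "poly ?p' s = s ^ Suc q * (v - v')" using v(2) v'(3) by (simp add: poly_monom algebra_simps)
    moreover have "?p' \<in> polyset k" using v'(1) \<iota>_k
      by (intro subring_diff[OF subring_polyset[OF sk]] polyset_monom[OF sk])
    moreover have "v - v' \<in> V" using v v' by (intro subring_diff[OF subring])
    ultimately have "coeff ?p' i = 0" using poly_coeffs_eq_0[OF k s(2,3)] i by blast
    then show ?thesis by (auto split: if_splits)
  qed
  \<comment> \<open>Since h is the identity on the base field, the coefficients of f survive while
    the finitely many digits of the parameters move to the base field.\<close>
  obtain A h where A: "subring_set A" "range \<iota> \<subseteq> A" "(\<lambda>(j, t). cf j t) ` (J \<times> {..q}) \<subseteq> A" "hom_on A h" "\<And>c. h (\<iota> c) = c"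
    using specialization_exists[OF ring_map_\<iota>, of "(\<lambda>(j, t). cf j t) ` (J \<times> {..q})"] finJ by auto
  define R2 where "R2 p g \<longleftrightarrow> (\<forall>i. coeff p i \<in> A \<and> fps_nth g i = h (coeff p i))" for p and g :: "'k fps"
  have R2: "ring_rel R2"
    unfolding ring_rel_def
  proof (intro conjI allI impI)
    show "R2 1 1" using subring_0[OF A(1)] subring_1[OF A(1)] hom_on_0[OF A(1,4)] hom_on_1[OF A(1,4)]
      by (simp add: R2_def coeff_1)
    fix p g p' g' assume "R2 p g" "R2 p' g'"
    then have *: "coeff p i \<in> A" "coeff p' i \<in> A" "fps_nth g i = h (coeff p i)" "fps_nth g' i = h (coeff p' i)" for i
      unfolding R2_def by auto
    show "R2 (p - p') (g - g')" unfolding R2_def using * by (auto intro: subring_diff[OF A(1)] simp: hom_on_diff[OF A(1,4)])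
    show "R2 (p * p') (g * g')" unfolding R2_def
      using * by (auto intro!: subring_sum[OF A(1)] subring_mult[OF A(1)] sum.cong
          simp: coeff_mult fps_mult_nth hom_on_sum[OF A(1,4)] hom_on_mult[OF A(1,4)] subring_mult[OF A(1)] atLeast0AtMost)
  qed
  define u' where "u' j = Abs_fps (\<lambda>i. h (coeff (U j) i))" for j
  have "mpoly_rel R2 (?T t1 U) (?T fps_X u')"
  proof (rule scaled_vals_rel[OF R2 P _ _ l])
    show "R2 t1 fps_X" unfolding R2_def t1_def
      using subring_0[OF A(1)] subring_1[OF A(1)] hom_on_0[OF A(1,4)] hom_on_1[OF A(1,4)] by (auto simp: fps_X_def)
    fix j assume j: "j \<in> J"
    have "cf j t \<in> A" if "t \<le> q" for t using A(3) j that by force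
    then have "coeff (U j) i \<in> A" for i
      using subring_0[OF A(1)] unfolding U_def coeff_sum by (intro subring_sum[OF A(1)]) (simp add: less_Suc_eq_le)
    then show "R2 (U j) (u' j)" by (simp add: R2_def u'_def)
  qed
  then have "fps_nth (lookup (?T fps_X u') \<mu>) i = h (coeff (lookup (?T t1 U) \<mu>) i)" for \<mu> i
    by (simp add: mpoly_rel_def R2_def)
  then have "fps_nth (lookup (?T fps_X u') \<mu>) i = (if i = q then lookup f \<mu> else 0)" if "i \<le> q" for \<mu> i
    using coeffs[OF that] A(5) hom_on_0[OF A(1,4)] by simp
  then show ?thesis unfolding bounded_approx_def q_def \<delta>_def D1_def by blast
qed

section \<open>From the scaled program to the complexities\<close>

lemma slp_results_mpolys:
  fixes P :: "'a::comm_ring_1 slp"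
  assumes wf: "wf_slp n P" and "j < length P"
  shows "slp_results P ! j \<in> mpolys n"
  using assms(2)
proof (induction j rule: less_induct)
  case (less j)
  have M: "(mpolys n :: 'a mpoly set) = graded {..<n} UNIV" by (auto simp: mpolys_def graded_def)
  have wfj: "wf_instr n j (P ! j)" using wf less.prems by (simp add: wf_slp_def)
  have op: "operand_val (slp_results P) a \<in> graded {..<n} UNIV" if "wf_operand n j a" for a
  proof (cases a)
    case (Var i)
    then show ?thesis using that by (auto simp: mvar_def intro!: graded_single split: if_splits)
  next
    case (Res i)
    then show ?thesis using that less.IH[of i] less.prems M by simp
  qed (simp add: graded_mconst)
  show ?case
    unfolding slp_results_nth[OF wf less.prems] M using wfj op
    by (cases "P ! j") (auto intro: graded_add graded_diff graded_mult)
qed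

lemma approx_complexity_order_le:
  assumes "bounded_approx e P l f" "wf_slp n P" "l < length P" "f \<in> mpolys n"
  shows "approx_complexity_order (weight e P l) n f \<le> 2 * length P"
proof -
  let ?q = "weight e P l"
  obtain u where u: "\<And>\<mu> i. i \<le> ?q \<Longrightarrow>
     fps_nth (lookup (slp_vals (scaled_params fps_X u) (scaled_slp e P) ! Suc (2 * l)) \<mu>) i =
       (if i = ?q then lookup f \<mu> else 0)" using assms(1) by (auto simp: bounded_approx_def)
  define T where "T = map (map_instr (scaled_params fps_X u)) (scaled_slp e P)"
  define G where "G = slp_results T ! Suc (2 * l)"
  have wfT: "wf_slp n T" unfolding T_def using wf_scaled_slp[OF assms(2)] by simp
  have lT: "Suc (2 * l) < length T" using assms(3) by (simp add: T_def)
  have G: "G \<in> mpolys n" unfolding G_def using slp_results_mpolys[OF wfT lT] .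
  have Gi: "fps_nth (lookup G \<mu>) i = (if i = ?q then lookup f \<mu> else 0)" if "i \<le> ?q" for \<mu> i
    using u[OF that] by (simp add: G_def T_def)
  let ?K = "keys G \<union> keys f"
  \<comment> \<open>Up to order q the result G is exactly \<epsilon>^q f, so shifting every
    coefficient by q + 1 collects all the rest.\<close>
  define f' where "f' = (\<Sum>\<mu>\<in>?K. single \<mu> (fps_shift (?q + 1) (lookup G \<mu>)))"
  have f': "f' \<in> mpolys n"
  proof -
    have "f' \<in> graded {..<n} UNIV" unfolding f'_def
      using G assms(4) by (intro graded_sum graded_single) (auto simp: mpolys_def)
    then show ?thesis by (auto simp: mpolys_def graded_def)
  qed
  have lf': "lookup f' \<mu> = fps_shift (?q + 1) (lookup G \<mu>)" for \<mu>
  proof -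
    have "lookup f' \<mu> = (\<Sum>\<nu>\<in>?K. if \<nu> = \<mu> then fps_shift (?q + 1) (lookup G \<mu>) else 0)"
      unfolding f'_def lookup_sum lookup_single when_def by (intro sum.cong) auto
    also have "\<dots> = fps_shift (?q + 1) (lookup G \<mu>)" by (auto simp: in_keys_iff)
    finally show ?thesis .
  qed
  have "mconst (fps_X ^ ?q) * Poly_Mapping.map fps_const f + mconst (fps_X ^ (?q + 1)) * f' = G"
  proof (rule poly_mapping_eqI)
    fix \<mu>
    have "lookup (Poly_Mapping.map fps_const f) \<mu> = fps_const (lookup f \<mu>)"
      by (simp add: Poly_Mapping.map.rep_eq when_def)
    then have "lookup (mconst (fps_X ^ ?q) * Poly_Mapping.map fps_const f + mconst (fps_X ^ (?q + 1)) * f') \<mu>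
        = fps_X ^ ?q * fps_const (lookup f \<mu>) + fps_X ^ (?q + 1) * fps_shift (?q + 1) (lookup G \<mu>)"
      by (simp only: lookup_add lookup_mconst_mult lf')
    also have "\<dots> = lookup G \<mu>"
    proof (rule fps_ext)
      fix i
      show "fps_nth (fps_X ^ ?q * fps_const (lookup f \<mu>) + fps_X ^ (?q + 1) * fps_shift (?q + 1) (lookup G \<mu>)) i
          = fps_nth (lookup G \<mu>) i"
        using Gi[of i \<mu>] by (cases i ?q rule: linorder_cases) (simp_all only: fps_add_nth fps_X_power_mult_nth, auto)
    qed
    finally show "lookup (mconst (fps_X ^ ?q) * Poly_Mapping.map fps_const f + mconst (fps_X ^ (?q + 1)) * f') \<mu> =
      lookup G \<mu>" .
  qed
  moreover have "computable_within n (2 * length P) G"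
    unfolding computable_within_def slp_computes_def
    using wfT lT by (intro exI[of _ T] conjI exI[of _ "Res (Suc (2 * l))"]) (auto simp: G_def T_def)
  ultimately show ?thesis
    unfolding approx_complexity_order_def using f' by (intro Least_le) metis
qed

lemma approx_complexity_order_0:
  assumes "computable_within n 0 (Poly_Mapping.map fps_const f)"
  shows "approx_complexity_order 0 n f = 0"
proof -
  have "approx_complexity_order 0 n f \<le> 0"
    unfolding approx_complexity_order_def
  proof (rule Least_le, rule bexI)
    show "(0 :: 'a fps mpoly) \<in> mpolys n" by (simp add: mpolys_def)
    show "computable_within n 0 (mconst (fps_X ^ 0) * Poly_Mapping.map fps_const f + mconst (fps_X ^ (0 + 1)) * 0)"
      using assms by (simp add: mconst_simps)
  qed
  then show ?thesis by simp
qed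

text \<open>The minimum is over a nonempty set: f itself, with its coefficients read as constants of
  k(\<epsilon>), is an admissible F.\<close>

lemma approx_complexity_attained:
  fixes f :: "'k::field mpoly"
  assumes f: "f \<in> mpolys n"
  obtains F where "F \<in> mpolys n" "\<And>\<mu>. lookup F \<mu> \<in> regular_at_0"
    "Poly_Mapping.map at_eps_0 F = f" "computable_within n (approx_complexity n f) F"
proof -
  define F where "F = Poly_Mapping.map (\<lambda>c. Fract [:c:] (1 :: 'k poly)) f"
  have lF: "lookup F \<mu> = Fract [:lookup f \<mu>:] 1" for \<mu>
    by (simp add: F_def Poly_Mapping.map.rep_eq when_def Zero_fract_def)
  have "keys F \<subseteq> keys f" by (auto simp: in_keys_iff F_def Poly_Mapping.map.rep_eq when_def)
  then have "F \<in> mpolys n" using f by (auto simp: mpolys_def)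
  moreover from this obtain r where "computable_within n r F" using computable_mpolys by blast
  moreover have "lookup F \<mu> \<in> regular_at_0" for \<mu>
    unfolding lF regular_at_0_def by (intro CollectI exI[of _ "[:lookup f \<mu>:]"] exI[of _ 1]) simp
  moreover have "Poly_Mapping.map at_eps_0 F = f"
    by (rule poly_mapping_eqI) (simp add: Poly_Mapping.map.rep_eq when_def lF at_eps_0_Fract Zero_fract_def eq_fract)
  ultimately have "\<exists>r. \<exists>F\<in>mpolys n. (\<forall>\<mu>. lookup F \<mu> \<in> regular_at_0) \<and>
     Poly_Mapping.map at_eps_0 F = f \<and> computable_within n r F" by blast
  from LeastI_ex[OF this] show ?thesis using that unfolding approx_complexity_def by blast
qed

theorem theorem5p7:
  fixes f :: "'k::alg_closed_field mpoly" and n :: nat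
  assumes "f \<in> mpolys n"
  shows "\<exists>q::nat. q \<le> 2 ^ ((approx_complexity n f)\<^sup>2) \<and>
           approx_complexity_order q n f \<le> 2 * approx_complexity n f"
proof -
  let ?r = "approx_complexity n f"
  obtain F where F: "F \<in> mpolys n" "\<And>\<mu>. lookup F \<mu> \<in> regular_at_0"
    "Poly_Mapping.map at_eps_0 F = f" "computable_within n ?r F"
    using approx_complexity_attained[OF assms] by blast
  have lf: "lookup f \<mu> = at_eps_0 (lookup F \<mu>)" for \<mu>
    using F(3) by (auto simp: Poly_Mapping.map.rep_eq when_def)
  obtain P0 out where P0: "length P0 \<le> ?r" "wf_slp n P0" "wf_operand n (length P0) out"
    "operand_val (slp_results P0) out = F"
    using F(4) by (auto simp: computable_within_def slp_computes_def)
  \<comment> \<open>This handles an output operand that is a constant or a variable and not the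
    result of an instruction: f then costs nothing, and q = 0 serves.\<close>
  have trivial: ?thesis if "computable_within n 0 (Poly_Mapping.map fps_const f)"
    using approx_complexity_order_0[OF that] by (intro exI[of _ 0]) simp
  show ?thesis
  proof (cases out)
    case (Const c)
    then have "Poly_Mapping.map fps_const f = mconst (fps_const (at_eps_0 c))"
      using F(3) P0(4) by (intro poly_mapping_eqI)
        (auto simp: Poly_Mapping.map.rep_eq when_def mconst_def lookup_single split: if_splits)
    then show ?thesis using trivial computable_mconst by metis
  next
    case (Var i)
    have "at_eps_0 (1 :: 'k poly fract) = 1" using at_eps_0_Fract[of 1 1] by (simp add: One_fract_def)
    then have "Poly_Mapping.map fps_const f = mvar i"
      using F(3) P0(4) Var by (intro poly_mapping_eqI)
        (auto simp: Poly_Mapping.map.rep_eq when_def mvar_def lookup_single split: if_splits)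
    then show ?thesis using trivial computable_mvar[of i n] P0(3) Var by simp
  next
    case (Res l)
    then have l: "l < length P0" using P0(3) by simp
    obtain P J y where P: "normal_slp J P" "wf_slp n P" "length P = length P0"
      "slp_vals (params y) P = slp_results P0"
      using slp_normalize[OF P0(2)] by metis
    have lP: "l < length P" using l P(3) by simp
    define c where "c j = fls_of_fract (y j)" for j
    have reg: "\<exists>g. lookup (slp_vals (params c) P ! l) \<mu> = fps_to_fls g \<and>
      fps_nth g 0 = lookup f \<mu>" for \<mu>
    proof -
      have "mpoly_rel (\<lambda>a b. b = fls_of_fract a) (slp_vals (params y) P ! l) (slp_vals (params c) P ! l)"
        by (rule params_vals_rel[OF ring_map_fls_of_fract[unfolded ring_map_def] P(1,2) _ lP]) (simp add: c_def)
      then have "lookup (slp_vals (params c) P ! l) \<mu> = fls_of_fract (lookup F \<mu>)"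
        using P0(4) Res by (simp add: mpoly_rel_def P(4))
      then show ?thesis using regular_at_0_fls[OF F(2)[of \<mu>]] lf by metis
    qed
    have JP: "J \<subseteq> {..<length P}" using P(1) by (simp add: normal_slp_def)
    have finJ: "finite J" using JP finite_subset by blast
    \<comment> \<open>Without poles e = 0 suffices, also if no parameter occurs at all. A pole
      forces m \<ge> 1, as \<open>order_estimate\<close> demands.\<close>
    obtain e where e: "bounded_approx e P l f" "weight e P l \<le> 2 ^ ((length P)\<^sup>2)"
    proof (cases "\<forall>j\<in>J. \<exists>g. c j = fps_to_fls g")
      case True
      then have "bounded_approx 0 P l f" using reg bounded_approx_regular[OF P(1,2) lP, of c f] by blast
      moreover have "weight 0 P l \<le> 2 ^ ((length P)\<^sup>2)" using weight_le[OF P(1,2) lP, of 0] by simp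
      ultimately show ?thesis by (rule that)
    next
      case False
      let ?m = "card J"
      let ?e = "?m ^ ?m * (2 ^ (length P - ?m) + 1) ^ (?m - 1)"
      from False obtain j0 where j0: "j0 \<in> J" "\<nexists>g. c j0 = fps_to_fls g" by blast
      have m: "1 \<le> ?m" "?m \<le> length P"
        using j0(1) finJ JP card_mono[of "{..<length P}" J] by (auto simp: Suc_le_eq card_gt_0_iff)
      have "card (J \<inter> {..l}) \<le> ?m" using finJ by (intro card_mono) auto
      moreover have "card ({..l} - J) \<le> card ({..<length P} - J)" using lP by (intro card_mono) auto
      moreover have "card ({..<length P} - J) = length P - ?m" using JP finJ by (simp add: card_Diff_subset)
      ultimately have "?e * card (J \<inter> {..l}) * 2 ^ card ({..l} - J) \<le> ?e * ?m * 2 ^ (length P - ?m)"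
        by (intro mult_le_mono[OF mult_le_mono[OF order_refl]] power_increasing) auto
      also have "\<dots> = ?m * 2 ^ (length P - ?m) * ?e" by (simp only: mult_ac)
      also have "\<dots> \<le> 2 ^ ((length P)\<^sup>2)" by (rule order_estimate[OF m])
      finally have "weight ?e P l \<le> 2 ^ ((length P)\<^sup>2)" using weight_le[OF P(1,2) lP, of ?e] by linarith
      with bounded_approx_pole[OF P(1,2) lP j0 reg] show ?thesis by (rule that)
    qed
    have "(2::nat) ^ ((length P)\<^sup>2) \<le> 2 ^ (?r\<^sup>2)"
      using P0(1) P(3) by (intro power_increasing power_mono) auto
    then have "weight e P l \<le> 2 ^ (?r\<^sup>2)" using e(2) by linarith
    moreover have "approx_complexity_order (weight e P l) n f \<le> 2 * ?r"
      using approx_complexity_order_le[OF e(1) P(2) lP assms] P0(1) P(3) by linarith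
    ultimately show ?thesis by blast
  qed
qed

end
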